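(* Consider the uncertain delayed followers, leader (exosystem), digraph $\bar{\mathcal G}$ and uncertainty vector $w$ described in the context. Assume: (i) there exist matrices $A,B,C$ with $A_i=A$, $B_i=B$, $C_i=C$ for $i=1,\dots,N$; (ii) all eigenvalues of $S$ are on the imaginary axis; (iii) $(A,B)$ is stabilizable; (iv) for every eigenvalue $\lambda$ of $S$, $\operatorname{rank}\begin{pmatrix}A-\lambda I_n & B\\ C&0\end{pmatrix}=n+p$; (v) $A$ has no eigenvalues with positive real part. Let $(G_1,G_2)$ be a minimal $p$-copy internal model of $S$, with $G_1\in\mathbb R^{n_z\times n_z}$. Then there exist matrices $K_x\in\mathbb R^{m\times n}$ and $K_z\in\mathbb R^{m\times n_z}$ such that the distributed dynamic state feedback control law $$u_i(t)=K_x\eta_i(t)+K_z z_i(t),\qquad \dot z_i(t)=G_1z_i(t)+G_2e_{vi}(t-\tau_{com}),\qquad i=1,\dots,N,$$ where $\eta_i(t)=\sum_{j\in\mathcal N_i}a_{ij}\big(x_i(t-\tau_{com})-x_j(t-\tau_{com})\big)$ with $x_0(t)\equiv 0$, solves the cooperative robust output regulation problem if and only if $\bar{\mathcal G}$ contains a directed spanning tree with node $0$ as the root. (That is, the existence of such $K_x,K_z$ is equivalent to the spanning tree condition.)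
   Context: Plant (followers), $i=1,\dots,N$: $\dot x_i(t)=\bar A_ix_i(t)+\bar B_iu_i(t-\tau_{con})+\bar E_iv(t)$, $y_i(t)=\bar C_ix_i(t)$, $t\ge0$, with $x_i\in\mathbb R^n$, $u_i\in\mathbb R^m$, $y_i\in\mathbb R^p$, input delay $\tau_{con}\ge0$. Exosystem (leader): $\dot v(t)=Sv(t)$, $v(0)=v_0$, $v\in\mathbb R^q$, $S\in\mathbb R^{q\times q}$ constant; $y_0(t)=-Fv(t)$ with $F\in\mathbb R^{p\times q}$. Regulated outputs: $e_i(t)=y_i(t)-y_0(t)$. The communication delay is $\tau_{com}\ge0$, and $\tau=\tau_{com}+\tau_{con}$. Uncertainty: $\bar A_i=A_i+\delta_iA$, $\bar B_i=B_i+\delta_iB$, $\bar E_i=E_i+\delta_iE$, $\bar C_i=C_i+\delta_iC$, where $A_i,B_i,E_i,C_i$ are the nominal matrices and the $\delta_i$ terms are constant unknown perturbations. The vector $w\in\mathbb R^{Nn(n+m+q)+Nnp}$ collects all entries of all $\delta_iA,\delta_iB,\delta_iE,\delta_iC$, $i=1,\dots,N$; nominal means $w=0$. Digraph: $\bar{\mathcal G}=(\bar{\mathcal V},\bar{\mathcal E})$ with $\bar{\mathcal V}=\{0,1,\dots,N\}$, node $0$ the exosystem, nodes $1,\dots,N$ the followers; no edge enters node $0$. $\mathcal N_i=\{j:(j,i)\in\bar{\mathcal E}\}$ is the neighbor set of node $i$. The weighted adjacency matrix $[a_{ij}]_{i,j=0}^N$ satisfies $a_{ii}=0$, $a_{ij}>0$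 if $(j,i)\in\bar{\mathcal E}$, and $a_{ij}=0$ otherwise. The virtual regulated outputs are $e_{vi}(t)=\sum_{j\in\mathcal N_i}a_{ij}(y_i(t)-y_j(t))$, $i=1,\dots,N$ (with $y_0(t)=-Fv(t)$ when $j=0$). Minimal $p$-copy internal model of $S$: a pair $G_1=\text{block diag}(\beta,\dots,\beta)$, $G_2=\text{block diag}(\sigma,\dots,\sigma)$ ($p$ copies each), where $\beta$ is a constant real square matrix whose characteristic polynomial equals the minimal polynomial of $S$, and $\sigma$ is a constant real column vector such that $(\beta,\sigma)$ is controllable. $n_z$ is the size of $G_1$. A control law solves the cooperative robust output regulation problem if the closed-loop system satisfies: (1) the nominal closed-loop system (i.e. $w=0$) is exponentially stable when $v=0$; (2) there is an open neighborhood $W$ of $w=0$ such that for every $w\in W$ and all initial conditions of plant, controller and exosystem, $\lim_{t\to\infty}e_i(t)=0$ for $i=1,\dots,N$. Initial data: the initial conditions of the $x_i$ and of the controller states are arbitrary continuous functions on $[-\tau,0]$, used to evaluate all delayed terms at negative times (with $v(t)=e^{St}v_0$ for all $t$). Exponential stability means that the norm of the closed-loop state is bounded by $\kappa e^{-\alpha t}$ times the supremum norm of the initial function, for some $\kappa,\alpha>0$. *)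

theory Defs
  imports "HOL-Analysis.Analysis" "HOL-Computational_Algebra.Polynomial"
begin

section \<open>Matrices and linear systems\<close>

text \<open>Complex eigenvalues of a real square matrix.\<close>

definition eigenvalues :: "real^'n^'n \<Rightarrow> complex set" where
  "eigenvalues M = {\<mu>. \<exists>x. x \<noteq> 0 \<and> map_matrix complex_of_real M *v x = \<mu> *s x}"

definition stabilizable :: "real^'n^'n \<Rightarrow> real^'m^'n \<Rightarrow> bool" where
  "stabilizable A B \<longleftrightarrow> (\<exists>K :: real^'n^'m. \<forall>\<mu> \<in> eigenvalues (A + B ** K). Re \<mu> < 0)"

text \<open>State-space controllability: any state can be steered to any other state in finite time.\<close>

definition controllable :: "real^'n^'n \<Rightarrow> real^'m^'n \<Rightarrow> bool" where
  "controllable A B \<longleftrightarrow>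
     (\<forall>\<xi>0 \<xi>1. \<exists>T>0. \<exists>u \<xi>. continuous_on {0..T} u \<and> \<xi> 0 = \<xi>0 \<and> \<xi> T = \<xi>1 \<and>
        (\<forall>t\<in>{0..T}. (\<xi> has_vector_derivative A *v \<xi> t + B *v u t) (at t within {0..T})))"

definition block_matrix ::
  "'a^'n^'k \<Rightarrow> 'a^'m^'k \<Rightarrow> 'a^'n^'l \<Rightarrow> 'a^'m^'l \<Rightarrow> 'a^('n + 'm)^('k + 'l)" where
  "block_matrix M11 M12 M21 M22 = (\<chi> i j.
     case i of
       Inl r \<Rightarrow> (case j of Inl c \<Rightarrow> M11 $ r $ c | Inr c \<Rightarrow> M12 $ r $ c)
     | Inr r \<Rightarrow> (case j of Inl c \<Rightarrow> M21 $ r $ c | Inr c \<Rightarrow> M22 $ r $ c))"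

definition char_polynomial :: "real^'n^'n \<Rightarrow> real poly" where
  "char_polynomial M = det (mat [:0, 1:] - map_matrix (\<lambda>c. [:c:]) M)"

text \<open>The type class power on \<open>real^'n^'n\<close> is the entrywise one, hence the iterated product.\<close>

definition matrix_poly :: "real poly \<Rightarrow> real^'n^'n \<Rightarrow> real^'n^'n" where
  "matrix_poly r M = (\<Sum>k\<le>degree r. coeff r k *\<^sub>R (((**) M) ^^ k) (mat 1))"

definition is_minimal_polynomial :: "real^'n^'n \<Rightarrow> real poly \<Rightarrow> bool" where
  "is_minimal_polynomial M r \<longleftrightarrow> lead_coeff r = 1 \<and> matrix_poly r M = 0 \<and>
     (\<forall>r'. r' \<noteq> 0 \<and> matrix_poly r' M = 0 \<longrightarrow> degree r \<le> degree r')"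

text \<open>
  \<open>copies M\<close> is block diag\<open>(M, ..., M)\<close> with one block for each element of \<open>'p\<close>.  Row \<open>(i, r)\<close> is
  row \<open>r\<close> of the \<open>i\<close>-th block, and similarly for columns.  The size of \<open>G1\<close> is
  \<open>n\<^sub>z = CARD('p \<times> 's)\<close>; the columns of \<open>G2\<close> are reindexed from \<open>'p \<times> 1\<close> to \<open>'p\<close>.
\<close>

definition copies :: "real^'c^'r \<Rightarrow> real^('p::finite \<times> 'c::finite)^('p \<times> 'r::finite)" where
  "copies M = (\<chi> i j. if fst i = fst j then M $ snd i $ snd j else 0)"

definition minimal_p_copy_internal_model ::
  "real^'q^'q \<Rightarrow> real^('p \<times> 's::finite)^('p \<times> 's) \<Rightarrow> real^'p^('p \<times> 's) \<Rightarrow> bool" where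
  "minimal_p_copy_internal_model S G1 G2 \<longleftrightarrow>
     (\<exists>(\<beta> :: real^'s^'s) (\<sigma> :: real^1^'s).
        G1 = copies \<beta> \<and> G2 = (\<chi> i j. copies \<sigma> $ i $ (j, 1)) \<and>
        is_minimal_polynomial S (char_polynomial \<beta>) \<and> controllable \<beta> \<sigma>)"

section \<open>The communication digraph\<close>

text \<open>
  The followers are indexed by the finite type \<open>'N\<close>, the nodes by \<open>'N option\<close>: \<open>None\<close> is node 0
  (the exosystem) and \<open>Some i\<close> is follower \<open>i\<close>.  An edge from \<open>j\<close> to \<open>i\<close> is the pair \<open>(j, i)\<close>.
\<close>

definition neighbors :: "('v \<times> 'v) set \<Rightarrow> 'v \<Rightarrow> 'v set" where
  "neighbors Ed i = {j. (j, i) \<in> Ed}"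

definition weighted_adjacency :: "('v \<times> 'v) set \<Rightarrow> ('v \<Rightarrow> 'v \<Rightarrow> real) \<Rightarrow> bool" where
  "weighted_adjacency Ed a \<longleftrightarrow>
     (\<forall>i. a i i = 0) \<and> (\<forall>i j. if (j, i) \<in> Ed then a i j > 0 else a i j = 0)"

text \<open>
  A directed tree: every node has exactly one parent, except the root, which has none and from
  which every node is reachable.
\<close>

definition directed_tree :: "('v \<times> 'v) set \<Rightarrow> 'v \<Rightarrow> bool" where
  "directed_tree T r \<longleftrightarrow>
     (\<forall>j. (j, r) \<notin> T) \<and> (\<forall>i. i \<noteq> r \<longrightarrow> (\<exists>!j. (j, i) \<in> T)) \<and> (\<forall>i. (r, i) \<in> T\<^sup>*)"

definition contains_directed_spanning_tree :: "('v \<times> 'v) set \<Rightarrow> 'v \<Rightarrow> bool" where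
  "contains_directed_spanning_tree Ed r \<longleftrightarrow> (\<exists>T \<subseteq> Ed. directed_tree T r)"

text \<open>\<open>\<Sum>\<^bsub>j \<in> N\<^sub>i\<^esub> a\<^sub>i\<^sub>j (\<xi>\<^sub>i - \<xi>\<^sub>j)\<close> for a quantity \<open>\<xi>\<close> attached to the nodes.\<close>

definition relative_sum ::
  "('v \<times> 'v) set \<Rightarrow> ('v \<Rightarrow> 'v \<Rightarrow> real) \<Rightarrow> ('v \<Rightarrow> 'b::real_vector) \<Rightarrow> 'v \<Rightarrow> 'b" where
  "relative_sum Ed a \<xi> i = (\<Sum>j \<in> neighbors Ed i. a i j *\<^sub>R (\<xi> i - \<xi> j))"

section \<open>Plant and closed loop\<close>

text \<open>
  The matrices \<open>(A\<^sub>i, B\<^sub>i, E\<^sub>i, C\<^sub>i)\<close> of all followers.  The uncertainty \<open>w\<close> has the same type: it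
  consists of all entries of \<open>\<delta>\<^sub>iA\<close>, \<open>\<delta>\<^sub>iB\<close>, \<open>\<delta>\<^sub>iE\<close>, \<open>\<delta>\<^sub>iC\<close>, with the Euclidean topology, and the
  uncertain plant is \<open>P + w\<close>.
\<close>

type_synonym ('n, 'm, 'p, 'q, 'N) plant =
  "(real^'n^'n^'N) \<times> (real^'m^'n^'N) \<times> (real^'q^'n^'N) \<times> (real^'n^'p^'N)"

lemma DIM_plant:
  "DIM(('n::finite, 'm::finite, 'p::finite, 'q::finite, 'N::finite) plant) =
     CARD('N) * CARD('n) * (CARD('n) + CARD('m) + CARD('q)) + CARD('N) * CARD('n) * CARD('p)"
  by (simp add: algebra_simps)

definition node_output ::
  "real^'n^'p^'N \<Rightarrow> real^'q^'p \<Rightarrow> (real \<Rightarrow> real^'n^'N) \<Rightarrow> (real \<Rightarrow> real^'q)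
     \<Rightarrow> real \<Rightarrow> 'N option \<Rightarrow> real^'p" where
  "node_output C F x v t j = (case j of None \<Rightarrow> - (F *v v t) | Some k \<Rightarrow> (C $ k) *v (x t $ k))"

definition regulated_error ::
  "real^'n^'p^'N \<Rightarrow> real^'q^'p \<Rightarrow> (real \<Rightarrow> real^'n^'N) \<Rightarrow> (real \<Rightarrow> real^'q)
     \<Rightarrow> 'N \<Rightarrow> real \<Rightarrow> real^'p" where
  "regulated_error C F x v i t = node_output C F x v t (Some i) - node_output C F x v t None"

definition virtual_error ::
  "('N option \<times> 'N option) set \<Rightarrow> ('N option \<Rightarrow> 'N option \<Rightarrow> real)
     \<Rightarrow> real^'n^'p^'N \<Rightarrow> real^'q^'p \<Rightarrow> (real \<Rightarrow> real^'n^'N) \<Rightarrow> (real \<Rightarrow> real^'q)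
     \<Rightarrow> 'N \<Rightarrow> real \<Rightarrow> real^'p" where
  "virtual_error Ed a C F x v i t = relative_sum Ed a (node_output C F x v t) (Some i)"

definition relative_state ::
  "('N option \<times> 'N option) set \<Rightarrow> ('N option \<Rightarrow> 'N option \<Rightarrow> real) \<Rightarrow> real
     \<Rightarrow> (real \<Rightarrow> real^'n^'N) \<Rightarrow> 'N \<Rightarrow> real \<Rightarrow> real^'n" where
  "relative_state Ed a \<tau>com x i t =
     relative_sum Ed a (\<lambda>j. case j of None \<Rightarrow> 0 | Some k \<Rightarrow> x (t - \<tau>com) $ k) (Some i)"

definition control ::
  "('N option \<times> 'N option) set \<Rightarrow> ('N option \<Rightarrow> 'N option \<Rightarrow> real) \<Rightarrow> real
     \<Rightarrow> real^'n^'m \<Rightarrow> real^'z^'m \<Rightarrow> (real \<Rightarrow> real^'n^'N) \<Rightarrow> (real \<Rightarrow> real^'z^'N)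
     \<Rightarrow> 'N \<Rightarrow> real \<Rightarrow> real^'m" where
  "control Ed a \<tau>com Kx Kz x z i t =
     Kx *v relative_state Ed a \<tau>com x i t + Kz *v (z t $ i)"

text \<open>
  \<open>(x, z, v)\<close> is a trajectory of plant, controller and exosystem.  The restrictions of \<open>x\<close> and \<open>z\<close>
  to \<open>[-\<tau>, 0]\<close> with \<open>\<tau> = \<tau>com + \<tau>con\<close> are the (arbitrary continuous) initial functions; at
  \<open>t = 0\<close> only the right derivative is constrained.  The exosystem equation is required on all of
  \<open>\<real>\<close>, which means \<open>v(t) = e\<^sup>S\<^sup>t v(0)\<close> at negative times as well.
\<close>

definition closed_loop ::
  "('n, 'm, 'p, 'q, 'N::finite) plant \<Rightarrow> real^'q^'q \<Rightarrow> real^'q^'p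
     \<Rightarrow> ('N option \<times> 'N option) set \<Rightarrow> ('N option \<Rightarrow> 'N option \<Rightarrow> real) \<Rightarrow> real \<Rightarrow> real
     \<Rightarrow> real^'z^'z \<Rightarrow> real^'p^'z \<Rightarrow> real^'n^'m \<Rightarrow> real^'z^'m
     \<Rightarrow> (real \<Rightarrow> real^'n^'N) \<Rightarrow> (real \<Rightarrow> real^'z^'N) \<Rightarrow> (real \<Rightarrow> real^'q) \<Rightarrow> bool" where
  "closed_loop P S F Ed a \<tau>com \<tau>con G1 G2 Kx Kz x z v \<longleftrightarrow>
     (case P of (A, B, E, C) \<Rightarrow>
        (\<forall>t. (v has_vector_derivative S *v v t) (at t)) \<and>
        continuous_on {- (\<tau>com + \<tau>con)..} x \<and>
        continuous_on {- (\<tau>com + \<tau>con)..} z \<and>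
        (\<forall>i. \<forall>t\<ge>0.
           ((\<lambda>s. x s $ i) has_vector_derivative
              (A $ i) *v (x t $ i) + (B $ i) *v control Ed a \<tau>com Kx Kz x z i (t - \<tau>con)
              + (E $ i) *v v t) (at t within {0..}) \<and>
           ((\<lambda>s. z s $ i) has_vector_derivative
              G1 *v (z t $ i) + G2 *v virtual_error Ed a C F x v i (t - \<tau>com))
              (at t within {0..})))"

definition exponentially_stable ::
  "('n, 'm, 'p, 'q, 'N::finite) plant \<Rightarrow> real^'q^'q \<Rightarrow> real^'q^'p
     \<Rightarrow> ('N option \<times> 'N option) set \<Rightarrow> ('N option \<Rightarrow> 'N option \<Rightarrow> real) \<Rightarrow> real \<Rightarrow> real
     \<Rightarrow> real^'z^'z \<Rightarrow> real^'p^'z \<Rightarrow> real^'n^'m \<Rightarrow> real^'z^'m \<Rightarrow> bool" where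
  "exponentially_stable P S F Ed a \<tau>com \<tau>con G1 G2 Kx Kz \<longleftrightarrow>
     (\<exists>\<kappa>>0. \<exists>\<alpha>>0. \<forall>x z. closed_loop P S F Ed a \<tau>com \<tau>con G1 G2 Kx Kz x z (\<lambda>_. 0) \<longrightarrow>
        (\<forall>t\<ge>0. norm (x t, z t) \<le>
           \<kappa> * exp (- \<alpha> * t) * (SUP s\<in>{- (\<tau>com + \<tau>con)..0}. norm (x s, z s))))"

definition solves_cooperative_robust_output_regulation ::
  "('n, 'm, 'p, 'q, 'N::finite) plant \<Rightarrow> real^'q^'q \<Rightarrow> real^'q^'p
     \<Rightarrow> ('N option \<times> 'N option) set \<Rightarrow> ('N option \<Rightarrow> 'N option \<Rightarrow> real) \<Rightarrow> real \<Rightarrow> real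
     \<Rightarrow> real^'z^'z \<Rightarrow> real^'p^'z \<Rightarrow> real^'n^'m \<Rightarrow> real^'z^'m \<Rightarrow> bool" where
  "solves_cooperative_robust_output_regulation P S F Ed a \<tau>com \<tau>con G1 G2 Kx Kz \<longleftrightarrow>
     exponentially_stable P S F Ed a \<tau>com \<tau>con G1 G2 Kx Kz \<and>
     (\<exists>W :: ('n, 'm, 'p, 'q, 'N) plant set. open W \<and> 0 \<in> W \<and>
        (\<forall>w\<in>W. \<forall>x z v. closed_loop (P + w) S F Ed a \<tau>com \<tau>con G1 G2 Kx Kz x z v \<longrightarrow>
           (\<forall>i. (regulated_error (snd (snd (snd (P + w)))) F x v i \<longlongrightarrow> 0) at_top)))"

end

theory Submission imports Defs "HOL-Computational_Algebra.Fundamental_Theorem_Algebra" begin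

text \<open>
  Let \<open>H\<close> be the grounded Laplacian of the followers (the graph Laplacian with row and column of the leader
  deleted) and \<open>\<tau> = \<tau>com + \<tau>con\<close>.

  For necessity, suppose that the set \<open>R\<close> of followers that node 0 does not reach is nonempty. No edge enters
  \<open>R\<close> from outside, so the relative sums of the followers in \<open>R\<close> vanish as soon as all states in \<open>R\<close> agree.
  On such states the internal models run freely and feel no error. All eigenvalues of \<open>G1\<close> are eigenvalues of
  \<open>S\<close>, hence purely imaginary. Thus for every choice of gains the nominal closed loop has
  a mode \<open>exp (\<mu> t) Y\<close> with \<open>Re \<mu> = 0\<close> (\<open>critical_mode\<close>, \<open>mode_trajectory\<close>), which does not decay
  (\<open>stable_imp_spanning_tree\<close>).

  Conversely, if node 0 reaches every follower, \<open>H\<close> is invertible. The advanced and mixed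
  internal-model states \<open>\<zeta>(t) = H\<^sup>-\<^sup>1 z(t + \<tau>com)\<close> satisfy \<open>\<zeta>\<^sub>i' = G1 \<zeta>\<^sub>i + G2 e\<^sub>i\<close>: every follower now drives
  its own internal model by its own regulated error. The input that reaches plant \<open>i\<close> at time \<open>t\<close> becomes
  \<open>\<Sum>\<^sub>j H\<^sub>i\<^sub>j K(x\<^sub>j, \<zeta>\<^sub>j)(t - \<tau>)\<close>. The closed loop consists of \<open>N\<close> equal copies of the augmented
  plant (plant and internal model), coupled through \<open>H\<close> in the input only and with the single delay \<open>\<tau>\<close>
  (\<open>closed_loop_internal_state\<close>).

  Stability comes from low gain. The rank condition and stabilizability of \<open>(A, B)\<close> make the augmented plant
  \<open>(Y, B)\<close> stabilizable, and it has no
  eigenvalue in the open right half plane (\<open>augmented_eigenpairs\<close>). Therefore the Lyapunov inequality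
  \<open>2 <P x, Y x> \<le> |B\<^sup>T P x|\<^sup>2 - \<epsilon> |x|\<^sup>2\<close> has positive definite solutions \<open>P\<close> of arbitrarily small norm
  (\<open>low_gain\<close>). Since \<open>H\<close> is a nonsingular M-matrix, a positive diagonal matrix \<open>D\<close> makes \<open>D H + H\<^sup>T D\<close> positive
  definite (\<open>grounded_laplacian_lyapunov\<close>). The feedback is the truncated predictor
  \<open>K = - \<mu> B\<^sup>T P exp (\<tau> Y)\<close>, which replaces the current state by the free evolution of the delayed one. The error of
  this prediction is an integral of past inputs and perturbations over a window of length \<open>\<tau>\<close>. A small gain makes it harmless: a
  Lyapunov-Krasovskii functional, \<open>D \<otimes> P\<close> plus a weighted integral over the window, decays exponentially with a
  margin that absorbs every small perturbation of the plant (\<open>delay_lyapunov\<close>, \<open>network_decay\<close>).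

  Regulation comes from the internal model. Let \<open>m\<close> be the minimal polynomial of \<open>S\<close>, which is the characteristic polynomial of
  the block \<open>\<beta>\<close> of \<open>G1\<close>. The operator \<open>m(d/dt)\<close> annihilates the exosystem signal, so \<open>m(d/dt)\<close> applied to a perturbed
  trajectory solves the perturbed loop without exosystem and decays (\<open>derivative_sequence\<close>,
  \<open>annihilated_combination\<close>, \<open>perturbed_decay\<close>). By the Cayley-Hamilton theorem and controllability of \<open>(\<beta>, \<sigma>)\<close>
  there is a row vector \<open>c\<close> such that \<open>c m(d/dt) \<zeta> = e\<close> for every solution of \<open>\<zeta>' = \<beta> \<zeta> + \<sigma> e\<close>
  (\<open>internal_model_readout\<close>). Hence the regulated errors tend to zero, whatever the small perturbation is
  (\<open>perturbed_regulation\<close>).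
\<close>

section \<open>The exponential of a linear map\<close>

text \<open>
  The operator exponential is to be the exponential of a Banach algebra. This copy of the bounded linear functions
  from a Euclidean space to itself serves only to carry composition as its product.
\<close>

typedef (overloaded) 'a endo = "UNIV :: ('a::euclidean_space \<Rightarrow>\<^sub>L 'a) set"
  morphisms rep_endo endo ..

setup_lifting type_definition_endo

instantiation endo :: (euclidean_space) real_normed_algebra_1
begin

lift_definition zero_endo :: "'a endo" is 0 .
lift_definition one_endo :: "'a endo" is id_blinfun .
lift_definition plus_endo :: "'a endo \<Rightarrow> 'a endo \<Rightarrow> 'a endo" is "(+)" .
lift_definition minus_endo :: "'a endo \<Rightarrow> 'a endo \<Rightarrow> 'a endo" is "(-)" .
lift_definition uminus_endo :: "'a endo \<Rightarrow> 'a endo" is uminus .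
lift_definition times_endo :: "'a endo \<Rightarrow> 'a endo \<Rightarrow> 'a endo" is "(o\<^sub>L)" .
lift_definition scaleR_endo :: "real \<Rightarrow> 'a endo \<Rightarrow> 'a endo" is "scaleR" .
lift_definition norm_endo :: "'a endo \<Rightarrow> real" is norm .
definition dist_endo :: "'a endo \<Rightarrow> 'a endo \<Rightarrow> real" where "dist_endo x y = norm (x - y)"
definition sgn_endo :: "'a endo \<Rightarrow> 'a endo" where "sgn_endo x = scaleR (inverse (norm x)) x"
definition uniformity_endo :: "('a endo \<times> 'a endo) filter" where
  "uniformity_endo = (INF e\<in>{0 <..}. principal {(x, y). dist x y < e})"
definition open_endo :: "'a endo set \<Rightarrow> bool" where
  "open_endo S = (\<forall>x\<in>S. \<forall>\<^sub>F (x', y) in uniformity. x' = x \<longrightarrow> y \<in> S)"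

instance
proof
  fix x y z :: "'a endo" and a b :: real
  show "x + y + z = x + (y + z)" "x + y = y + x" "0 + x = x" "- x + x = 0" "x - y = x + - y"
    "a *\<^sub>R (x + y) = a *\<^sub>R x + a *\<^sub>R y" "(a + b) *\<^sub>R x = a *\<^sub>R x + b *\<^sub>R x"
    "a *\<^sub>R b *\<^sub>R x = (a * b) *\<^sub>R x" "1 *\<^sub>R x = x"
    "norm x = 0 \<longleftrightarrow> x = 0" "norm (a *\<^sub>R x) = \<bar>a\<bar> * norm x"
    by (transfer; simp add: algebra_simps)+
  show "x * y * z = x * (y * z)" "(x + y) * z = x * z + y * z" "x * (y + z) = x * y + x * z"
    "1 * x = x" "x * 1 = x" "a *\<^sub>R x * y = a *\<^sub>R (x * y)" "x * a *\<^sub>R y = a *\<^sub>R (x * y)"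
    by (transfer; auto intro!: blinfun_eqI simp: blinfun.bilinear_simps)+
  show "norm (x + y) \<le> norm x + norm y" by transfer (rule norm_triangle_ineq)
  show "norm (x * y) \<le> norm x * norm y" by transfer (rule norm_blinfun_compose)
  show "norm (1 :: 'a endo) = 1" by transfer simp
  show "(0 :: 'a endo) \<noteq> 1"
    by transfer (metis norm_blinfun_id norm_zero zero_neq_one)
qed (simp_all add: dist_endo_def sgn_endo_def uniformity_endo_def open_endo_def)

end

instance endo :: (euclidean_space) banach
proof
  fix X :: "nat \<Rightarrow> 'a endo" assume X: "Cauchy X"
  have "Cauchy (\<lambda>n. rep_endo (X n))"
    using X by (simp add: Cauchy_def dist_norm norm_endo.rep_eq minus_endo.rep_eq)
  then obtain L where L: "(\<lambda>n. rep_endo (X n)) \<longlonglongrightarrow> L"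
    using Cauchy_convergent_iff convergent_def by blast
  have "X \<longlonglongrightarrow> endo L"
    using L by (simp add: LIMSEQ_iff norm_endo.rep_eq minus_endo.rep_eq endo_inverse)
  then show "convergent X" by (auto simp: convergent_def)
qed

definition flow :: "('a::euclidean_space \<Rightarrow> 'a) \<Rightarrow> real \<Rightarrow> 'a \<Rightarrow> 'a" where
  "flow M t = blinfun_apply (rep_endo (exp (t *\<^sub>R endo (Blinfun M))))"

lemma bounded_linear_rep_endo_apply: "bounded_linear (\<lambda>X. blinfun_apply (rep_endo X) w)"
  by (rule bounded_linear_intro[where K = "norm w"])
     (auto simp: plus_endo.rep_eq scaleR_endo.rep_eq norm_endo.rep_eq blinfun.bilinear_simps
        mult.commute[of "norm w"] intro: norm_blinfun)

lemma rep_endo_Blinfun: "linear M \<Longrightarrow> blinfun_apply (rep_endo (endo (Blinfun M))) w = M w"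
  by (simp add: endo_inverse bounded_linear_Blinfun_apply linear_conv_bounded_linear)

lemma linear_flow [simp]: "linear (flow M t)"
  unfolding flow_def by (simp add: bounded_linear.linear blinfun.bounded_linear_right)

lemma flow_0 [simp]: "flow M 0 w = w"
  by (simp add: flow_def one_endo.rep_eq)

lemma flow_add: "flow M (s + t) w = flow M s (flow M t w)"
proof -
  have "exp ((s + t) *\<^sub>R X) = exp (s *\<^sub>R X) * exp (t *\<^sub>R X)" for X :: "'a endo"
    unfolding scaleR_add_left by (rule exp_add_commuting) (simp add: mult.commute)
  then show ?thesis by (simp add: flow_def times_endo.rep_eq)
qed

lemma flow_minus_cancel [simp]: "flow M (- t) (flow M t w) = w" "flow M t (flow M (- t) w) = w"
  using flow_add[of M "- t" t w] flow_add[of M t "- t" w] by simp_all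

lemma flow_has_vector_derivative:
  assumes "linear M"
  shows "((\<lambda>t. flow M t w) has_vector_derivative M (flow M t w)) (at t within S)"
proof -
  let ?X = "endo (Blinfun M)"
  have "((\<lambda>t. exp (t *\<^sub>R ?X)) has_vector_derivative ?X * exp (t *\<^sub>R ?X)) (at t within S)"
    using exp_scaleR_has_vector_derivative_left has_vector_derivative_at_within by blast
  from bounded_linear.has_vector_derivative[OF bounded_linear_rep_endo_apply this, of w]
  show ?thesis
    using assms by (simp add: flow_def times_endo.rep_eq rep_endo_Blinfun)
qed

lemma flow_commute:
  assumes "linear M"
  shows "flow M t (M w) = M (flow M t w)"
proof -
  let ?X = "endo (Blinfun M)"
  have "exp (t *\<^sub>R ?X) * ?X = ?X * exp (t *\<^sub>R ?X)"
    by (rule exp_times_scaleR_commute)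
  then have "rep_endo (exp (t *\<^sub>R ?X) * ?X) w = rep_endo (?X * exp (t *\<^sub>R ?X)) w"
    by simp
  then show ?thesis
    using assms by (simp add: flow_def times_endo.rep_eq rep_endo_Blinfun)
qed

lemma continuous_on_flow:
  assumes "linear M" "continuous_on S f"
  shows "continuous_on S (\<lambda>t. flow M (f t) w)"
proof -
  have "continuous_on UNIV (\<lambda>t. flow M t w)"
    using flow_has_vector_derivative[OF assms(1)]
    by (meson continuous_on_eq_continuous_within has_vector_derivative_continuous)
  then show ?thesis
    using continuous_on_compose2[OF _ assms(2)] by auto
qed

section \<open>Eigenpairs of real linear maps\<close>

text \<open>
  \<open>p(M) w\<close> by Horner's scheme, so that induction over \<open>pCons\<close> applies.
\<close>

definition poly_act :: "real poly \<Rightarrow> ('a::euclidean_space \<Rightarrow> 'a) \<Rightarrow> 'a \<Rightarrow> 'a" where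
  "poly_act p M w = fold_coeffs (\<lambda>a y. a *\<^sub>R w + M y) p 0"

lemma poly_act_0 [simp]: "poly_act 0 M w = 0"
  by (simp add: poly_act_def)

lemma poly_act_pCons [simp]:
  "linear M \<Longrightarrow> poly_act (pCons a p) M w = a *\<^sub>R w + M (poly_act p M w)"
  by (cases "p = 0 \<and> a = 0") (auto simp: poly_act_def linear_0)

lemma poly_act_add: "linear M \<Longrightarrow> poly_act (p + q) M w = poly_act p M w + poly_act q M w"
proof (induction p arbitrary: q rule: pCons_induct)
  case (pCons a p)
  then show ?case by (cases q) (simp add: linear_add algebra_simps)
qed simp

lemma poly_act_smult: "linear M \<Longrightarrow> poly_act (smult c p) M w = c *\<^sub>R poly_act p M w"
  by (induction p rule: pCons_induct) (simp_all add: linear_cmul algebra_simps)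

lemma linear_poly_act: "linear M \<Longrightarrow> linear (poly_act p M)"
  by (induction p rule: pCons_induct)
     (auto simp: linear_iff algebra_simps)

lemma poly_act_mult: "linear M \<Longrightarrow> poly_act (p * q) M w = poly_act p M (poly_act q M w)"
  by (induction p rule: pCons_induct) (simp_all add: poly_act_add poly_act_smult)

lemma poly_act_commute: "linear M \<Longrightarrow> poly_act p M (M w) = M (poly_act p M w)"
  by (induction p rule: pCons_induct) (simp_all add: linear_add linear_cmul linear_0)

lemma poly_act_in_subspace:
  assumes "linear M" "subspace U" "\<And>w. w \<in> U \<Longrightarrow> M w \<in> U" "w \<in> U"
  shows "poly_act p M w \<in> U"
  using assms(2-)
  by (induction p rule: pCons_induct) (simp_all add: assms(1) subspace_0 subspace_add subspace_scale)

lemma poly_act_sum: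
  assumes "linear M"
  shows "poly_act p M w = (\<Sum>k\<le>degree p. coeff p k *\<^sub>R (M ^^ k) w)"
proof (induction p rule: pCons_induct)
  case (pCons a p)
  show ?case
  proof (cases "p = 0")
    case False
    then show ?thesis
      using pCons assms
      by (simp add: sum.atMost_Suc_shift linear_sum linear_cmul del: sum.atMost_Suc)
  qed (simp add: assms linear_0)
qed simp

text \<open>
  The \<open>DIM('a) + 1\<close> vectors \<open>M\<^sup>k w\<close> are linearly dependent.
\<close>

lemma exists_annihilator:
  fixes M :: "'a::euclidean_space \<Rightarrow> 'a"
  assumes M: "linear M"
  shows "\<exists>p. p \<noteq> 0 \<and> poly_act p M w = 0"
proof -
  let ?f = "\<lambda>k. (M ^^ k) w"
  have mon: "poly_act (monom c k) M w = c *\<^sub>R (M ^^ k) w" for c k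
    by (induction k) (simp_all add: monom_0 monom_Suc M linear_0 linear_cmul)
  show ?thesis
  proof (cases "inj_on ?f {..DIM('a)}")
    case False
    then obtain i j where "i \<noteq> j" "?f i = ?f j" by (auto simp: inj_on_def)
    then have "monom 1 i - monom 1 j \<noteq> (0 :: real poly)"
      by (metis (no_types) eq_iff_diff_eq_0 monom_eq_iff' zero_neq_one)
    moreover have "poly_act (monom 1 i - monom 1 j) M w = 0"
      using poly_act_add[OF M, of "monom 1 i - monom 1 j" "monom 1 j" w] \<open>?f i = ?f j\<close>
      by (simp add: mon)
    ultimately show ?thesis by blast
  next
    case True
    then have "card (?f ` {..DIM('a)}) > DIM('a)"
      by (simp add: card_image)
    then have "dependent (?f ` {..DIM('a)})"
      using independent_bound_general by (metis dim_subset_UNIV leD le_trans independent_card_le_dim order_refl)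
    then obtain u where u: "\<exists>v\<in>?f ` {..DIM('a)}. u v \<noteq> 0"
      "(\<Sum>v\<in>?f ` {..DIM('a)}. u v *\<^sub>R v) = 0"
      by (auto simp: dependent_finite)
    define p where "p = (\<Sum>k\<le>DIM('a). monom (u (?f k)) k)"
    have act: "poly_act (\<Sum>k\<in>I. monom (c k) k) M w = (\<Sum>k\<in>I. c k *\<^sub>R ?f k)" if "finite I" for I c
      using that by (induction I rule: finite_induct) (simp_all add: poly_act_add M mon)
    have "poly_act p M w = 0"
      using u(2) by (simp add: p_def act sum.reindex[OF True])
    moreover obtain k where k: "k \<le> DIM('a)" "u (?f k) \<noteq> 0" using u(1) by auto
    have "coeff p k = u (?f k)"
      using k by (simp add: p_def coeff_sum coeff_monom if_distrib cong: if_cong)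
    with k have "p \<noteq> 0" by auto
    ultimately show ?thesis by blast
  qed
qed

text \<open>
  \<open>u + i v\<close> is an eigenvector of the complexification of \<open>M\<close> for the eigenvalue \<open>a + i b\<close>, written with real
  vectors so that invariant subspaces and inner products stay real.
\<close>

definition eigenpair :: "('a::euclidean_space \<Rightarrow> 'a) \<Rightarrow> real \<Rightarrow> real \<Rightarrow> 'a \<Rightarrow> 'a \<Rightarrow> bool" where
  "eigenpair M a b u v \<longleftrightarrow>
     (u \<noteq> 0 \<or> v \<noteq> 0) \<and> M u = a *\<^sub>R u - b *\<^sub>R v \<and> M v = b *\<^sub>R u + a *\<^sub>R v"

text \<open>
  The minimal polynomial over the reals of the complex number \<open>z\<close>.
\<close>

definition root_factor :: "complex \<Rightarrow> real poly" where
  "root_factor z = (if Im z = 0 then [:- Re z, 1:] else [:(Re z)\<^sup>2 + (Im z)\<^sup>2, - 2 * Re z, 1:])"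

lemma root_factor_nonzero [simp]: "root_factor z \<noteq> 0"
  and degree_root_factor_pos: "degree (root_factor z) > 0"
  by (simp_all add: root_factor_def)

lemma poly_map_complex_of_real:
  "poly (map_poly complex_of_real p) (complex_of_real x) = complex_of_real (poly p x)"
  by (induction p) (simp_all add: map_poly_pCons)

text \<open>
  The remainder of \<open>p\<close> modulo the quadratic factor is a real polynomial of degree at most one that vanishes
  at a non-real point, hence zero.
\<close>

lemma root_factor_dvd:
  fixes p :: "real poly"
  assumes z: "poly (map_poly complex_of_real p) z = 0"
  shows "root_factor z dvd p"
proof (cases "Im z = 0")
  case True
  then have "complex_of_real (Re z) = z" by (simp add: complex_eq_iff)
  then have "poly p (Re z) = 0"
    using z poly_map_complex_of_real[of p "Re z"] by simp
  then show ?thesis using True by (simp add: root_factor_def poly_eq_0_iff_dvd)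
next
  case False
  define f where "f = root_factor z"
  have deg: "degree (p mod f) < 2"
    using degree_mod_less'[of f p] False by (cases "p mod f = 0") (auto simp: f_def root_factor_def)
  have "poly (map_poly complex_of_real f) z = 0"
    using False by (simp add: f_def root_factor_def map_poly_pCons complex_eq_iff power2_eq_square
        algebra_simps)
  moreover have hom: "map_poly complex_of_real (q * r + s)
      = map_poly complex_of_real q * map_poly complex_of_real r + map_poly complex_of_real s" for q r s
    by (rule poly_eqI) (simp add: coeff_map_poly coeff_mult)
  ultimately have "poly (map_poly complex_of_real (p mod f)) z = 0"
    using z arg_cong[OF hom[of "p div f" f "p mod f"], of "\<lambda>p. poly p z"] by simp
  moreover obtain c d where cd: "p mod f = [:c, d:]"
    using deg by (metis degree_pCons_eq_if less_2_cases_iff pCons_cases One_nat_def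
        Suc_less_eq degree_0_id degree_eq_zeroE less_one pCons_0_0 less_Suc_eq_0_disj
        not_less_eq numeral_2_eq_2 zero_less_Suc)
  ultimately have "c = 0 \<and> d = 0"
    using False by (auto simp: map_poly_pCons complex_eq_iff)
  then show ?thesis using cd by (simp add: f_def mod_eq_0_iff_dvd)
qed

lemma exists_root_factor:
  fixes p :: "real poly"
  assumes "degree p > 0"
  obtains z r where "p = root_factor z * r"
proof -
  have "degree (map_poly complex_of_real p) > 0" using assms by (simp add: degree_map_poly)
  then obtain z where "poly (map_poly complex_of_real p) z = 0"
    using fundamental_theorem_of_algebra[of "map_poly complex_of_real p"]
    by (auto simp: constant_degree)
  from root_factor_dvd[OF this] show thesis using that by (auto simp: dvd_def)
qed

text \<open>
  The second vector is the only possible one: \<open>M w = a w - b v\<close> has to be solved for \<open>v\<close>.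
\<close>

lemma eigenpair_of_root_factor:
  assumes "linear M" "w \<noteq> 0" "poly_act (root_factor z) M w = 0"
  shows "eigenpair M (Re z) (Im z) w
           (if Im z = 0 then 0 else (1 / Im z) *\<^sub>R (Re z *\<^sub>R w - M w))"
proof (cases "Im z = 0")
  case True
  then show ?thesis using assms
    by (simp add: eigenpair_def root_factor_def linear_0)
next
  case False
  define a b where "a = Re z" and "b = Im z"
  have b: "b \<noteq> 0" using False by (simp add: b_def)
  have "(a\<^sup>2 + b\<^sup>2) *\<^sub>R w + M ((- 2 * a) *\<^sub>R w + M w) = 0"
    using assms(1,3) False unfolding root_factor_def a_def b_def by (simp add: linear_0)
  then have MM: "M (M w) = a *\<^sub>R M w + a *\<^sub>R M w - (a\<^sup>2 + b\<^sup>2) *\<^sub>R w"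
    using assms(1) by (simp add: linear_add linear_cmul linear_diff algebra_simps add_eq_0_iff flip: scaleR_2)
  have "b *\<^sub>R M ((1 / b) *\<^sub>R (a *\<^sub>R w - M w)) = a *\<^sub>R M w - M (M w)"
    using assms(1) b by (simp add: linear_cmul linear_diff)
  also have "\<dots> = b *\<^sub>R (b *\<^sub>R w + a *\<^sub>R (1 / b) *\<^sub>R (a *\<^sub>R w - M w))"
    using b unfolding MM by (simp add: algebra_simps power2_eq_square)
  finally have "M ((1 / b) *\<^sub>R (a *\<^sub>R w - M w)) = b *\<^sub>R w + a *\<^sub>R (1 / b) *\<^sub>R (a *\<^sub>R w - M w)"
    using b by simp
  then show ?thesis
    using False b assms(2) by (simp add: eigenpair_def flip: a_def b_def)
qed

text \<open>
  An annihilator of a nonzero vector, of least degree, has a factor \<open>root_factor z\<close>; the cofactor applied to the vector is nonzero and is killed by that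
  factor. Below, the vectors with some undesired behaviour form an invariant subspace, which is
  therefore trivial if no eigenpair behaves in this way.
\<close>

lemma exists_eigenpair:
  assumes M: "linear M" and U: "subspace U" "\<And>w. w \<in> U \<Longrightarrow> M w \<in> U" and w: "w \<in> U" "w \<noteq> 0"
  shows "\<exists>a b. \<exists>u\<in>U. \<exists>v\<in>U. eigenpair M a b u v"
proof -
  define p where "p = arg_min degree (\<lambda>p. p \<noteq> 0 \<and> poly_act p M w = 0)"
  have p: "p \<noteq> 0" "poly_act p M w = 0"
    and min: "\<And>r. r \<noteq> 0 \<Longrightarrow> poly_act r M w = 0 \<Longrightarrow> degree p \<le> degree r"
    using arg_min_nat_lemma[of "\<lambda>p. p \<noteq> 0 \<and> poly_act p M w = 0" _ degree] exists_annihilator[OF M, of w]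
    unfolding p_def by blast+
  have "degree p > 0"
  proof (rule ccontr)
    assume "\<not> degree p > 0"
    then obtain c where "p = [:c:]" using degree_eq_zeroE[of p] by auto
    then show False using p w M by (auto simp: linear_0)
  qed
  then obtain z r where pr: "p = root_factor z * r" by (rule exists_root_factor)
  then have "r \<noteq> 0" "degree r < degree p"
    using p(1) degree_mult_eq[of "root_factor z" r] degree_root_factor_pos[of z] by auto
  then have nz: "poly_act r M w \<noteq> 0" using min by fastforce
  have mem: "poly_act r M w \<in> U" by (rule poly_act_in_subspace[OF M U w(1)])
  have "poly_act (root_factor z) M (poly_act r M w) = 0"
    using p(2) by (simp add: pr poly_act_mult M)
  note e = eigenpair_of_root_factor[OF M nz this]
  have "(if Im z = 0 then 0 else (1 / Im z) *\<^sub>R (Re z *\<^sub>R poly_act r M w - M (poly_act r M w))) \<in> U"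
    using mem U by (auto intro!: subspace_scale subspace_diff simp: subspace_0)
  with e mem show ?thesis by blast
qed

section \<open>Differential inequalities\<close>

lemma nonincreasing_on_interval:
  fixes f :: "real \<Rightarrow> real"
  assumes "a \<le> b" and der: "\<And>t. t \<in> {a..b} \<Longrightarrow> (f has_real_derivative f' t) (at t within {a..b})"
    and le: "\<And>t. t \<in> {a..b} \<Longrightarrow> f' t \<le> 0"
  shows "f b \<le> f a"
proof (cases "a = b")
  case False
  with assms(1) have "a < b" by simp
  show ?thesis
  proof (rule DERIV_nonpos_imp_decreasing_open[OF assms(1)])
    fix x assume "a < x" "x < b"
    then have "(f has_real_derivative f' x) (at x)"
      using der[of x] at_within_interior[of x "{a..b}"] by simp
    then show "\<exists>y. DERIV f x :> y \<and> y \<le> 0" using le[of x] \<open>a < x\<close> \<open>x < b\<close> by auto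
  next
    show "continuous_on {a..b} f"
      using der by (meson DERIV_continuous continuous_on_eq_continuous_within)
  qed
qed simp

lemma gronwall_on_interval:
  fixes f :: "real \<Rightarrow> real"
  assumes "a \<le> b" and der: "\<And>t. t \<in> {a..b} \<Longrightarrow> (f has_real_derivative f' t) (at t within {a..b})"
    and le: "\<And>t. t \<in> {a..b} \<Longrightarrow> f' t \<le> k * f t"
  shows "f b \<le> f a * exp (k * (b - a))"
proof -
  have "f b * exp (- k * (b - a)) \<le> f a * exp (- k * (a - a))"
  proof (rule nonincreasing_on_interval[OF assms(1)])
    fix t assume t: "t \<in> {a..b}"
    show "((\<lambda>t. f t * exp (- k * (t - a))) has_real_derivative (f' t - k * f t) * exp (- k * (t - a)))
             (at t within {a..b})"
      by (auto intro!: derivative_eq_intros der[OF t] simp: algebra_simps)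
    show "(f' t - k * f t) * exp (- k * (t - a)) \<le> 0"
      using le[OF t] by (simp add: mult_le_0_iff)
  qed
  then have "f b * exp (- k * (b - a)) * exp (k * (b - a)) \<le> f a * exp (k * (b - a))"
    by (intro mult_right_mono) simp_all
  then show ?thesis by (simp add: mult.assoc flip: exp_add)
qed

lemma nonincreasing_of_deriv_nonpos:
  fixes f :: "real \<Rightarrow> real"
  assumes "a \<le> b" and der: "\<And>t. t \<ge> a \<Longrightarrow> (f has_real_derivative f' t) (at t within {a..})"
    and le: "\<And>t. t \<ge> a \<Longrightarrow> f' t \<le> 0"
  shows "f b \<le> f a"
proof (rule nonincreasing_on_interval[OF assms(1)])
  fix t assume "t \<in> {a..b}"
  then show "(f has_real_derivative f' t) (at t within {a..b})" "f' t \<le> 0"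
    using le by (auto intro: DERIV_subset[OF der])
qed

lemma gronwall:
  fixes f :: "real \<Rightarrow> real"
  assumes "a \<le> b" and der: "\<And>t. t \<ge> a \<Longrightarrow> (f has_real_derivative f' t) (at t within {a..})"
    and le: "\<And>t. t \<ge> a \<Longrightarrow> f' t \<le> k * f t"
  shows "f b \<le> f a * exp (k * (b - a))"
proof (rule gronwall_on_interval[OF assms(1)])
  fix t assume "t \<in> {a..b}"
  then show "(f has_real_derivative f' t) (at t within {a..b})" "f' t \<le> k * f t"
    using le by (auto intro: DERIV_subset[OF der])
qed

text \<open>
  The exponent is half the rate of the forcing, if this is smaller than \<open>\<delta>\<close>, so that no resonance
  \<open>\<gamma> = \<beta>\<close> occurs in the integrated inequality.
\<close>

lemma exp_decay_of_forced:
  fixes f :: "real \<Rightarrow> real"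
  assumes pos: "\<delta> > 0" "\<gamma> > 0" "c \<ge> 0" and nonneg: "\<And>t. t \<ge> 0 \<Longrightarrow> f t \<ge> 0"
    and der: "\<And>t. t \<ge> 0 \<Longrightarrow> (f has_real_derivative f' t) (at t within {0..})"
    and le: "\<And>t. t \<ge> 0 \<Longrightarrow> f' t \<le> - \<delta> * f t + c * exp (- \<gamma> * t)"
  shows "\<exists>c'\<ge>0. \<exists>\<beta>>0. \<forall>t\<ge>0. f t \<le> c' * exp (- \<beta> * t)"
proof -
  define \<beta> where "\<beta> = min \<delta> (\<gamma> / 2)"
  have \<beta>: "\<beta> > 0" "\<beta> \<le> \<delta>" "\<gamma> - \<beta> > 0" using pos by (auto simp: \<beta>_def)
  define c' where "c' = f 0 + c / (\<gamma> - \<beta>)"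
  have "f t \<le> c' * exp (- \<beta> * t)" if t: "t \<ge> 0" for t
  proof -
    have "f t * exp (\<beta> * t) + c / (\<gamma> - \<beta>) * exp (- (\<gamma> - \<beta>) * t)
       \<le> f 0 * exp (\<beta> * 0) + c / (\<gamma> - \<beta>) * exp (- (\<gamma> - \<beta>) * 0)"
    proof (rule nonincreasing_of_deriv_nonpos[OF t])
      fix t :: real assume t: "t \<ge> 0"
      show "((\<lambda>t. f t * exp (\<beta> * t) + c / (\<gamma> - \<beta>) * exp (- (\<gamma> - \<beta>) * t)) has_real_derivative
           (f' t + \<beta> * f t) * exp (\<beta> * t) - c * exp (- (\<gamma> - \<beta>) * t)) (at t within {0..})"
      proof -
        define d where "d = \<gamma> - \<beta>"
        have "((\<lambda>t. f t * exp (\<beta> * t) + c / d * exp (- d * t)) has_real_derivative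
           (f' t + \<beta> * f t) * exp (\<beta> * t) - c * exp (- d * t)) (at t within {0..})"
          using \<beta>(3) unfolding d_def[symmetric]
          by - (rule derivative_eq_intros der[OF t] refl | simp add: algebra_simps)+
        then show ?thesis by (simp add: d_def)
      qed
      have "f' t + \<beta> * f t \<le> (\<beta> - \<delta>) * f t + c * exp (- \<gamma> * t)"
        using le[OF t] by (simp add: algebra_simps)
      also have "\<dots> \<le> c * exp (- \<gamma> * t)"
        using \<beta> nonneg[OF t] by (simp add: mult_le_0_iff)
      finally have "(f' t + \<beta> * f t) * exp (\<beta> * t) \<le> c * exp (- \<gamma> * t) * exp (\<beta> * t)"
        by (rule mult_right_mono) simp
      then show "(f' t + \<beta> * f t) * exp (\<beta> * t) - c * exp (- (\<gamma> - \<beta>) * t) \<le> 0"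
        by (simp add: algebra_simps flip: exp_add)
    qed
    then have "f t * exp (\<beta> * t) \<le> c'"
      using \<beta>(3) pos(3) by (simp add: c'_def) (smt (verit) divide_nonneg_pos exp_ge_zero mult_nonneg_nonneg zero_le_divide_iff)
    then show ?thesis by (simp add: exp_minus field_simps)
  qed
  moreover have "c' \<ge> 0" using nonneg[of 0] pos \<beta> by (simp add: c'_def)
  ultimately show ?thesis using \<beta>(1) by blast
qed

lemma has_real_derivative_inner:
  assumes "(f has_vector_derivative f') (at t within S)" "(g has_vector_derivative g') (at t within S)"
  shows "((\<lambda>t. f t \<bullet> g t) has_real_derivative (f' \<bullet> g t + f t \<bullet> g')) (at t within S)"
  using bounded_bilinear.has_vector_derivative[OF bounded_bilinear_inner assms]
  by (simp add: has_real_derivative_iff_has_vector_derivative add.commute)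

section \<open>Decay and growth along a flow\<close>

text \<open>
  Induction on the degree of an annihilator of \<open>w\<close>, in place of the Jordan form. Split off one factor
  \<open>root_factor z\<close> and apply it to \<open>w\<close>: the result \<open>h\<close> has an annihilator of smaller degree, so its orbit decays.
  The orbit of \<open>w\<close> is a damped rotation with rate \<open>Re z < 0\<close>, forced by the orbit of \<open>h\<close>.
\<close>

lemma flow_decays:
  assumes M: "linear M" and U: "subspace U" "\<And>w. w \<in> U \<Longrightarrow> M w \<in> U"
    and stable: "\<And>a b u v. u \<in> U \<Longrightarrow> v \<in> U \<Longrightarrow> eigenpair M a b u v \<Longrightarrow> a < 0" and w: "w \<in> U"
  obtains c \<alpha> where "c \<ge> 0" "\<alpha> > 0" "\<And>t. t \<ge> 0 \<Longrightarrow> (norm (flow M t w))\<^sup>2 \<le> c * exp (- \<alpha> * t)"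
proof -
  have *: "\<exists>c \<alpha>. c \<ge> 0 \<and> \<alpha> > 0 \<and> (\<forall>t\<ge>0. (norm (flow M t w))\<^sup>2 \<le> c * exp (- \<alpha> * t))"
    if "p \<noteq> 0" "poly_act p M w = 0" "w \<in> U" for p w
    using that
  proof (induction "degree p" arbitrary: p w rule: less_induct)
    case less
    show ?case
    proof (cases "degree p = 0")
      case True
      then obtain k where "p = [:k:]" by (rule degree_eq_zeroE)
      then have "w = 0" using less.prems M by (auto simp: linear_0)
      then show ?thesis by (intro exI[of _ 0] exI[of _ 1]) (simp add: linear_0)
    next
      case False
      then obtain z r where pr: "p = root_factor z * r" using exists_root_factor by blast
      have r: "r \<noteq> 0" "degree r < degree p"
        using less.prems(1) degree_mult_eq[of "root_factor z" r] degree_root_factor_pos[of z] pr by auto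
      show ?thesis
      proof (cases "poly_act r M w = 0")
        case True
        then show ?thesis using less.hyps[OF r(2,1)] less.prems by blast
      next
        case False
        let ?w1 = "poly_act r M w"
        have mem: "?w1 \<in> U" by (rule poly_act_in_subspace[OF M U less.prems(3)])
        have "poly_act (root_factor z) M ?w1 = 0"
          using less.prems(2) by (simp add: pr poly_act_mult M)
        from eigenpair_of_root_factor[OF M False this]
        have a: "Re z < 0"
          by (rule stable[rotated 2])
             (use mem U in \<open>auto intro!: subspace_scale subspace_diff simp: subspace_0\<close>)
        define h where "h = poly_act (root_factor z) M w"
        have "h \<in> U" unfolding h_def by (rule poly_act_in_subspace[OF M U less.prems(3)])
        moreover have "poly_act r M h = 0"
          using less.prems(2) unfolding h_def
          by (metis pr mult.commute poly_act_mult[OF M])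
        ultimately obtain c \<gamma> where c: "c \<ge> 0" "\<gamma> > 0"
          "\<And>t. t \<ge> 0 \<Longrightarrow> (norm (flow M t h))\<^sup>2 \<le> c * exp (- \<gamma> * t)"
          using less.hyps[OF r(2,1)] by blast
        \<comment> \<open>\<open>y\<close> completes \<open>w\<close> to a plane on which \<open>M\<close> acts as the rotation \<open>a + i b\<close>, up to multiples of \<open>h\<close>\<close>
        define a b where "a = Re z" and "b = Im z"
        obtain y q q' where y: "M w = a *\<^sub>R w - b *\<^sub>R y + q *\<^sub>R h"
          and q': "M y = b *\<^sub>R w + a *\<^sub>R y + q' *\<^sub>R h"
        proof (cases "b = 0")
          case True
          then have "h = M w - a *\<^sub>R w" using M by (simp add: h_def root_factor_def a_def b_def linear_0)
          then have "M w = a *\<^sub>R w - b *\<^sub>R 0 + 1 *\<^sub>R h" "M 0 = b *\<^sub>R w + a *\<^sub>R 0 + 0 *\<^sub>R h"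
            using True M by (simp_all add: linear_0)
          then show thesis by (rule that)
        next
          case False
          have hh: "h = (a\<^sup>2 + b\<^sup>2) *\<^sub>R w + M ((- 2 * a) *\<^sub>R w + M w)"
            using M False unfolding h_def root_factor_def a_def b_def by (simp add: linear_0)
          then have MM: "M (M w) = h + a *\<^sub>R M w + a *\<^sub>R M w - (a\<^sup>2 + b\<^sup>2) *\<^sub>R w"
          proof -
            have two: "(- 2 * a) *\<^sub>R x = - (a *\<^sub>R x) - a *\<^sub>R x" for x :: 'a
            proof -
              have "- 2 * a = - a + - a" by simp
              then show ?thesis by (simp only: scaleR_left_distrib scaleR_minus_left diff_conv_add_uminus)
            qed
            have "M ((- 2 * a) *\<^sub>R w + M w) = (- 2 * a) *\<^sub>R M w + M (M w)"
              by (simp only: linear_add[OF M] linear_cmul[OF M])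
            with hh show ?thesis unfolding two by simp
          qed
          let ?y = "(1 / b) *\<^sub>R (a *\<^sub>R w - M w)"
          have "b *\<^sub>R M ?y = a *\<^sub>R M w - M (M w)"
            using M False by (simp add: linear_cmul linear_diff)
          also have "\<dots> = b *\<^sub>R (b *\<^sub>R w + a *\<^sub>R ?y + (- 1 / b) *\<^sub>R h)"
            using False unfolding MM by (simp add: algebra_simps power2_eq_square)
          finally have "M ?y = b *\<^sub>R w + a *\<^sub>R ?y + (- 1 / b) *\<^sub>R h"
            using False by simp
          moreover have "M w = a *\<^sub>R w - b *\<^sub>R ?y + 0 *\<^sub>R h" using False by simp
          ultimately show thesis by (rule that[of ?y 0 "- 1 / b", rotated])
        qed
        let ?W = "\<lambda>t. flow M t w" and ?Y = "\<lambda>t. flow M t y" and ?H = "\<lambda>t. flow M t h"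
        define N where "N t = ?W t \<bullet> ?W t + ?Y t \<bullet> ?Y t" for t
        define N' where "N' t = 2 * (?W t \<bullet> M (?W t)) + 2 * (?Y t \<bullet> M (?Y t))" for t
        have lin: "M (?W t) = a *\<^sub>R ?W t - b *\<^sub>R ?Y t + q *\<^sub>R ?H t"
          "M (?Y t) = b *\<^sub>R ?W t + a *\<^sub>R ?Y t + q' *\<^sub>R ?H t" for t
          using arg_cong[OF y, of "flow M t"] arg_cong[OF q', of "flow M t"]
          by (simp_all add: flow_commute[OF M] linear_add linear_diff linear_cmul)
        have der: "(N has_real_derivative N' t) (at t within {0..})" for t
          unfolding N_def N'_def
          by (rule derivative_eq_intros has_real_derivative_inner flow_has_vector_derivative M refl)+
             (simp add: inner_commute)
        have le: "N' t \<le> a * N t + ((q\<^sup>2 + q'\<^sup>2) / (- a) * c) * exp (- \<gamma> * t)" if "t \<ge> 0" for t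
        proof -
          have young: "2 * (q * (x \<bullet> h)) \<le> (- a) * (x \<bullet> x) + q\<^sup>2 / (- a) * (h \<bullet> h)" for x h :: 'a and q
          proof -
            have "0 \<le> (a *\<^sub>R x + q *\<^sub>R h) \<bullet> (a *\<^sub>R x + q *\<^sub>R h)" by simp
            then have "2 * (q * (x \<bullet> h)) * (- a) \<le> (a * a) * (x \<bullet> x) + q\<^sup>2 * (h \<bullet> h)"
              by (simp add: algebra_simps inner_commute power2_eq_square)
            then show ?thesis using a unfolding a_def[symmetric] by (simp add: field_simps power2_eq_square)
          qed
          have "N' t = 2 * a * N t + 2 * (q * (?W t \<bullet> ?H t)) + 2 * (q' * (?Y t \<bullet> ?H t))"
            unfolding N'_def N_def lin by (simp add: algebra_simps inner_commute)
          also have "\<dots> \<le> a * N t + (q\<^sup>2 + q'\<^sup>2) / (- a) * (norm (?H t))\<^sup>2"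
            using young[of q "?W t" "?H t"] young[of q' "?Y t" "?H t"]
            by (simp add: N_def power2_norm_eq_inner algebra_simps add_divide_distrib)
          also have "\<dots> \<le> a * N t + (q\<^sup>2 + q'\<^sup>2) / (- a) * (c * exp (- \<gamma> * t))"
            using a unfolding a_def[symmetric]
            by (intro add_left_mono mult_left_mono c(3)[OF that]) (simp add: divide_nonneg_neg)
          finally show ?thesis by (simp add: mult.assoc)
        qed
        have pa: "- a > 0" using a by (simp add: a_def)
        then have pc: "(q\<^sup>2 + q'\<^sup>2) / (- a) * c \<ge> 0"
          by (intro mult_nonneg_nonneg divide_nonneg_pos add_nonneg_nonneg zero_le_power2 c(1))
        have "\<exists>c'\<ge>0. \<exists>\<beta>>0. \<forall>t\<ge>0. N t \<le> c' * exp (- \<beta> * t)"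
        proof (rule exp_decay_of_forced[OF pa c(2) pc])
          show "N t \<ge> 0" for t by (simp add: N_def)
          show "N' t \<le> - (- a) * N t + (q\<^sup>2 + q'\<^sup>2) / (- a) * c * exp (- \<gamma> * t)" if "t \<ge> 0" for t
            using le[OF that] by (simp only: minus_minus)
        qed (rule der)
        then obtain c' \<beta> where c': "c' \<ge> 0" "\<beta> > 0" "\<forall>t\<ge>0. N t \<le> c' * exp (- \<beta> * t)"
          by blast
        have "(norm (?W t))\<^sup>2 \<le> c' * exp (- \<beta> * t)" if "t \<ge> 0" for t
        proof -
          have "(norm (?W t))\<^sup>2 \<le> N t" by (simp add: N_def power2_norm_eq_inner)
          also have "\<dots> \<le> c' * exp (- \<beta> * t)" using c'(3) that by blast
          finally show ?thesis .
        qed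
        with c'(1,2) show ?thesis by blast
      qed
    qed
  qed
  obtain p where "p \<noteq> 0" "poly_act p M w = 0" using exists_annihilator[OF M] by blast
  with *[OF this w] show thesis using that by blast
qed

text \<open>
  Backwards in time the plane of an eigenpair with \<open>a \<le> 0\<close> is rotated and expanded by \<open>exp (- a t) \<ge> 1\<close>.
\<close>

lemma eigenpair_flow_growth:
  assumes M: "linear M" and e: "eigenpair M a b u v" and a: "a \<le> 0" and t: "t \<ge> 0"
  shows "(norm u)\<^sup>2 + (norm v)\<^sup>2 \<le> (norm (flow M (- t) u))\<^sup>2 + (norm (flow M (- t) v))\<^sup>2"
proof -
  let ?u = "\<lambda>t. flow M (- t) u" and ?v = "\<lambda>t. flow M (- t) v"
  have der: "((\<lambda>t. flow M (- t) w) has_vector_derivative - M (flow M (- t) w)) (at t within {0..})" for w t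
  proof -
    have "(uminus has_vector_derivative - 1) (at t within {0..})"
      by (auto intro!: derivative_eq_intros)
    from vector_diff_chain_within[OF this flow_has_vector_derivative[OF M], of w]
    show ?thesis by (simp add: o_def)
  qed
  have lin: "M (?u t) = a *\<^sub>R ?u t - b *\<^sub>R ?v t" "M (?v t) = b *\<^sub>R ?u t + a *\<^sub>R ?v t" for t
    using e flow_commute[OF M, of "- t" u] flow_commute[OF M, of "- t" v]
    by (simp_all add: eigenpair_def linear_add linear_diff linear_cmul)
  have "- (?u t \<bullet> ?u t + ?v t \<bullet> ?v t) \<le> - (?u 0 \<bullet> ?u 0 + ?v 0 \<bullet> ?v 0)"
  proof (rule nonincreasing_of_deriv_nonpos[OF t])
    fix t :: real assume "t \<ge> 0"
    show "((\<lambda>t. - (?u t \<bullet> ?u t + ?v t \<bullet> ?v t)) has_real_derivative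
       2 * a * (?u t \<bullet> ?u t + ?v t \<bullet> ?v t)) (at t within {0..})"
      by (rule derivative_eq_intros has_real_derivative_inner der refl)+
         (simp add: lin algebra_simps inner_commute)
    show "2 * a * (?u t \<bullet> ?u t + ?v t \<bullet> ?v t) \<le> 0"
      using a by (simp add: mult_le_0_iff)
  qed
  then show ?thesis by (simp add: power2_norm_eq_inner)
qed

text \<open>
  The vectors whose backward orbit has bounded energy form an invariant subspace. It contains no eigenpair, because
  the backward orbit of an eigenpair does not shrink; hence it is trivial.
\<close>

lemma flow_backward_integral_unbounded:
  assumes M: "linear M" and a: "\<And>a b u v. eigenpair M a b u v \<Longrightarrow> a \<le> 0" and w: "w \<noteq> 0"
  shows "\<exists>T\<ge>0. integral {0..T} (\<lambda>s. (norm (flow M (- s) w))\<^sup>2) > k"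
proof (rule ccontr)
  assume neg: "\<not> ?thesis"
  define I where "I T w = integral {0..T} (\<lambda>s. (norm (flow M (- s) w))\<^sup>2)" for T w
  define V where "V = {w. \<exists>K. \<forall>T\<ge>0. I T w \<le> K}"
  have int [simp]: "(\<lambda>s. c * (norm (flow M (- s) w))\<^sup>2) integrable_on {0..T}"
     "(\<lambda>s. (norm (flow M (- s) w))\<^sup>2) integrable_on {0..T}" for T w c
    by (intro integrable_continuous_interval continuous_intros continuous_on_flow M)+
  have bnd: "w' \<in> V" if "u \<in> V" "v \<in> V"
     and le: "\<And>s. (norm (flow M (- s) w'))\<^sup>2 \<le> C * (norm (flow M (- s) u))\<^sup>2 + C * (norm (flow M (- s) v))\<^sup>2"
     and C: "C \<ge> 0" for w' u v C
  proof -
    from that obtain K1 K2 where K: "\<And>T. T \<ge> 0 \<Longrightarrow> I T u \<le> K1" "\<And>T. T \<ge> 0 \<Longrightarrow> I T v \<le> K2"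
      unfolding V_def by blast
    have "I T w' \<le> C * K1 + C * K2" if "T \<ge> 0" for T
    proof -
      have "I T w' \<le> integral {0..T} (\<lambda>s. C * (norm (flow M (- s) u))\<^sup>2 + C * (norm (flow M (- s) v))\<^sup>2)"
        unfolding I_def by (rule integral_le) (auto intro!: integrable_add le)
      also have "\<dots> = C * I T u + C * I T v"
        unfolding I_def by (subst integral_add) auto
      finally show ?thesis using mult_left_mono[OF K(1)[OF that] C] mult_left_mono[OF K(2)[OF that] C] by linarith
    qed
    then show ?thesis by (auto simp: V_def)
  qed
  have sq: "(norm (x + y))\<^sup>2 \<le> 2 * (norm x)\<^sup>2 + 2 * (norm y)\<^sup>2" for x y :: 'a
    using power_mono[OF norm_triangle_ineq[of x y], of 2] sum_squares_bound[of "norm x" "norm y"]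
    by (simp add: power2_sum)
  have sub: "subspace V"
  proof (rule subspaceI)
    show "0 \<in> V" by (auto simp: V_def I_def linear_0)
    show "x + y \<in> V" if "x \<in> V" "y \<in> V" for x y
      by (rule bnd[OF that, of _ 2]) (use sq in \<open>simp_all add: linear_add\<close>)
    show "c *\<^sub>R x \<in> V" if "x \<in> V" for c x
      by (rule bnd[OF that that, of _ "c\<^sup>2"]) (simp_all add: linear_cmul power_mult_distrib)
  qed
  obtain m where m: "\<And>x. norm (M x) \<le> m * norm x" "m > 0"
    using linear_bounded_pos[OF M] by blast
  have inv: "M x \<in> V" if "x \<in> V" for x
  proof (rule bnd[OF that that, of _ "m\<^sup>2"])
    fix s
    have "(norm (M (flow M (- s) x)))\<^sup>2 \<le> (m * norm (flow M (- s) x))\<^sup>2"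
      by (rule power_mono[OF m(1)]) simp
    also have "\<dots> \<le> m\<^sup>2 * (norm (flow M (- s) x))\<^sup>2 + m\<^sup>2 * (norm (flow M (- s) x))\<^sup>2"
      by (simp add: power_mult_distrib)
    finally show "(norm (flow M (- s) (M x)))\<^sup>2
      \<le> m\<^sup>2 * (norm (flow M (- s) x))\<^sup>2 + m\<^sup>2 * (norm (flow M (- s) x))\<^sup>2"
      by (simp only: flow_commute[OF M])
  qed simp
  have "I T w \<le> k" if "T \<ge> 0" for T
  proof (rule ccontr)
    assume "\<not> I T w \<le> k"
    then have "T \<ge> 0 \<and> k < integral {0..T} (\<lambda>s. (norm (flow M (- s) w))\<^sup>2)"
      using that by (simp add: I_def)
    then have "\<exists>T\<ge>0. k < integral {0..T} (\<lambda>s. (norm (flow M (- s) w))\<^sup>2)" ..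
    with neg show False ..
  qed
  then have wV: "w \<in> V" unfolding V_def by blast
  have "\<exists>a b. \<exists>u\<in>V. \<exists>v\<in>V. eigenpair M a b u v"
    using inv by (intro exists_eigenpair[OF M sub _ wV w])
  then obtain a b u v where uv: "u \<in> V" "v \<in> V" "eigenpair M a b u v" by blast
  from uv(1) obtain K1 where K1: "\<forall>T\<ge>0. I T u \<le> K1" unfolding V_def mem_Collect_eq ..
  from uv(2) obtain K2 where K2: "\<forall>T\<ge>0. I T v \<le> K2" unfolding V_def mem_Collect_eq ..
  define d where "d = (norm u)\<^sup>2 + (norm v)\<^sup>2"
  have "d > 0" using uv(3) by (simp add: d_def eigenpair_def sum_power2_gt_zero_iff)
  define T where "T = (\<bar>K1 + K2\<bar> + 1) / d"
  have T: "T \<ge> 0" "T * d = \<bar>K1 + K2\<bar> + 1" using \<open>d > 0\<close> by (auto simp: T_def)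
  have "T * d = integral {0..T} (\<lambda>s. d)" using T by simp
  also have "\<dots> \<le> integral {0..T} (\<lambda>s. (norm (flow M (- s) u))\<^sup>2 + (norm (flow M (- s) v))\<^sup>2)"
    by (rule integral_le)
       (simp_all add: integrable_add integrable_continuous_interval[OF continuous_on_const] d_def eigenpair_flow_growth[OF M uv(3) a[OF uv(3)]])
  also have "\<dots> = I T u + I T v" unfolding I_def by (subst integral_add) auto
  finally show False using K1[rule_format, OF T(1)] K2[rule_format, OF T(1)] T(2) by linarith
qed

lemma flow_tendsto_0:
  assumes M: "linear M" and U: "subspace U" "\<And>w. w \<in> U \<Longrightarrow> M w \<in> U"
    and stable: "\<And>a b u v. u \<in> U \<Longrightarrow> v \<in> U \<Longrightarrow> eigenpair M a b u v \<Longrightarrow> a < 0" and w: "w \<in> U"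
  shows "((\<lambda>t. flow M t w) \<longlongrightarrow> 0) at_top"
proof (rule flow_decays[OF M U(1) _ _ w])
  show "M x \<in> U" if "x \<in> U" for x by (rule U(2)[OF that])
  show "a < 0" if "u \<in> U" "v \<in> U" "eigenpair M a b u v" for a b u v by (rule stable[OF that])
  fix c \<alpha> :: real
  assume c: "c \<ge> 0" "\<alpha> > 0" "\<And>t. t \<ge> 0 \<Longrightarrow> (norm (flow M t w))\<^sup>2 \<le> c * exp (- \<alpha> * t)"
  have "((\<lambda>t. c * exp (- \<alpha> * t)) \<longlongrightarrow> c * 0) at_top"
  proof (intro tendsto_intros filterlim_compose[OF exp_at_bot])
    show "filterlim (\<lambda>t. - \<alpha> * t) at_bot at_top"
      using c(2) by (simp add: filterlim_uminus_at_bot filterlim_tendsto_pos_mult_at_top[OF tendsto_const _ filterlim_ident])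
  qed
  then have lim: "((\<lambda>t. c * exp (- \<alpha> * t)) \<longlongrightarrow> 0) at_top" by simp
  have up: "\<forall>\<^sub>F t in at_top. (norm (flow M t w))\<^sup>2 \<le> c * exp (- \<alpha> * t)"
    using eventually_ge_at_top[of 0] by eventually_elim (rule c(3))
  have lo: "\<forall>\<^sub>F t in at_top. 0 \<le> (norm (flow M t w))\<^sup>2" by simp
  have "((\<lambda>t. (norm (flow M t w))\<^sup>2) \<longlongrightarrow> 0) at_top"
    by (rule real_tendsto_sandwich[OF lo up tendsto_const lim])
  then have "((\<lambda>t. sqrt ((norm (flow M t w))\<^sup>2)) \<longlongrightarrow> sqrt 0) at_top" by (rule tendsto_real_sqrt)
  then show ?thesis by (simp add: tendsto_norm_zero_iff)
qed

section \<open>Low-gain solutions of the Lyapunov inequality\<close>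

text \<open>
  Otherwise the unit vectors that violate the inequality for \<open>c = n\<close> accumulate at a vector with \<open>g = 0\<close> and
  \<open>f \<le> 0\<close>.
\<close>

lemma finsler:
  fixes f g :: "'a::euclidean_space \<Rightarrow> real"
  assumes cont: "continuous_on (sphere 0 1) f" "continuous_on (sphere 0 1) g"
    and g: "\<And>w. norm w = 1 \<Longrightarrow> g w \<ge> 0" and fg: "\<And>w. norm w = 1 \<Longrightarrow> g w = 0 \<Longrightarrow> f w > 0"
  shows "\<exists>c\<ge>0. \<exists>r>0. \<forall>w. norm w = 1 \<longrightarrow> f w + c * g w \<ge> r"
proof -
  have ne: "sphere (0::'a) 1 \<noteq> {}" by simp
  have "\<exists>n::nat. \<forall>w. norm w = 1 \<longrightarrow> f w + real n * g w > 0"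
  proof (rule ccontr)
    assume "\<not> ?thesis"
    then have "\<forall>n::nat. \<exists>w. norm w = 1 \<and> f w + real n * g w \<le> 0" by (simp add: not_less)
    then obtain W where W: "\<And>n. norm (W n) = 1" "\<And>n. f (W n) + real n * g (W n) \<le> 0" by metis
    obtain l r where l: "l \<in> sphere (0::'a) 1" and r: "strict_mono (r :: nat \<Rightarrow> nat)"
      and lim: "(W \<circ> r) \<longlonglongrightarrow> l"
      using compact_sphere[of "0::'a" 1] W(1) unfolding compact_def by (metis mem_sphere_0)
    have fl: "(\<lambda>n. f (W (r n))) \<longlonglongrightarrow> f l"
      using continuous_on_tendsto_compose[OF cont(1) lim[unfolded o_def] l] W(1) by simp
    have gl: "(\<lambda>n. g (W (r n))) \<longlonglongrightarrow> g l"
      using continuous_on_tendsto_compose[OF cont(2) lim[unfolded o_def] l] W(1) by simp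
    have "f (W n) \<le> 0" for n
      using W(2)[of n] g[OF W(1)[of n]] mult_nonneg_nonneg[of "real n" "g (W n)"] by linarith
    then have fl0: "f l \<le> 0" by (intro tendsto_upperbound[OF fl]) auto
    obtain B where "\<forall>w\<in>sphere 0 1. \<bar>f w\<bar> \<le> B"
      using compact_imp_bounded[OF compact_continuous_image[OF cont(1) compact_sphere]]
      by (auto simp: bounded_iff)
    then have B: "\<And>w. norm w = 1 \<Longrightarrow> \<bar>f w\<bar> \<le> B" by simp
    have le: "g (W (r n)) \<le> B / real n" if "n > 0" for n
    proof -
      have "real n * g (W (r n)) \<le> real (r n) * g (W (r n))"
        using seq_suble[OF r, of n] g[OF W(1)] by (intro mult_right_mono) auto
      also have "\<dots> \<le> B" using W(2)[of "r n"] B[OF W(1)[of "r n"]] by linarith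
      finally show ?thesis using that by (simp add: field_simps)
    qed
    have "g l \<le> 0"
    proof (rule tendsto_le[OF _ _ gl])
      show "(\<lambda>n. B / real n) \<longlonglongrightarrow> 0" by (rule lim_const_over_n)
      show "\<forall>\<^sub>F n in sequentially. g (W (r n)) \<le> B / real n"
        using eventually_gt_at_top[of 0] by eventually_elim (rule le)
    qed simp
    then have "g l = 0" using g[of l] l by simp
    with fg[of l] fl0 l show False by simp
  qed
  then obtain n :: nat where n: "\<And>w. norm w = 1 \<Longrightarrow> f w + real n * g w > 0" by blast
  obtain w0 where w0: "w0 \<in> sphere (0::'a) 1"
    and min: "\<forall>w\<in>sphere (0::'a) 1. f w0 + real n * g w0 \<le> f w + real n * g w"
    using continuous_attains_inf[OF compact_sphere ne, of "\<lambda>w. f w + real n * g w"]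
      continuous_on_add[OF cont(1) continuous_on_mult_left[OF cont(2), of "real n"]] by blast
  show ?thesis
    using n[of w0] w0 min by (intro exI[of _ "real n"] conjI exI[of _ "f w0 + real n * g w0"]) auto
qed

lemma riesz_operator:
  fixes q :: "'a::euclidean_space \<Rightarrow> 'a \<Rightarrow> real"
  assumes "\<And>x. linear (q x)" "\<And>y. linear (\<lambda>x. q x y)"
  shows "\<exists>Q. linear Q \<and> (\<forall>x y. Q x \<bullet> y = q x y)"
proof (intro exI conjI allI)
  let ?Q = "\<lambda>x. \<Sum>b\<in>Basis. q x b *\<^sub>R b"
  show "linear ?Q"
    using assms(2) by (auto simp: linear_iff scaleR_sum_right sum.distrib algebra_simps)
  fix x y
  have "q x y = q x (\<Sum>b\<in>Basis. (y \<bullet> b) *\<^sub>R b)" by (simp add: euclidean_representation)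
  also have "\<dots> = (\<Sum>b\<in>Basis. (y \<bullet> b) * q x b)"
    using assms(1) by (simp add: linear_sum linear_cmul)
  also have "\<dots> = ?Q x \<bullet> y" by (simp add: inner_sum_left) (simp add: inner_commute mult.commute)
  finally show "?Q x \<bullet> y = q x y" ..
qed

lemma integral_form:
  fixes F :: "real \<Rightarrow> 'a::euclidean_space \<Rightarrow> 'b::euclidean_space"
  assumes lin: "\<And>s. linear (F s)" and cont: "\<And>x. continuous_on {0..T} (\<lambda>s. F s x)"
    and k: "continuous_on {0..T} k"
  shows "\<exists>Q. linear Q \<and> (\<forall>x y. Q x \<bullet> y = integral {0..T} (\<lambda>s. k s * (F s x \<bullet> F s y)))
     \<and> (\<forall>x y. Q x \<bullet> y = x \<bullet> Q y)"
proof -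
  have int: "(\<lambda>s. k s * (F s x \<bullet> F s y)) integrable_on {0..T}" for x y
    by (intro integrable_continuous_interval continuous_intros cont k)
  have lin1: "linear (\<lambda>y. integral {0..T} (\<lambda>s. k s * (F s x \<bullet> F s y)))" for x
    by (rule linearI)
       (simp_all add: linear_add[OF lin] linear_cmul[OF lin] inner_simps distrib_left integral_add[OF int int]
         mult.left_commute[of "k _"])
  have sym: "integral {0..T} (\<lambda>s. k s * (F s x \<bullet> F s y)) = integral {0..T} (\<lambda>s. k s * (F s y \<bullet> F s x))" for x y
    by (simp add: inner_commute)
  have "\<exists>Q. linear Q \<and> (\<forall>x y. Q x \<bullet> y = integral {0..T} (\<lambda>s. k s * (F s x \<bullet> F s y)))"
    by (rule riesz_operator) (simp_all add: lin1 sym[of _ y for y])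
  then show ?thesis using sym by (metis inner_commute)
qed

lemma quadratic_continuous: "linear Q \<Longrightarrow> continuous_on S (\<lambda>x::'a::euclidean_space. Q x \<bullet> x)"
  by (intro continuous_intros linear_continuous_on) (simp add: linear_conv_bounded_linear)

lemma flow_back_derivative:
  assumes M: "linear M"
  shows "((\<lambda>t. flow M (- t) w) has_vector_derivative - flow M (- t) (M w)) (at t within S)"
proof -
  have "(uminus has_vector_derivative - 1) (at t within S)"
    by (auto intro!: derivative_eq_intros)
  from vector_diff_chain_within[OF this flow_has_vector_derivative[OF M], of w]
  show ?thesis by (simp add: o_def flow_commute[OF M])
qed

lemma linear_has_vector_derivative:
  fixes C :: "'a::euclidean_space \<Rightarrow> 'b::real_normed_vector"
  assumes "linear C" "(f has_vector_derivative f') F"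
  shows "((\<lambda>t. C (f t)) has_vector_derivative C f') F"
  using bounded_linear.has_vector_derivative[OF _ assms(2), of C] assms(1)
  by (simp add: linear_conv_bounded_linear)

text \<open>
  The dual of the statement that stabilizable systems have a Lyapunov inequality with input term. On the unobservable
  subspace \<open>U\<close> the flow tends to zero, so for some \<open>T\<close> the form \<open>\<integral>\<^sub>0\<^sup>T |exp (s M) x|\<^sup>2\<close> strictly decreases there. Off \<open>U\<close> the
  output energy \<open>\<integral> |C exp (- s M) x|\<^sup>2\<close> is positive, and Finsler's lemma combines the two forms. The second form
  carries the weight \<open>1 - s\<close>, whose derivative produces exactly the output energy.
\<close>

lemma strict_observability_form:
  fixes M :: "'a::euclidean_space \<Rightarrow> 'a" and C :: "'a \<Rightarrow> 'b::euclidean_space"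
  assumes M: "linear M" and C: "linear C"
    and detect: "\<And>a b u v. eigenpair M a b u v \<Longrightarrow> C u = 0 \<Longrightarrow> C v = 0 \<Longrightarrow> a < 0"
  shows "\<exists>Q \<rho> r. linear Q \<and> (\<forall>x y. Q x \<bullet> y = x \<bullet> Q y) \<and> (\<forall>x. Q x \<bullet> x \<ge> 0) \<and> \<rho> \<ge> 0 \<and> r > 0 \<and>
     (\<forall>x. 2 * (Q x \<bullet> M x) + r * (norm x)\<^sup>2 \<le> \<rho> * (norm (C x))\<^sup>2)"
proof -
  let ?G = "\<lambda>s w. C (flow M (- s) w)"
  have linG: "linear (?G s)" for s
    using linear_compose[OF linear_flow C] by (simp add: o_def)
  have derG: "((\<lambda>s. ?G s w) has_vector_derivative - ?G s (M w)) (at s within S)" for w s S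
    using linear_has_vector_derivative[OF C flow_back_derivative[OF M]] by (simp add: linear_neg[OF C])
  have contG: "continuous_on S (\<lambda>s. ?G s w)" for S w
    using derG by (meson continuous_on_eq_continuous_within has_vector_derivative_continuous)
  define U where "U = {w. \<forall>s\<in>{0..1}. ?G s w = 0}"
  have subU: "subspace U"
    by (rule subspaceI) (simp_all add: U_def linear_0[OF linG] linear_add[OF linG] linear_cmul[OF linG])
  have invU: "M w \<in> U" if "w \<in> U" for w
    unfolding U_def
  proof (intro CollectI ballI)
    fix s :: real assume s: "s \<in> {0..1}"
    have "((\<lambda>s. ?G s w) has_vector_derivative 0) (at s within cbox 0 1)"
      by (rule has_vector_derivative_transform[OF _ _ has_vector_derivative_const[of 0]])
         (use s that in \<open>simp_all add: U_def\<close>)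
    then have "- ?G s (M w) = 0"
      by (intro vector_derivative_unique_within_closed_interval[OF _ _ derG]) (use s in simp_all)
    then show "?G s (M w) = 0" by simp
  qed
  have C0: "C u = 0" if "u \<in> U" for u
    using that unfolding U_def by (auto dest: bspec[of _ _ 0])
  have decay: "((\<lambda>t. flow M t w) \<longlongrightarrow> 0) at_top" if "w \<in> U" for w
  proof (rule flow_tendsto_0[OF M subU _ _ that])
    show "M w \<in> U" if "w \<in> U" for w by (rule invU[OF that])
    show "a < 0" if "u \<in> U" "v \<in> U" "eigenpair M a b u v" for a b u v
      by (rule detect[OF that(3) C0[OF that(1)] C0[OF that(2)]])
  qed
  obtain Bs where Bs: "Bs \<subseteq> U" "pairwise orthogonal Bs" "\<And>x. x \<in> Bs \<Longrightarrow> norm x = 1"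
      "independent Bs" "span Bs = U"
    using orthonormal_basis_subspace[OF subU] by metis
  have finB: "finite Bs" using Bs(4) by (rule independent_imp_finite)
  have "((\<lambda>t. \<Sum>b\<in>Bs. norm (flow M t b)) \<longlongrightarrow> (\<Sum>b\<in>Bs. 0)) at_top"
    using Bs(1) decay by (intro tendsto_sum tendsto_norm_zero) auto
  then have "\<forall>\<^sub>F t in at_top. (\<Sum>b\<in>Bs. norm (flow M t b)) < 1/2 \<and> t \<ge> 0"
    by (intro eventually_conj eventually_ge_at_top order_tendstoD(2)) auto
  then obtain T where T: "(\<Sum>b\<in>Bs. norm (flow M T b)) < 1/2" "T \<ge> 0"
    using eventually_happens'[OF trivial_limit_at_top_linorder] by blast
  \<comment> \<open>One time \<open>T\<close> serves all of \<open>U\<close>, since the flow is linear and \<open>U\<close> has a finite orthonormal basis.\<close>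
  have contract: "norm (flow M T w) \<le> norm w / 2" if "w \<in> U" for w
  proof -
    have w: "w = (\<Sum>b\<in>Bs. (w \<bullet> b) *\<^sub>R b)"
      using orthonormal_basis_expand[OF Bs(2,3) _ finB, of w] that Bs(5) by simp
    have "flow M T w = flow M T (\<Sum>b\<in>Bs. (w \<bullet> b) *\<^sub>R b)" using w by simp
    also have "\<dots> = (\<Sum>b\<in>Bs. (w \<bullet> b) *\<^sub>R flow M T b)"
      by (simp add: linear_sum linear_cmul)
    finally have start: "norm (flow M T w) \<le> (\<Sum>b\<in>Bs. \<bar>w \<bullet> b\<bar> * norm (flow M T b))"
      using norm_sum[of "\<lambda>b. (w \<bullet> b) *\<^sub>R flow M T b" Bs] by simp
    have ab: "\<bar>w \<bullet> b\<bar> \<le> norm w" if "b \<in> Bs" for b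
      using Cauchy_Schwarz_ineq2[of w b] Bs(3)[OF that] by simp
    note start
    also have "(\<Sum>b\<in>Bs. \<bar>w \<bullet> b\<bar> * norm (flow M T b)) \<le> (\<Sum>b\<in>Bs. norm w * norm (flow M T b))"
      by (intro sum_mono mult_right_mono) (simp_all add: ab)
    also have "\<dots> = norm w * (\<Sum>b\<in>Bs. norm (flow M T b))" by (simp add: sum_distrib_left)
    also have "\<dots> \<le> norm w * (1/2)" by (intro mult_left_mono) (use T in auto)
    finally show ?thesis by simp
  qed
  \<comment> \<open>\<open>Q1\<close> decreases along \<open>U\<close>; the derivative of \<open>Q2\<close> is \<open>|C w|\<^sup>2\<close> minus the output energy \<open>Q3\<close>.\<close>
  obtain Q1 where Q1: "linear Q1" "\<And>x y. Q1 x \<bullet> y = integral {0..T} (\<lambda>s. 1 * (flow M s x \<bullet> flow M s y))"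
      "\<And>x y. Q1 x \<bullet> y = x \<bullet> Q1 y"
    using integral_form[of "flow M" T "\<lambda>_. 1", OF linear_flow continuous_on_flow[OF M continuous_on_id] continuous_on_const] by blast
  obtain Q2 where Q2: "linear Q2" "\<And>x y. Q2 x \<bullet> y = integral {0..1} (\<lambda>s. (1 - s) * (?G s x \<bullet> ?G s y))"
      "\<And>x y. Q2 x \<bullet> y = x \<bullet> Q2 y"
    using integral_form[of ?G 1 "\<lambda>s. 1 - s", OF linG contG continuous_on_op_minus] by blast
  obtain Q3 where Q3: "linear Q3" "\<And>x y. Q3 x \<bullet> y = integral {0..1} (\<lambda>s. 1 * (?G s x \<bullet> ?G s y))"
      "\<And>x y. Q3 x \<bullet> y = x \<bullet> Q3 y"
    using integral_form[of ?G 1 "\<lambda>s. 1", OF linG contG continuous_on_const] by blast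
  have der1: "2 * (Q1 w \<bullet> M w) = (norm (flow M T w))\<^sup>2 - (norm w)\<^sup>2" for w
  proof -
    have "((\<lambda>s. 2 * (flow M s w \<bullet> flow M s (M w))) has_integral
       (flow M T w \<bullet> flow M T w - flow M 0 w \<bullet> flow M 0 w)) {0..T}"
    proof (rule fundamental_theorem_of_calculus[OF T(2)])
      fix s :: real
      show "((\<lambda>s. flow M s w \<bullet> flow M s w) has_vector_derivative 2 * (flow M s w \<bullet> flow M s (M w)))
         (at s within {0..T})"
        using has_real_derivative_inner[OF flow_has_vector_derivative[OF M, where w = w and t = s and S = "{0..T}"]
            flow_has_vector_derivative[OF M, where w = w and t = s and S = "{0..T}"]]
        by (simp add: has_real_derivative_iff_has_vector_derivative inner_commute flow_commute[OF M])
    qed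
    from integral_unique[OF this] show ?thesis
      unfolding Q1(2) by (simp add: power2_norm_eq_inner)
  qed
  have der2: "2 * (Q2 w \<bullet> M w) = (norm (C w))\<^sup>2 - Q3 w \<bullet> w" for w
  proof -
    have "((\<lambda>s. - (?G s w \<bullet> ?G s w) - 2 * ((1 - s) * (?G s w \<bullet> ?G s (M w)))) has_integral
       ((1 - 1) * (?G 1 w \<bullet> ?G 1 w) - (1 - 0) * (?G 0 w \<bullet> ?G 0 w))) {0..1}"
    proof (rule fundamental_theorem_of_calculus)
      fix s :: real
      show "((\<lambda>s. (1 - s) * (?G s w \<bullet> ?G s w)) has_vector_derivative
         - (?G s w \<bullet> ?G s w) - 2 * ((1 - s) * (?G s w \<bullet> ?G s (M w)))) (at s within {0..1})"
        unfolding has_real_derivative_iff_has_vector_derivative[symmetric]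
        by (rule derivative_eq_intros has_real_derivative_inner derG refl)+
           (simp add: inner_commute algebra_simps)
    qed simp
    note eq = integral_unique[OF this]
    have "integral {0..1} (\<lambda>s. - (?G s w \<bullet> ?G s w) - 2 * ((1 - s) * (?G s w \<bullet> ?G s (M w)))) =
       - (Q3 w \<bullet> w) - 2 * (Q2 w \<bullet> M w)"
      unfolding Q3(2) Q2(2)
      by (subst integral_diff)
         (auto intro!: integrable_continuous_interval continuous_intros contG)
    with eq show ?thesis by (simp add: power2_norm_eq_inner)
  qed
  define f where "f w = (norm w)\<^sup>2 - (norm (flow M T w))\<^sup>2" for w
  have "\<exists>c\<ge>0. \<exists>r>0. \<forall>w. norm w = 1 \<longrightarrow> f w + c * (Q3 w \<bullet> w) \<ge> r"
  proof (rule finsler)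
    show "continuous_on (sphere 0 1) f" unfolding f_def
      by (intro continuous_intros linear_continuous_on) (simp add: linear_conv_bounded_linear[symmetric])
    show "continuous_on (sphere 0 1) (\<lambda>w. Q3 w \<bullet> w)" by (rule quadratic_continuous[OF Q3(1)])
    show "Q3 w \<bullet> w \<ge> 0" for w
      unfolding Q3(2) by (rule integral_nonneg) (auto intro!: integrable_continuous_interval continuous_intros contG)
    fix w :: 'a assume w: "norm w = 1" "Q3 w \<bullet> w = 0"
    have hi: "((\<lambda>s. ?G s w \<bullet> ?G s w) has_integral 0) (cbox 0 1)"
    proof -
      have "integral (cbox 0 1) (\<lambda>s. ?G s w \<bullet> ?G s w) = 0" using w(2) unfolding Q3(2) by simp
      moreover have "(\<lambda>s. ?G s w \<bullet> ?G s w) integrable_on cbox 0 1"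
        unfolding box_real by (intro integrable_continuous_interval continuous_intros contG)
      ultimately show ?thesis by (metis integrable_integral)
    qed
    have "?G s w \<bullet> ?G s w = 0" if "s \<in> {0..1}" for s
      by (rule has_integral_0_cbox_imp_0[OF _ _ hi])
         (use that in \<open>auto intro!: continuous_intros contG\<close>)
    then have "w \<in> U" by (simp add: U_def)
    from contract[OF this] w(1) have "(norm (flow M T w))\<^sup>2 \<le> (1/2)\<^sup>2" by (intro power_mono) auto
    then show "f w > 0" using w(1) by (simp add: f_def power2_eq_square)
  qed
  then obtain c r where c: "c \<ge> 0" "r > 0" "\<And>w. norm w = 1 \<Longrightarrow> f w + c * (Q3 w \<bullet> w) \<ge> r" by blast
  define Q where "Q w = Q1 w + c *\<^sub>R Q2 w" for w
  have linQ: "linear Q"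
    using linear_compose_add[OF Q1(1) linear_compose_scale_right[OF Q2(1), of c]] by (simp add: Q_def[abs_def])
  have hom: "r * (norm w)\<^sup>2 \<le> f w + c * (Q3 w \<bullet> w)" for w
  proof (cases "w = 0")
    case False
    define e where "e = w /\<^sub>R norm w"
    have e: "norm e = 1" "w = norm w *\<^sub>R e" using False by (auto simp: e_def)
    have "f w + c * (Q3 w \<bullet> w) = (norm w)\<^sup>2 * (f e + c * (Q3 e \<bullet> e))"
    proof -
      have "f (k *\<^sub>R e) + c * (Q3 (k *\<^sub>R e) \<bullet> (k *\<^sub>R e)) = k\<^sup>2 * (f e + c * (Q3 e \<bullet> e))" for k
        by (simp add: f_def linear_cmul Q3(1) power_mult_distrib algebra_simps power2_eq_square)
      from this[of "norm w"] show ?thesis using e(2) by simp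
    qed
    then show ?thesis using mult_left_mono[OF c(3)[OF e(1)], of "(norm w)\<^sup>2"] by (simp add: mult.commute)
  qed (simp add: f_def linear_0 Q3(1))
  have "2 * (Q w \<bullet> M w) + r * (norm w)\<^sup>2 \<le> c * (norm (C w))\<^sup>2" for w
    using hom[of w] der1[of w] arg_cong[OF der2[of w], of "(*) c"]
    by (simp add: Q_def inner_simps f_def algebra_simps)
  moreover have "Q1 x \<bullet> x \<ge> 0" for x
    unfolding Q1(2) by (rule integral_nonneg)
       (auto intro!: integrable_continuous_interval continuous_intros continuous_on_flow M)
  moreover have "Q2 x \<bullet> x \<ge> 0" for x
    unfolding Q2(2) by (rule integral_nonneg)
       (auto intro!: integrable_continuous_interval continuous_intros contG)
  ultimately show ?thesis
    using linQ c(1,2) Q1(3) Q2(3)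
    by (intro exI[of _ Q] exI[of _ c] exI[of _ r]) (auto simp: Q_def inner_simps)
qed

text \<open>
  The same inequality with an arbitrarily large form. Follow the backward flow for a time \<open>T\<close>: the form at the
  end point plus \<open>\<rho>\<close> times the output energy on the way satisfies the inequality with the same \<open>\<rho>\<close>. It dominates
  \<open>r\<close> times the energy of the backward orbit, which exceeds every bound because no eigenvalue has positive
  real part. Compactness of the sphere gives one \<open>T\<close> for all directions.
\<close>

lemma unbounded_form:
  fixes M :: "'a::euclidean_space \<Rightarrow> 'a" and C :: "'a \<Rightarrow> 'b::euclidean_space"
  assumes M: "linear M" and C: "linear C"
    and marginal: "\<And>a b u v. eigenpair M a b u v \<Longrightarrow> a \<le> 0"
    and Q: "linear Q" "\<And>x y. Q x \<bullet> y = x \<bullet> Q y" "\<And>x. Q x \<bullet> x \<ge> 0"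
    and \<rho>: "\<rho> \<ge> 0" and r: "r > 0"
    and ineq: "\<And>x. 2 * (Q x \<bullet> M x) + r * (norm x)\<^sup>2 \<le> \<rho> * (norm (C x))\<^sup>2"
  shows "\<exists>Q' r'. linear Q' \<and> (\<forall>x y. Q' x \<bullet> y = x \<bullet> Q' y) \<and> (\<forall>x. Q' x \<bullet> x \<ge> k * (norm x)\<^sup>2) \<and> r' > 0 \<and>
     (\<forall>x. 2 * (Q' x \<bullet> M x) + r' * (norm x)\<^sup>2 \<le> \<rho> * (norm (C x))\<^sup>2)"
proof -
  let ?E = "\<lambda>s. flow M (- s)"
  let ?G = "\<lambda>s w. C (?E s w)"
  have linG: "linear (?G s)" for s
    using linear_compose[OF linear_flow C] by (simp add: o_def)
  have derG: "((\<lambda>s. ?G s w) has_vector_derivative - ?G s (M w)) (at s within S)" for w s S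
    using linear_has_vector_derivative[OF C flow_back_derivative[OF M]] by (simp add: linear_neg[OF C])
  have contG: "continuous_on S (\<lambda>s. ?G s w)" for S w
    using derG by (meson continuous_on_eq_continuous_within has_vector_derivative_continuous)
  have contE: "continuous_on S (\<lambda>s. ?E s w)" for S w
    by (intro continuous_on_flow M continuous_intros)
  define J where "J T w = integral {0..T} (\<lambda>s. (norm (?E s w))\<^sup>2)" for T w
  have intE: "(\<lambda>s. (norm (?E s w))\<^sup>2) integrable_on {a..b}" for a b w
    by (intro integrable_continuous_interval continuous_intros contE)
  have J_mono: "J T w \<le> J T' w" if "T \<le> T'" for T T' w
    unfolding J_def by (rule integral_subset_le) (use that intE in auto)
  have J_form: "\<exists>Q. linear Q \<and> (\<forall>x. J T x = Q x \<bullet> x)" for T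
    using integral_form[of ?E T "\<lambda>_. 1"] contE
    by (simp add: J_def power2_norm_eq_inner) metis
  have J_cont: "continuous_on S (J T)" for S T
    using J_form[of T] quadratic_continuous[of _ S] by (metis (no_types, lifting) continuous_on_cong)
  have "\<exists>n::nat. \<forall>w. norm w = 1 \<longrightarrow> J (real n) w \<ge> k / r"
  proof (rule ccontr)
    assume "\<not> ?thesis"
    then have "\<forall>n::nat. \<exists>w. norm w = 1 \<and> J (real n) w < k / r" by (simp add: not_le)
    then obtain W where W: "\<And>n. norm (W n) = 1" "\<And>n. J (real n) (W n) < k / r" by metis
    obtain l h where l: "l \<in> sphere (0::'a) 1" and h: "strict_mono (h :: nat \<Rightarrow> nat)"
      and lim: "(W \<circ> h) \<longlonglongrightarrow> l"
      using compact_sphere[of "0::'a" 1] W(1) unfolding compact_def by (metis mem_sphere_0)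
    have "J (real m) l \<le> k / r" for m :: nat
    proof (rule tendsto_upperbound)
      show "(\<lambda>n. J (real m) (W (h n))) \<longlonglongrightarrow> J (real m) l"
        using continuous_on_tendsto_compose[OF J_cont[of "sphere 0 1"] lim[unfolded o_def] l] W(1) by simp
      show "\<forall>\<^sub>F n in sequentially. J (real m) (W (h n)) \<le> k / r"
        using eventually_ge_at_top[of m]
      proof eventually_elim
        case (elim n)
        then have "real m \<le> real (h n)" using seq_suble[OF h, of n] by simp
        then show ?case using J_mono W(2)[of "h n"] by (meson less_imp_le order_trans)
      qed
    qed simp
    then have "J T l \<le> k / r" for T
      using J_mono[of T "real (nat \<lceil>T\<rceil>)" l] by (meson order_trans real_nat_ceiling_ge)
    moreover have "l \<noteq> 0" using l by auto
    from flow_backward_integral_unbounded[OF M marginal this, where k = "k / r"]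
    have "\<exists>T\<ge>0. J T l > k / r" by (simp add: J_def)
    ultimately show False by (meson not_less)
  qed
  then obtain n :: nat where n: "\<And>w. norm w = 1 \<Longrightarrow> J (real n) w \<ge> k / r" by blast
  define T where "T = real n"
  have T: "T \<ge> 0" by (simp add: T_def)
  have Jk: "r * J T w \<ge> k * (norm w)\<^sup>2" for w
  proof (cases "w = 0")
    case False
    define e where "e = w /\<^sub>R norm w"
    have e: "norm e = 1" "w = norm w *\<^sub>R e" using False by (auto simp: e_def)
    have "J T (c *\<^sub>R e) = c\<^sup>2 * J T e" for c
      by (simp add: J_def linear_cmul power_mult_distrib)
    from this[of "norm w"] have "J T w = (norm w)\<^sup>2 * J T e" using e(2) by simp
    moreover have "k \<le> r * J T e" using n[OF e(1)] r by (simp add: T_def field_simps)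
    ultimately show ?thesis using mult_left_mono[of k "r * J T e" "(norm w)\<^sup>2"] by (simp add: algebra_simps)
  qed (simp add: J_def linear_0)
  obtain Q3 where Q3: "linear Q3" "\<And>x y. Q3 x \<bullet> y = integral {0..T} (\<lambda>s. 1 * (?G s x \<bullet> ?G s y))"
      "\<And>x y. Q3 x \<bullet> y = x \<bullet> Q3 y"
    using integral_form[of ?G T "\<lambda>s. 1", OF linG contG continuous_on_const] by blast
  have der3: "2 * (Q3 w \<bullet> M w) = (norm (C w))\<^sup>2 - (norm (?G T w))\<^sup>2" for w
  proof -
    have "((\<lambda>s. - 2 * (?G s w \<bullet> ?G s (M w))) has_integral (?G T w \<bullet> ?G T w - ?G 0 w \<bullet> ?G 0 w)) {0..T}"
    proof (rule fundamental_theorem_of_calculus[OF T])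
      fix s :: real
      show "((\<lambda>s. ?G s w \<bullet> ?G s w) has_vector_derivative - 2 * (?G s w \<bullet> ?G s (M w))) (at s within {0..T})"
        using has_real_derivative_inner[OF derG[of w s "{0..T}"] derG[of w s "{0..T}"]]
        by (simp add: has_real_derivative_iff_has_vector_derivative inner_commute)
    qed
    from integral_unique[OF this] show ?thesis
      unfolding Q3(2) by (simp add: power2_norm_eq_inner)
  qed
  let ?A = "adjoint (?E T)"
  have adj: "x \<bullet> ?A y = ?E T x \<bullet> y" "?A y \<bullet> x = y \<bullet> ?E T x" for x y
    using adjoint_works[OF linear_flow] by (simp_all add: inner_commute)
  define Q' where "Q' w = ?A (Q (?E T w)) + \<rho> *\<^sub>R Q3 w" for w
  have linQ': "linear Q'"
    using linear_compose_add[OF linear_compose[OF linear_compose[OF linear_flow Q(1)] adjoint_linear[OF linear_flow]]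
        linear_compose_scale_right[OF Q3(1), of \<rho>]]
    by (simp add: Q'_def[abs_def] o_def)
  have Q': "Q' x \<bullet> y = Q (?E T x) \<bullet> ?E T y + \<rho> * (Q3 x \<bullet> y)" for x y
    by (simp add: Q'_def inner_simps adj)
  have symQ': "Q' x \<bullet> y = x \<bullet> Q' y" for x y
    using Q(2)[of "?E T x" "?E T y"] Q3(3)[of x y] Q'[of x y] Q'[of y x]
    by (simp add: inner_commute)
  obtain m where m: "\<And>x. norm (flow M T x) \<le> m * norm x" "m > 0"
    using linear_bounded_pos[OF linear_flow] by blast
  have bk: "r / m\<^sup>2 * (norm w)\<^sup>2 \<le> r * (norm (?E T w))\<^sup>2" for w
  proof -
    have "norm w \<le> m * norm (?E T w)" using m(1)[of "?E T w"] by simp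
    then have "(norm w)\<^sup>2 \<le> m\<^sup>2 * (norm (?E T w))\<^sup>2"
      using power_mono[of "norm w" "m * norm (?E T w)" 2] by (simp add: power_mult_distrib)
    then show ?thesis using r m(2) by (simp add: field_simps)
  qed
  have "2 * (Q' w \<bullet> M w) + r / m\<^sup>2 * (norm w)\<^sup>2 \<le> \<rho> * (norm (C w))\<^sup>2" for w
  proof -
    have "2 * (Q' w \<bullet> M w) = 2 * (Q (?E T w) \<bullet> M (?E T w)) + \<rho> * ((norm (C w))\<^sup>2 - (norm (?G T w))\<^sup>2)"
      unfolding Q' der3[symmetric] by (simp add: flow_commute[OF M])
    then show ?thesis using ineq[of "?E T w"] bk[of w] by (simp add: algebra_simps)
  qed
  moreover have "Q' w \<bullet> w \<ge> k * (norm w)\<^sup>2" for w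
  proof -
    let ?h = "\<lambda>s. Q (?E s w) \<bullet> ?E s w"
    have hi: "((\<lambda>s. - 2 * (Q (?E s w) \<bullet> M (?E s w))) has_integral (?h T - ?h 0)) {0..T}"
    proof (rule fundamental_theorem_of_calculus[OF T])
      fix s :: real
      have d: "((\<lambda>s. ?E s w) has_vector_derivative - M (?E s w)) (at s within {0..T})"
        using flow_back_derivative[OF M, of w s] by (simp add: flow_commute[OF M])
      show "(?h has_vector_derivative - 2 * (Q (?E s w) \<bullet> M (?E s w))) (at s within {0..T})"
      proof -
        have "Q (- M e) \<bullet> e + Q e \<bullet> - M e = - 2 * (Q e \<bullet> M e)" for e
          using Q(2)[of "M e" e] by (simp add: linear_neg[OF Q(1)] inner_commute)
        with has_real_derivative_inner[OF linear_has_vector_derivative[OF Q(1) d] d] show ?thesis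
          by (simp only: has_real_derivative_iff_has_vector_derivative)
      qed
    qed
    have hj: "((\<lambda>s. r * (norm (?E s w))\<^sup>2 - \<rho> * (?G s w \<bullet> ?G s w)) has_integral (r * J T w - \<rho> * (Q3 w \<bullet> w))) {0..T}"
    proof -
      have "((\<lambda>s. (norm (?E s w))\<^sup>2) has_integral J T w) {0..T}"
        unfolding J_def by (rule integrable_integral[OF intE])
      moreover have "((\<lambda>s. ?G s w \<bullet> ?G s w) has_integral (Q3 w \<bullet> w)) {0..T}"
        unfolding Q3(2) mult_1
        by (rule integrable_integral) (intro integrable_continuous_interval continuous_intros contG)
      ultimately show ?thesis by (intro has_integral_diff has_integral_mult_right)
    qed
    have "r * J T w - \<rho> * (Q3 w \<bullet> w) \<le> ?h T - ?h 0"
    proof (rule has_integral_le[OF hj hi])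
      fix s
      show "r * (norm (?E s w))\<^sup>2 - \<rho> * (?G s w \<bullet> ?G s w) \<le> - 2 * (Q (?E s w) \<bullet> M (?E s w))"
        using ineq[of "?E s w"] by (simp add: power2_norm_eq_inner)
    qed
    then show ?thesis using Jk[of w] Q(3)[of "?E 0 w"] unfolding Q' by linarith
  qed
  ultimately show ?thesis
    using linQ' r m(2) symQ'
    by (intro exI[of _ Q'] exI[of _ "r / m\<^sup>2"]) simp
qed

text \<open>
  The operator \<open>P\<close> is \<open>\<rho> Q\<^sup>-\<^sup>1\<close> for a form \<open>Q\<close> of the dual system: the substitution \<open>x = Q y\<close> turns the dual
  inequality into the asserted one, and a large \<open>Q\<close> gives a small \<open>P\<close>.
\<close>

lemma low_gain:
  fixes Y :: "'a::euclidean_space \<Rightarrow> 'a" and B :: "'b::euclidean_space \<Rightarrow> 'a"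
  assumes Y: "linear Y" and B: "linear B"
    and stab: "\<And>a b u v. eigenpair (adjoint Y) a b u v \<Longrightarrow> adjoint B u = 0 \<Longrightarrow> adjoint B v = 0 \<Longrightarrow> a < 0"
    and marginal: "\<And>a b u v. eigenpair (adjoint Y) a b u v \<Longrightarrow> a \<le> 0"
    and \<gamma>: "\<gamma> > 0"
  shows "\<exists>P \<epsilon> k. linear P \<and> (\<forall>x y. P x \<bullet> y = x \<bullet> P y) \<and> k > 0 \<and> (\<forall>x. P x \<bullet> x \<ge> k * (norm x)\<^sup>2) \<and>
     (\<forall>x. norm (P x) \<le> \<gamma> * norm x) \<and> \<epsilon> > 0 \<and>
     (\<forall>x. 2 * (P x \<bullet> Y x) \<le> (norm (adjoint B (P x)))\<^sup>2 - \<epsilon> * (norm x)\<^sup>2)"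
proof -
  let ?M = "adjoint Y" and ?C = "adjoint B"
  have M: "linear ?M" and C: "linear ?C" using Y B by (simp_all add: adjoint_linear)
  have "\<exists>Q \<rho> r. linear Q \<and> (\<forall>x y. Q x \<bullet> y = x \<bullet> Q y) \<and> (\<forall>x. Q x \<bullet> x \<ge> 0) \<and> \<rho> \<ge> 0 \<and> r > 0 \<and>
     (\<forall>x. 2 * (Q x \<bullet> ?M x) + r * (norm x)\<^sup>2 \<le> \<rho> * (norm (?C x))\<^sup>2)"
    by (rule strict_observability_form[OF M C]) (rule stab)
  then obtain Q0 \<rho>0 r0 where Q0': "linear Q0 \<and> (\<forall>x y. Q0 x \<bullet> y = x \<bullet> Q0 y) \<and> (\<forall>x. Q0 x \<bullet> x \<ge> 0) \<and> \<rho>0 \<ge> 0 \<and> r0 > 0 \<and>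
     (\<forall>x. 2 * (Q0 x \<bullet> ?M x) + r0 * (norm x)\<^sup>2 \<le> \<rho>0 * (norm (?C x))\<^sup>2)"
    by blast
  then have Q0: "linear Q0" "\<And>x y. Q0 x \<bullet> y = x \<bullet> Q0 y" "\<And>x. Q0 x \<bullet> x \<ge> 0" "\<rho>0 \<ge> 0" "r0 > 0"
     "\<And>x. 2 * (Q0 x \<bullet> ?M x) + r0 * (norm x)\<^sup>2 \<le> \<rho>0 * (norm (?C x))\<^sup>2"
    by blast+
  \<comment> \<open>The inequality survives an increase of \<open>\<rho>0\<close>, and \<open>\<rho>\<close> has to be positive.\<close>
  define \<rho> where "\<rho> = \<rho>0 + 1"
  have \<rho>: "\<rho> > 0" using Q0(4) by (simp add: \<rho>_def)
  have ineq0: "2 * (Q0 x \<bullet> ?M x) + r0 * (norm x)\<^sup>2 \<le> \<rho> * (norm (?C x))\<^sup>2" for x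
    using Q0(6)[of x] zero_le_power2[of "norm (?C x)"] unfolding \<rho>_def distrib_right by linarith
  define k where "k = \<rho> / \<gamma>"
  have k: "k > 0" using \<rho> \<gamma> by (simp add: k_def)
  have "\<exists>Q' r'. linear Q' \<and> (\<forall>x y. Q' x \<bullet> y = x \<bullet> Q' y) \<and> (\<forall>x. Q' x \<bullet> x \<ge> k * (norm x)\<^sup>2) \<and> r' > 0 \<and>
     (\<forall>x. 2 * (Q' x \<bullet> ?M x) + r' * (norm x)\<^sup>2 \<le> \<rho> * (norm (?C x))\<^sup>2)"
    by (rule unbounded_form[OF M C _ Q0(1-3) less_imp_le[OF \<rho>] Q0(5) ineq0]) (rule marginal)
  then obtain Q r where Q': "linear Q \<and> (\<forall>x y. Q x \<bullet> y = x \<bullet> Q y) \<and> (\<forall>x. Q x \<bullet> x \<ge> k * (norm x)\<^sup>2) \<and> r > 0 \<and>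
     (\<forall>x. 2 * (Q x \<bullet> ?M x) + r * (norm x)\<^sup>2 \<le> \<rho> * (norm (?C x))\<^sup>2)"
    by blast
  then have Q: "linear Q" "\<And>x y. Q x \<bullet> y = x \<bullet> Q y" "\<And>x. Q x \<bullet> x \<ge> k * (norm x)\<^sup>2" "r > 0"
     "\<And>x. 2 * (Q x \<bullet> ?M x) + r * (norm x)\<^sup>2 \<le> \<rho> * (norm (?C x))\<^sup>2"
    by blast+
  have lower: "k * norm w \<le> norm (Q w)" for w
  proof (cases "w = 0")
    case False
    have "k * norm w * norm w \<le> norm (Q w) * norm w"
      using Q(3)[of w] norm_cauchy_schwarz[of "Q w" w] by (simp add: power2_eq_square mult.assoc)
    then show ?thesis using False by simp
  qed simp
  have "inj Q"
  proof (rule linear_injective_0[OF Q(1), THEN iffD2], intro allI impI)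
    fix x assume "Q x = 0"
    then have "k * norm x \<le> 0" using lower[of x] by simp
    then show "x = 0" using k by (simp add: mult_le_0_iff)
  qed
  then obtain G where G: "linear G" "\<And>x. G (Q x) = x" "\<And>x. Q (G x) = x"
    using linear_injective_isomorphism[OF Q(1)] by metis
  define P where "P x = \<rho> *\<^sub>R G x" for x
  obtain m where m: "\<And>x. norm (Q x) \<le> m * norm x" "m > 0"
    using linear_bounded_pos[OF Q(1)] by blast
  have Gup: "norm (G x) \<le> norm x / k" for x
    using lower[of "G x"] k by (simp add: G field_simps)
  have Glow: "(norm x)\<^sup>2 / m\<^sup>2 \<le> (norm (G x))\<^sup>2" for x
    using power_mono[OF m(1)[of "G x"], of 2] m(2) by (simp add: G power_mult_distrib field_simps)
  show ?thesis
  proof (rule exI[of _ P], rule exI[of _ "\<rho> * r / m\<^sup>2"], rule exI[of _ "\<rho> * k / m\<^sup>2"], intro conjI allI)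
    show "linear P" using linear_compose_scale_right[OF G(1)] by (simp add: P_def[abs_def])
    show "P x \<bullet> y = x \<bullet> P y" for x y
      using Q(2)[of "G x" "G y"] by (simp add: P_def G inner_commute)
    show "\<rho> * k / m\<^sup>2 > 0" "\<rho> * r / m\<^sup>2 > 0" using \<rho> k Q(4) m(2) by simp_all
    fix x
    have "\<rho> * k * ((norm x)\<^sup>2 / m\<^sup>2) \<le> \<rho> * k * (norm (G x))\<^sup>2"
      using Glow \<rho> k by (intro mult_left_mono) auto
    also have "\<dots> \<le> P x \<bullet> x"
      using mult_left_mono[OF Q(3)[of "G x"], of \<rho>] \<rho> by (simp add: G P_def inner_commute mult.assoc)
    finally show "\<rho> * k / m\<^sup>2 * (norm x)\<^sup>2 \<le> P x \<bullet> x" by simp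
    show "norm (P x) \<le> \<gamma> * norm x"
      using mult_left_mono[OF Gup[of x], of \<rho>] \<rho> \<gamma> by (simp add: P_def k_def mult.commute)
    have "2 * (P x \<bullet> Y x) = \<rho> * (2 * (Q (G x) \<bullet> ?M (G x)))"
      by (simp add: P_def G adjoint_works[OF Y] inner_commute)
    also have "\<dots> \<le> \<rho> * (\<rho> * (norm (?C (G x)))\<^sup>2 - r * (norm (G x))\<^sup>2)"
      using Q(5)[of "G x"] \<rho> by (intro mult_left_mono) auto
    also have "\<dots> = (norm (?C (P x)))\<^sup>2 - \<rho> * r * (norm (G x))\<^sup>2"
      by (simp add: P_def linear_cmul[OF C] power_mult_distrib algebra_simps power2_eq_square)
    also have "\<dots> \<le> (norm (?C (P x)))\<^sup>2 - \<rho> * r * ((norm x)\<^sup>2 / m\<^sup>2)"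
      using Glow[of x] \<rho> Q(4) by (intro diff_left_mono mult_left_mono) auto
    finally show "2 * (P x \<bullet> Y x) \<le> (norm (?C (P x)))\<^sup>2 - \<rho> * r / m\<^sup>2 * (norm x)\<^sup>2" by simp
  qed
qed

section \<open>A Lyapunov-Krasovskii functional for delayed feedback\<close>

lemma integral_square_le:
  fixes f :: "real \<Rightarrow> real"
  assumes "a \<le> b" and f: "continuous_on {a..b} f"
  shows "(integral {a..b} f)\<^sup>2 \<le> (b - a) * integral {a..b} (\<lambda>s. (f s)\<^sup>2)"
proof (cases "a = b")
  case False
  define L where "L = b - a"
  have L: "L > 0" using False assms(1) by (simp add: L_def)
  define m where "m = integral {a..b} f / L"
  have int: "f integrable_on {a..b}" "(\<lambda>s. (f s)\<^sup>2) integrable_on {a..b}"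
    by (intro integrable_continuous_interval continuous_intros f)+
  have i: "((\<lambda>s. (f s)\<^sup>2 - 2 * m * f s + m\<^sup>2) has_integral
      (integral {a..b} (\<lambda>s. (f s)\<^sup>2) - 2 * m * integral {a..b} f + m\<^sup>2 * L)) {a..b}"
    using has_integral_const_real[of "m\<^sup>2" a b] assms(1)
    by (intro has_integral_add has_integral_diff has_integral_mult_right integrable_integral int)
       (simp add: L_def mult.commute)
  have "0 \<le> integral {a..b} (\<lambda>s. (f s)\<^sup>2) - 2 * m * integral {a..b} f + m\<^sup>2 * L"
  proof (rule has_integral_nonneg[OF i])
    show "0 \<le> (f s)\<^sup>2 - 2 * m * f s + m\<^sup>2" for s
      using zero_le_power2[of "f s - m"] by (simp add: power2_diff algebra_simps)
  qed
  then have "0 \<le> L * (integral {a..b} (\<lambda>s. (f s)\<^sup>2) - 2 * m * integral {a..b} f + m\<^sup>2 * L)"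
    using L by simp
  also have "\<dots> = L * integral {a..b} (\<lambda>s. (f s)\<^sup>2) - (integral {a..b} f)\<^sup>2"
    using L by (simp add: m_def power2_eq_square field_simps)
  finally show ?thesis by (simp add: L_def)
qed simp

lemma integral_has_real_derivative_from:
  fixes f :: "real \<Rightarrow> real"
  assumes f: "continuous_on {0..} f" and t: "t \<ge> 0"
  shows "((\<lambda>t. integral {0..t} f) has_real_derivative f t) (at t within {0..})"
proof -
  have "((\<lambda>u. integral {0..u} f) has_vector_derivative f t) (at t within {0..t + 1})"
    by (rule integral_has_vector_derivative[OF continuous_on_subset[OF f]]) (use t in auto)
  moreover have "at t within {0..t + 1} = at t within {0..}"
    by (rule at_within_nhd[of t "{..<t + 1}"]) (use t in auto)
  ultimately show ?thesis by (simp add: has_real_derivative_iff_has_vector_derivative)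
qed

text \<open>
  The integral of \<open>(s - t + \<tau>) G(s)\<close> over \<open>[t - \<tau>, t]\<close>, expanded so that the fundamental theorem of calculus applies
  to each term. Its derivative trades the present value \<open>\<tau> G(t)\<close> for the integral of \<open>G\<close> over the past window,
  which is the term that pays for the prediction error.
\<close>

definition window_functional :: "real \<Rightarrow> (real \<Rightarrow> real) \<Rightarrow> real \<Rightarrow> real" where
  "window_functional \<tau> G t = integral {0..t} (\<lambda>s. s * G s) - integral {0..t - \<tau>} (\<lambda>s. s * G s)
     - (t - \<tau>) * (integral {0..t} G - integral {0..t - \<tau>} G)"

lemma window_functional:
  assumes G: "continuous_on {0..} G" "\<And>s. s \<ge> 0 \<Longrightarrow> G s \<ge> 0" and \<tau>: "\<tau> \<ge> 0" and t: "t \<ge> \<tau>"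
  shows window_functional_nonneg: "window_functional \<tau> G t \<ge> 0"
    and window_functional_le: "window_functional \<tau> G t \<le> \<tau> * integral {t - \<tau>..t} G"
    and window_functional_deriv: "(window_functional \<tau> G has_real_derivative \<tau> * G t - integral {t - \<tau>..t} G) (at t within {\<tau>..})"
proof -
  have sub: "continuous_on {a..b} G" if "a \<ge> 0" for a b
    using G(1) by (rule continuous_on_subset) (use that in auto)
  have int: "G integrable_on {a..b}" "(\<lambda>s. s * G s) integrable_on {a..b}" "(\<lambda>s. c * G s) integrable_on {a..b}" if "a \<ge> 0" for a b c
    by (intro integrable_continuous_interval continuous_intros sub that)+
  have comb: "integral {0..t} f - integral {0..t - \<tau>} f = integral {t - \<tau>..t} f" if "f integrable_on {0..t}" for f :: "real \<Rightarrow> real"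
    using Henstock_Kurzweil_Integration.integral_combine[of 0 "t - \<tau>" t f] that \<tau> t by simp
  have W: "window_functional \<tau> G t = integral {t - \<tau>..t} (\<lambda>s. s * G s - (t - \<tau>) * G s)"
    unfolding window_functional_def using t
    by (subst integral_diff) (simp_all add: comb int)
  show "window_functional \<tau> G t \<ge> 0"
    unfolding W using t G(2)
    by (intro integral_nonneg integrable_diff int) (auto simp flip: left_diff_distrib)
  have "window_functional \<tau> G t \<le> integral {t - \<tau>..t} (\<lambda>s. \<tau> * G s)"
    unfolding W
  proof (intro integral_le integrable_diff int)
    fix s assume s: "s \<in> {t - \<tau>..t}"
    then have "(s - (t - \<tau>)) * G s \<le> \<tau> * G s" using G(2) t by (intro mult_right_mono) auto
    then show "s * G s - (t - \<tau>) * G s \<le> \<tau> * G s" by (simp add: left_diff_distrib)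
  qed (use t in auto)
  then show "window_functional \<tau> G t \<le> \<tau> * integral {t - \<tau>..t} G" by simp
  have d1: "((\<lambda>t. integral {0..t} f) has_real_derivative f t) (at t within {\<tau>..})" if "continuous_on {0..} f" for f
    by (rule DERIV_subset[OF integral_has_real_derivative_from[OF that]]) (use \<tau> t in auto)
  have d2: "((\<lambda>t. integral {0..t - \<tau>} f) has_real_derivative f (t - \<tau>)) (at t within {\<tau>..})" if "continuous_on {0..} f" for f
  proof -
    have "((\<lambda>t. t - \<tau>) has_real_derivative 1) (at t within {\<tau>..})" by (auto intro!: derivative_eq_intros)
    moreover have "((\<lambda>t. integral {0..t} f) has_real_derivative f (t - \<tau>)) (at (t - \<tau>) within (\<lambda>t. t - \<tau>) ` {\<tau>..})"
      by (rule DERIV_subset[OF integral_has_real_derivative_from[OF that]]) (use t in auto)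
    ultimately show ?thesis using DERIV_image_chain[of "\<lambda>t. integral {0..t} f" _ "\<lambda>t. t - \<tau>" t "{\<tau>..}" 1]
      by (simp add: o_def)
  qed
  have cG: "continuous_on {0..} (\<lambda>s. s * G s)" by (intro continuous_intros G)
  have "(window_functional \<tau> G has_real_derivative (t * G t - (t - \<tau>) * G (t - \<tau>)
      - ((t - \<tau>) * (G t - G (t - \<tau>)) + 1 * (integral {0..t} G - integral {0..t - \<tau>} G)))) (at t within {\<tau>..})"
    unfolding window_functional_def[abs_def]
    by (rule derivative_eq_intros d1[OF cG] d2[OF cG] d1[OF G(1)] d2[OF G(1)] refl | simp)+
  then show "(window_functional \<tau> G has_real_derivative \<tau> * G t - integral {t - \<tau>..t} G) (at t within {\<tau>..})"
    using comb[of G] int(1)[of 0] by (simp add: algebra_simps)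
qed

text \<open>
  What the stability proof uses of a feedback \<open>K\<close> for the delay-free system: a Lyapunov operator \<open>P\<close>, and a seminorm-like
  quantity \<open>n\<close> (in the application \<open>|B\<^sup>T P x|\<close>) that bounds both the control and its effect on the Lyapunov
  function, and whose square is part of the decrease of that function. The constant \<open>c1\<close> must not depend on the gain, whereas
  \<open>\<kappa>0\<close> bounds the gain and can be made small.
\<close>

definition feedback_certificate ::
  "real \<Rightarrow> real \<Rightarrow> ('a::euclidean_space \<Rightarrow> 'a) \<Rightarrow> ('a \<Rightarrow> 'a) \<Rightarrow> ('b::euclidean_space \<Rightarrow> 'a) \<Rightarrow> ('a \<Rightarrow> 'b)
    \<Rightarrow> ('a \<Rightarrow> real) \<Rightarrow> real \<Rightarrow> real \<Rightarrow> real \<Rightarrow> bool" where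
  "feedback_certificate c1 \<kappa>0 P Y B K n p l \<epsilon> \<longleftrightarrow>
     linear P \<and> (\<forall>x y. P x \<bullet> y = x \<bullet> P y) \<and> l > 0 \<and> (\<forall>x. P x \<bullet> x \<ge> l * (norm x)\<^sup>2) \<and>
     p > 0 \<and> (\<forall>x. norm (P x) \<le> p * norm x) \<and> linear K \<and> (\<forall>x. norm (K x) \<le> \<kappa>0 * norm x) \<and>
     linear B \<and> (\<forall>x. n x \<ge> 0) \<and> (\<forall>x. norm (K x) \<le> c1 * n x) \<and> (\<forall>x u. P x \<bullet> B u \<le> c1 * n x * norm u) \<and>
     \<epsilon> > 0 \<and> (\<forall>x. 2 * (P x \<bullet> (Y x + B (K x))) \<le> - \<epsilon> * (norm x)\<^sup>2 - (n x)\<^sup>2)"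

text \<open>
  The control acts on \<open>X t - r t\<close>, a prediction of the state with error \<open>r\<close> bounded by an integral over the delay
  window; \<open>\<Delta>\<close> is a small relative perturbation. Decay is required from time \<open>\<tau>\<close> on, when the window lies in the domain
  of the differential equation.
\<close>

definition delayed_feedback_decay ::
  "real \<Rightarrow> real \<Rightarrow> ('a::euclidean_space \<Rightarrow> 'a) \<Rightarrow> ('b::euclidean_space \<Rightarrow> 'a) \<Rightarrow> ('a \<Rightarrow> 'b)
    \<Rightarrow> real \<Rightarrow> real \<Rightarrow> real \<Rightarrow> bool" where
  "delayed_feedback_decay \<tau> \<phi> Y B K \<eta> \<kappa> \<alpha> \<longleftrightarrow> (\<forall>X U \<Delta> r M.
     continuous_on {0..} X \<longrightarrow> continuous_on {0..} U \<longrightarrow>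
     (\<forall>t\<ge>\<tau>. (X has_vector_derivative Y (X t) + B (U t) + \<Delta> t) (at t within {\<tau>..})) \<longrightarrow>
     (\<forall>t\<ge>\<tau>. norm (\<Delta> t) \<le> \<eta> * (norm (X t) + norm (U t))) \<longrightarrow>
     (\<forall>t\<ge>\<tau>. U t = K (X t - r t)) \<longrightarrow>
     (\<forall>t\<ge>\<tau>. norm (r t) \<le> \<phi> * integral {t - \<tau>..t} (\<lambda>s. norm (U s) + \<eta> * norm (X s))) \<longrightarrow>
     (\<forall>s\<in>{0..\<tau>}. norm (X s) \<le> M \<and> norm (U s) \<le> M) \<longrightarrow>
     (\<forall>t\<ge>\<tau>. norm (X t) \<le> \<kappa> * M * exp (- \<alpha> * t)))"

text \<open>
  The admissible gain \<open>\<kappa>0\<close> depends on \<open>\<tau>\<close>, \<open>\<phi>\<close> and \<open>c1\<close> only and is fixed before the certificate. Differentiating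
  \<open><P X, X>\<close> plus the window functional of \<open>G = \<delta> |U|\<^sup>2 + \<theta> |X|\<^sup>2\<close> gives \<open>- \<epsilon> |X|\<^sup>2 - n\<^sup>2\<close> and
  \<open>- \<integral> G\<close> on the good side. The bad terms are \<open>\<tau> G(t)\<close>, absorbed by \<open>n\<^sup>2\<close> and \<open>\<epsilon> |X|\<^sup>2\<close> for small \<open>\<delta>\<close>
  and \<open>\<theta>\<close>, and \<open>|K r|\<^sup>2 \<le> \<kappa>0\<^sup>2 |r|\<^sup>2\<close>. By the Cauchy-Schwarz inequality the latter is at most a constant times
  \<open>\<kappa>0\<^sup>2 \<integral> G / \<delta>\<close>, hence absorbed by \<open>\<integral> G\<close> for small \<open>\<kappa>0\<close>.
\<close>

lemma delay_lyapunov: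
  fixes \<tau> \<phi> c1 :: real
  assumes \<tau>: "\<tau> \<ge> 0" and \<phi>: "\<phi> > 0" and c1: "c1 > 0"
  shows "\<exists>\<kappa>0>0. \<forall>(P :: 'a::euclidean_space \<Rightarrow> 'a) Y (B :: 'b::euclidean_space \<Rightarrow> 'a) K n p l \<epsilon>.
    feedback_certificate c1 \<kappa>0 P Y B K n p l \<epsilon> \<longrightarrow>
    (\<exists>\<eta>>0. \<exists>\<kappa>>0. \<exists>\<alpha>>0. delayed_feedback_decay \<tau> \<phi> Y B K \<eta> \<kappa> \<alpha>)"
proof -
  \<comment> \<open>The terms \<open>\<delta> (1 + \<tau>) |U|\<^sup>2\<close> then use up only an eighth of \<open>n\<^sup>2\<close>.\<close>
  define \<delta> where "\<delta> = 1 / (16 * c1\<^sup>2 * (1 + \<tau>))"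
  have "c1 \<noteq> 0" "1 + \<tau> \<noteq> 0" using c1 \<tau> by simp_all
  then have \<delta>: "\<delta> > 0" "\<delta> * (1 + \<tau>) * (2 * c1\<^sup>2) = 1/8"
    using c1 \<tau> by (simp_all add: \<delta>_def)
  \<comment> \<open>The total coefficient of \<open>|K r|\<^sup>2\<close>: from the cross term and from the part of \<open>|U|\<^sup>2\<close> that is due to \<open>r\<close>.\<close>
  define c3 where "c3 = 2 * c1\<^sup>2 + 1 / (8 * c1\<^sup>2)"
  have c3: "c3 > 0" using c1 by (simp add: c3_def add_pos_pos)
  \<comment> \<open>Chosen so that \<open>c3 |K r|\<^sup>2\<close> is at most half the integral of \<open>G\<close> over the window.\<close>
  define \<kappa>0 where "\<kappa>0 = sqrt (\<delta> / (4 * c3 * \<phi>\<^sup>2 * (\<tau> + 1)))"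
  have \<kappa>0: "\<kappa>0 > 0" using \<delta> c3 \<phi> \<tau> by (simp add: \<kappa>0_def)
  have \<kappa>0_sq: "c3 * \<kappa>0\<^sup>2 * (\<phi>\<^sup>2 * (2 * \<tau>)) \<le> \<delta> / 2"
  proof -
    have "\<kappa>0\<^sup>2 = \<delta> / (4 * c3 * \<phi>\<^sup>2 * (\<tau> + 1))" using \<delta> c3 \<phi> \<tau> by (simp add: \<kappa>0_def)
    moreover have "c3 * (\<delta> / (4 * c3 * z * y)) * (z * (2 * \<tau>)) = \<delta> / 2 * (\<tau> / y)" if "z > 0" "y > 0" for z y
      using c3 that by simp
    ultimately have "c3 * \<kappa>0\<^sup>2 * (\<phi>\<^sup>2 * (2 * \<tau>)) = \<delta> / 2 * (\<tau> / (\<tau> + 1))"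
      using \<phi> \<tau> by simp
    also have "\<dots> \<le> \<delta> / 2 * 1" using \<delta> \<tau> by (intro mult_left_mono) auto
    finally show ?thesis by simp
  qed
  show ?thesis
  proof (rule exI[of _ \<kappa>0], intro conjI \<kappa>0 allI impI)
    fix P :: "'a \<Rightarrow> 'a" and Y :: "'a \<Rightarrow> 'a" and B :: "'b \<Rightarrow> 'a" and K and n :: "'a \<Rightarrow> real" and p l \<epsilon> :: real
    assume "feedback_certificate c1 \<kappa>0 P Y B K n p l \<epsilon>"
    then have P: "linear P" "\<forall>x y. P x \<bullet> y = x \<bullet> P y" and l: "l > 0" "\<forall>x. P x \<bullet> x \<ge> l * (norm x)\<^sup>2"
      and p: "p > 0" "\<forall>x. norm (P x) \<le> p * norm x" and K: "linear K" "\<forall>x. norm (K x) \<le> \<kappa>0 * norm x"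
      and B: "linear B" and n: "\<forall>x. n x \<ge> 0" "\<forall>x. norm (K x) \<le> c1 * n x"
      and PB: "\<forall>x u. P x \<bullet> B u \<le> c1 * n x * norm u"
      and \<epsilon>: "\<epsilon> > 0" and ineq: "\<forall>x. 2 * (P x \<bullet> (Y x + B (K x))) \<le> - \<epsilon> * (norm x)\<^sup>2 - (n x)\<^sup>2"
      unfolding feedback_certificate_def by blast+
    \<comment> \<open>A quarter of \<open>\<epsilon> |X|\<^sup>2\<close> pays for the state part of \<open>\<tau> G(t)\<close>, another quarter for the perturbation; half of it remains.\<close>
    define \<theta> where "\<theta> = \<epsilon> / (4 * (\<tau> + 1))"
    have \<theta>: "\<theta> > 0" "\<tau> * \<theta> \<le> \<epsilon> / 4" using \<epsilon> \<tau> by (auto simp: \<theta>_def field_simps)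
    define \<eta> where "\<eta> = min (min (\<delta> / p) (\<epsilon> / (12 * p))) (min 1 (\<theta> / \<delta>))"
    have \<eta>: "\<eta> > 0" "\<eta> * p \<le> \<delta>" "3 * p * \<eta> \<le> \<epsilon> / 4" "\<eta> \<le> 1" "\<eta> * \<delta> \<le> \<theta>"
    proof -
      have "\<eta> \<le> \<delta> / p" "\<eta> \<le> \<epsilon> / (12 * p)" "\<eta> \<le> \<theta> / \<delta>" unfolding \<eta>_def by simp_all
      then show "\<eta> * p \<le> \<delta>" "3 * p * \<eta> \<le> \<epsilon> / 4" "\<eta> * \<delta> \<le> \<theta>" using p(1) \<delta>(1) by (auto simp: field_simps)
      show "\<eta> > 0" "\<eta> \<le> 1" using p(1) \<delta>(1) \<epsilon> \<theta>(1) by (auto simp: \<eta>_def)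
    qed
    \<comment> \<open>The rate at which the remaining negative terms dominate the functional itself.\<close>
    define \<alpha> where "\<alpha> = min (\<epsilon> / (2 * p)) (1 / (2 * \<tau> + 2))"
    have \<alpha>: "\<alpha> > 0" "\<alpha> * p \<le> \<epsilon> / 2" "\<alpha> * \<tau> \<le> 1 / 2"
    proof -
      show "\<alpha> > 0" using \<epsilon> p \<tau> by (simp add: \<alpha>_def)
      have "\<alpha> \<le> \<epsilon> / (2 * p)" "\<alpha> \<le> 1 / (2 * \<tau> + 2)" unfolding \<alpha>_def by simp_all
      then show "\<alpha> * p \<le> \<epsilon> / 2" using p(1) by (simp add: field_simps)
      have "\<alpha> * (2 * \<tau> + 2) \<le> 1" using \<open>\<alpha> \<le> 1 / (2 * \<tau> + 2)\<close> \<tau> by (simp add: field_simps)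
      then show "\<alpha> * \<tau> \<le> 1 / 2" using \<open>\<alpha> > 0\<close> by (simp add: distrib_left)
    qed
    define w0 where "w0 = p + \<tau> * (\<tau> * (\<delta> + \<theta>))"
    have w0: "w0 > 0" using p(1) \<tau> \<delta>(1) \<theta>(1) by (auto simp: w0_def intro: add_pos_nonneg)
    define \<kappa> where "\<kappa> = sqrt (w0 / l * exp (\<alpha> * \<tau>))"
    have \<kappa>: "\<kappa> > 0" using w0 l(1) by (simp add: \<kappa>_def)
    show "\<exists>\<eta>>0. \<exists>\<kappa>>0. \<exists>\<alpha>>0. delayed_feedback_decay \<tau> \<phi> Y B K \<eta> \<kappa> \<alpha>"
      unfolding delayed_feedback_decay_def
    proof (rule exI[of _ \<eta>], rule conjI[OF \<eta>(1)], rule exI[of _ \<kappa>], rule conjI[OF \<kappa>],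
        rule exI[of _ "\<alpha> / 2"], rule conjI, use \<alpha>(1) in simp, intro allI impI)
      fix X :: "real \<Rightarrow> 'a" and U :: "real \<Rightarrow> 'b" and \<Delta> :: "real \<Rightarrow> 'a" and r :: "real \<Rightarrow> 'a" and M t1 :: real
      assume cX: "continuous_on {0..} X" and cU: "continuous_on {0..} U"
        and der: "\<forall>t\<ge>\<tau>. (X has_vector_derivative Y (X t) + B (U t) + \<Delta> t) (at t within {\<tau>..})"
        and \<Delta>: "\<forall>t\<ge>\<tau>. norm (\<Delta> t) \<le> \<eta> * (norm (X t) + norm (U t))"
        and U: "\<forall>t\<ge>\<tau>. U t = K (X t - r t)"
        and r: "\<forall>t\<ge>\<tau>. norm (r t) \<le> \<phi> * integral {t - \<tau>..t} (\<lambda>s. norm (U s) + \<eta> * norm (X s))"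
        and M: "\<forall>s\<in>{0..\<tau>}. norm (X s) \<le> M \<and> norm (U s) \<le> M" and t1: "t1 \<ge> \<tau>"
      define G where "G s = \<delta> * (norm (U s))\<^sup>2 + \<theta> * (norm (X s))\<^sup>2" for s
      have cG: "continuous_on {0..} G" unfolding G_def by (intro continuous_intros cX cU)
      have Gnn: "G s \<ge> 0" for s using \<delta>(1) \<theta>(1) by (simp add: G_def)
      define W where "W t = P (X t) \<bullet> X t + window_functional \<tau> G t" for t
      define W' where "W' t = 2 * (P (X t) \<bullet> (Y (X t) + B (U t) + \<Delta> t)) + (\<tau> * G t - integral {t - \<tau>..t} G)" for t
      have derW: "(W has_real_derivative W' t) (at t within {\<tau>..})" if t: "t \<ge> \<tau>" for t
      proof -
        have d: "(X has_vector_derivative Y (X t) + B (U t) + \<Delta> t) (at t within {\<tau>..})" using der t by blast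
        have "((\<lambda>t. P (X t)) has_vector_derivative P (Y (X t) + B (U t) + \<Delta> t)) (at t within {\<tau>..})"
          using bounded_linear.has_vector_derivative[OF _ d, of P] P(1) by (simp add: linear_conv_bounded_linear)
        note e = has_real_derivative_inner[OF this d]
        have "P z \<bullet> x + P x \<bullet> z = 2 * (P x \<bullet> z)" for x z
          using P(2)[rule_format, of z x] by (simp add: inner_commute)
        with e have "((\<lambda>t. P (X t) \<bullet> X t) has_real_derivative 2 * (P (X t) \<bullet> (Y (X t) + B (U t) + \<Delta> t))) (at t within {\<tau>..})"
          by (simp only:)
        from DERIV_add[OF this window_functional_deriv[OF cG Gnn \<tau> t]]
        show ?thesis unfolding W_def W'_def by simp
      qed
      have W'_le: "W' t \<le> - \<alpha> * W t" if t: "t \<ge> \<tau>" for t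
      proof -
        let ?x = "norm (X t)" and ?n = "n (X t)" and ?u = "norm (U t)" and ?r = "norm (r t)"
        define I where "I = integral {t - \<tau>..t} G"
        have sub: "continuous_on {t - \<tau>..t} f" if "continuous_on {0..} f" for f :: "real \<Rightarrow> real"
          using that by (rule continuous_on_subset) (use t in auto)
        have cont: "continuous_on {t - \<tau>..t} (\<lambda>s. norm (U s) + \<eta> * norm (X s))"
          by (intro sub continuous_intros cX cU)
        have I0: "I \<ge> 0" unfolding I_def
          by (intro integral_nonneg integrable_continuous_interval sub cG Gnn)
        have "?r\<^sup>2 \<le> (\<phi> * integral {t - \<tau>..t} (\<lambda>s. norm (U s) + \<eta> * norm (X s)))\<^sup>2"
          using r t by (intro power_mono) auto
        also have "\<dots> \<le> \<phi>\<^sup>2 * (\<tau> * integral {t - \<tau>..t} (\<lambda>s. (norm (U s) + \<eta> * norm (X s))\<^sup>2))"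
          using integral_square_le[OF _ cont] \<tau> by (auto simp: power_mult_distrib intro!: mult_left_mono)
        also have "\<dots> \<le> \<phi>\<^sup>2 * (\<tau> * (2 / \<delta> * I))"
        proof (intro mult_left_mono)
          have "integral {t - \<tau>..t} (\<lambda>s. (norm (U s) + \<eta> * norm (X s))\<^sup>2) \<le> integral {t - \<tau>..t} (\<lambda>s. 2 / \<delta> * G s)"
          proof (intro integral_le integrable_continuous_interval sub continuous_intros cX cU cG)
            fix s
            have "(norm (U s) + \<eta> * norm (X s))\<^sup>2 \<le> 2 * (norm (U s))\<^sup>2 + 2 * (\<eta> * norm (X s))\<^sup>2"
              using sum_squares_bound[of "norm (U s)" "\<eta> * norm (X s)"] by (simp add: power2_sum)
            also have "(\<eta> * norm (X s))\<^sup>2 \<le> \<theta> / \<delta> * (norm (X s))\<^sup>2"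
            proof -
              have "\<eta> * \<eta> \<le> \<eta> * 1" using \<eta> by (intro mult_left_mono) auto
              also have "\<dots> \<le> \<theta> / \<delta>" using \<eta>(5) \<delta>(1) by (simp add: field_simps)
              finally have "\<eta> * \<eta> * (norm (X s))\<^sup>2 \<le> \<theta> / \<delta> * (norm (X s))\<^sup>2"
                by (rule mult_right_mono) simp
              then show ?thesis by (simp only: power_mult_distrib power2_eq_square[of \<eta>])
            qed
            finally show "(norm (U s) + \<eta> * norm (X s))\<^sup>2 \<le> 2 / \<delta> * G s"
              using \<delta>(1) by (simp add: G_def field_simps)
          qed
          then show "integral {t - \<tau>..t} (\<lambda>s. (norm (U s) + \<eta> * norm (X s))\<^sup>2) \<le> 2 / \<delta> * I"
            by (simp add: I_def)
        qed (use \<tau> in auto)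
        finally have rI: "?r\<^sup>2 \<le> \<phi>\<^sup>2 * (2 * \<tau>) / \<delta> * I" by (simp add: mult_ac)
        have rr: "c3 * \<kappa>0\<^sup>2 * ?r\<^sup>2 \<le> I / 2"
        proof -
          have "c3 * \<kappa>0\<^sup>2 * ?r\<^sup>2 \<le> c3 * \<kappa>0\<^sup>2 * (\<phi>\<^sup>2 * (2 * \<tau>) / \<delta> * I)"
            using rI c3 by (intro mult_left_mono) auto
          also have "\<dots> = (c3 * \<kappa>0\<^sup>2 * (\<phi>\<^sup>2 * (2 * \<tau>))) * (I / \<delta>)" by simp
          also have "\<dots> \<le> \<delta> / 2 * (I / \<delta>)" using \<kappa>0_sq I0 \<delta>(1) by (intro mult_right_mono) auto
          finally show ?thesis using \<delta>(1) by simp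
        qed
        have Kr: "norm (K (r t)) \<le> \<kappa>0 * ?r" using K(2) by blast
        have Kr2: "(norm (K (r t)))\<^sup>2 \<le> \<kappa>0\<^sup>2 * ?r\<^sup>2"
          using power_mono[OF Kr, of 2] by (simp add: power_mult_distrib)
        have Ut: "U t = K (X t) - K (r t)" using U t by (simp add: linear_diff[OF K(1)])
        have nn: "?n \<ge> 0" using n(1) by blast
        have u2: "?u\<^sup>2 \<le> 2 * c1\<^sup>2 * ?n\<^sup>2 + 2 * (norm (K (r t)))\<^sup>2"
        proof -
          have "?u \<le> norm (K (X t)) + norm (K (r t))" unfolding Ut by (rule norm_triangle_ineq4)
          then have "?u \<le> c1 * ?n + norm (K (r t))" using n(2)[rule_format, of "X t"] by linarith
          from power_mono[OF this, of 2] have "?u\<^sup>2 \<le> (c1 * ?n + norm (K (r t)))\<^sup>2" by simp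
          also have "\<dots> \<le> 2 * (c1 * ?n)\<^sup>2 + 2 * (norm (K (r t)))\<^sup>2"
            using sum_squares_bound[of "c1 * ?n" "norm (K (r t))"] by (simp add: power2_sum)
          finally show ?thesis by (simp add: power_mult_distrib)
        qed
        have cross: "2 * (P (X t) \<bullet> B (- K (r t))) \<le> ?n\<^sup>2 / 2 + 2 * c1\<^sup>2 * (norm (K (r t)))\<^sup>2"
        proof -
          have "P (X t) \<bullet> B (- K (r t)) \<le> c1 * ?n * norm (K (r t))" using PB[rule_format, of "X t" "- K (r t)"] by simp
          moreover have "2 * (c1 * ?n * norm (K (r t))) \<le> ?n\<^sup>2 / 2 + 2 * c1\<^sup>2 * (norm (K (r t)))\<^sup>2"
            using zero_le_power2[of "?n - 2 * c1 * norm (K (r t))"] by (simp add: power2_diff power_mult_distrib algebra_simps)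
          ultimately show ?thesis by linarith
        qed
        have pert: "2 * (P (X t) \<bullet> \<Delta> t) \<le> \<epsilon> / 4 * ?x\<^sup>2 + \<delta> * ?u\<^sup>2"
        proof -
          have "P (X t) \<bullet> \<Delta> t \<le> norm (P (X t)) * norm (\<Delta> t)" by (rule norm_cauchy_schwarz)
          also have "\<dots> \<le> (p * ?x) * (\<eta> * (?x + ?u))"
            using p \<Delta> t by (intro mult_mono) auto
          finally have "2 * (P (X t) \<bullet> \<Delta> t) \<le> (\<eta> * p) * (2 * ?x\<^sup>2 + 2 * ?x * ?u)"
            by (simp add: algebra_simps power2_eq_square)
          also have "\<dots> \<le> (\<eta> * p) * (3 * ?x\<^sup>2 + ?u\<^sup>2)"
            using sum_squares_bound[of ?x ?u] \<eta>(1) p(1) by (intro mult_left_mono) auto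
          also have "\<dots> = (3 * p * \<eta>) * ?x\<^sup>2 + (\<eta> * p) * ?u\<^sup>2" by (simp add: algebra_simps)
          also have "\<dots> \<le> \<epsilon> / 4 * ?x\<^sup>2 + \<delta> * ?u\<^sup>2"
            using \<eta>(2,3) by (intro add_mono mult_right_mono) auto
          finally show ?thesis .
        qed
        have "Y (X t) + B (U t) + \<Delta> t = (Y (X t) + B (K (X t))) + B (- K (r t)) + \<Delta> t"
          unfolding Ut by (simp add: linear_diff[OF B] linear_neg[OF B])
        then have "W' t = 2 * (P (X t) \<bullet> (Y (X t) + B (K (X t)))) + 2 * (P (X t) \<bullet> B (- K (r t)))
           + 2 * (P (X t) \<bullet> \<Delta> t) + \<tau> * G t - I"
          unfolding W'_def I_def by (simp add: inner_add_right)
        also have "\<dots> \<le> (- \<epsilon> * ?x\<^sup>2 - ?n\<^sup>2) + (?n\<^sup>2 / 2 + 2 * c1\<^sup>2 * (norm (K (r t)))\<^sup>2)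
           + (\<epsilon> / 4 * ?x\<^sup>2 + \<delta> * ?u\<^sup>2) + (\<tau> * \<delta> * ?u\<^sup>2 + \<epsilon> / 4 * ?x\<^sup>2) - I"
        proof -
          have "\<tau> * G t \<le> \<tau> * \<delta> * ?u\<^sup>2 + \<epsilon> / 4 * ?x\<^sup>2"
            using mult_right_mono[OF \<theta>(2), of "?x\<^sup>2"] by (simp add: G_def algebra_simps)
          with ineq[rule_format, of "X t"] cross pert show ?thesis by linarith
        qed
        also have "\<dots> = - (\<epsilon> / 2) * ?x\<^sup>2 - ?n\<^sup>2 / 2 + 2 * c1\<^sup>2 * (norm (K (r t)))\<^sup>2 + \<delta> * (1 + \<tau>) * ?u\<^sup>2 - I"
          by (simp add: algebra_simps)
        also have "\<dots> \<le> - (\<epsilon> / 2) * ?x\<^sup>2 - ?n\<^sup>2 / 2 + 2 * c1\<^sup>2 * (norm (K (r t)))\<^sup>2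
            + \<delta> * (1 + \<tau>) * (2 * c1\<^sup>2 * ?n\<^sup>2 + 2 * (norm (K (r t)))\<^sup>2) - I"
          using u2 \<delta>(1) \<tau> by (intro diff_right_mono add_left_mono mult_left_mono) auto
        also have "\<dots> = - (\<epsilon> / 2) * ?x\<^sup>2 - (1/2 - 1/8) * ?n\<^sup>2 + c3 * (norm (K (r t)))\<^sup>2 - I"
        proof -
          have a: "\<delta> * (1 + \<tau>) * (2 * c1\<^sup>2 * z) = 1/8 * z" for z
            using arg_cong[OF \<delta>(2), of "\<lambda>y. y * z"] by (simp add: mult_ac)
          have b: "\<delta> * (1 + \<tau>) * 2 = 1 / (8 * c1\<^sup>2)" using c1 \<open>1 + \<tau> \<noteq> 0\<close> by (simp add: \<delta>_def)
          have c: "\<delta> * (1 + \<tau>) * (2 * z) = 1 / (8 * c1\<^sup>2) * z" for z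
            unfolding b[symmetric] by (simp add: mult_ac)
          have "\<delta> * (1 + \<tau>) * (2 * c1\<^sup>2 * ?n\<^sup>2 + 2 * (norm (K (r t)))\<^sup>2) =
              1/8 * ?n\<^sup>2 + 1 / (8 * c1\<^sup>2) * (norm (K (r t)))\<^sup>2"
            unfolding distrib_left[of "\<delta> * (1 + \<tau>)" "2 * c1\<^sup>2 * ?n\<^sup>2"] a c ..
          then show ?thesis unfolding c3_def by (simp only:) (simp add: algebra_simps)
        qed
        also have "\<dots> \<le> - (\<epsilon> / 2) * ?x\<^sup>2 - I / 2"
        proof -
          have "c3 * (norm (K (r t)))\<^sup>2 \<le> I / 2"
            using order_trans[OF mult_left_mono[OF Kr2, of c3] rr[unfolded mult.assoc]] c3 by simp
          moreover have "(1/2 - 1/8) * ?n\<^sup>2 \<ge> 0" by simp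
          ultimately show ?thesis by linarith
        qed
        also have "\<dots> \<le> - \<alpha> * W t"
        proof -
          have "P (X t) \<bullet> X t \<le> p * ?x\<^sup>2"
            using norm_cauchy_schwarz[of "P (X t)" "X t"] mult_right_mono[OF p(2)[rule_format, of "X t"], of ?x]
            by (simp add: power2_eq_square mult.assoc)
          moreover have "window_functional \<tau> G t \<le> \<tau> * I"
            unfolding I_def by (rule window_functional_le[OF cG Gnn \<tau> t])
          ultimately have "\<alpha> * W t \<le> \<alpha> * (p * ?x\<^sup>2 + \<tau> * I)"
            unfolding W_def using \<alpha>(1) by (intro mult_left_mono) auto
          also have "\<dots> = (\<alpha> * p) * ?x\<^sup>2 + (\<alpha> * \<tau>) * I" by (simp add: algebra_simps)
          also have "\<dots> \<le> \<epsilon> / 2 * ?x\<^sup>2 + 1 / 2 * I"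
            using \<alpha> I0 by (intro add_mono mult_right_mono) auto
          finally show ?thesis by simp
        qed
        finally show ?thesis .
      qed
      have "W t1 \<le> W \<tau> * exp (- \<alpha> * (t1 - \<tau>))"
        by (rule gronwall[OF t1 derW W'_le])
      moreover have Mnn: "M \<ge> 0" using M \<tau> norm_ge_zero[of "X 0"] by (meson atLeastAtMost_iff order_refl order_trans)
      have "W \<tau> \<le> w0 * M\<^sup>2"
      proof -
        have M2: "(norm (X s))\<^sup>2 \<le> M\<^sup>2" "(norm (U s))\<^sup>2 \<le> M\<^sup>2" if "s \<in> {0..\<tau>}" for s
          using M that by (auto intro!: power_mono)
        have "P (X \<tau>) \<bullet> X \<tau> \<le> p * (norm (X \<tau>))\<^sup>2"
          using norm_cauchy_schwarz[of "P (X \<tau>)" "X \<tau>"] mult_right_mono[OF p(2)[rule_format, of "X \<tau>"], of "norm (X \<tau>)"]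
          by (simp add: power2_eq_square mult.assoc)
        also have "\<dots> \<le> p * M\<^sup>2" using M2(1)[of \<tau>] \<tau> p(1) by simp
        finally have 1: "P (X \<tau>) \<bullet> X \<tau> \<le> p * M\<^sup>2" .
        have "integral {0..\<tau>} G \<le> integral {0..\<tau>} (\<lambda>s. (\<delta> + \<theta>) * M\<^sup>2)"
        proof (intro integral_le integrable_continuous_interval continuous_on_const)
          show "continuous_on {0..\<tau>} G" using cG by (rule continuous_on_subset) auto
          fix s assume s: "s \<in> {0..\<tau>}"
          then show "G s \<le> (\<delta> + \<theta>) * M\<^sup>2"
            unfolding G_def distrib_right using M2[OF s] \<delta>(1) \<theta>(1) by (intro add_mono mult_left_mono) auto
        qed
        then have "integral {0..\<tau>} G \<le> \<tau> * ((\<delta> + \<theta>) * M\<^sup>2)" using \<tau> by (simp add: mult_ac)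
        then have "window_functional \<tau> G \<tau> \<le> \<tau> * (\<tau> * ((\<delta> + \<theta>) * M\<^sup>2))"
          using window_functional_le[OF cG Gnn \<tau> order_refl] mult_left_mono[of "integral {0..\<tau>} G" _ \<tau>] \<tau> by fastforce
        with 1 show ?thesis unfolding W_def w0_def by (simp add: algebra_simps)
      qed
      ultimately have "W t1 \<le> w0 * M\<^sup>2 * exp (- \<alpha> * (t1 - \<tau>))"
        by (meson exp_ge_zero mult_right_mono order_trans)
      moreover have "l * (norm (X t1))\<^sup>2 \<le> W t1"
        using l(2)[rule_format, of "X t1"] window_functional_nonneg[OF cG Gnn \<tau> t1] unfolding W_def by linarith
      moreover have "exp (- \<alpha> * (t1 - \<tau>)) = exp (\<alpha> * \<tau>) * exp (- \<alpha> * t1)"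
        by (simp add: algebra_simps flip: exp_add)
      ultimately have "l * (norm (X t1))\<^sup>2 \<le> w0 * M\<^sup>2 * (exp (\<alpha> * \<tau>) * exp (- \<alpha> * t1))"
        by (simp only:)
      then have "(norm (X t1))\<^sup>2 \<le> w0 / l * exp (\<alpha> * \<tau>) * M\<^sup>2 * exp (- \<alpha> * t1)"
        using l(1) by (simp add: field_simps)
      also have "\<dots> = (\<kappa> * M * exp (- (\<alpha> / 2) * t1))\<^sup>2"
      proof -
        have "\<kappa>\<^sup>2 = w0 / l * exp (\<alpha> * \<tau>)" unfolding \<kappa>_def using w0 l(1) by simp
        moreover have "(exp (- (\<alpha> / 2) * t1))\<^sup>2 = exp (- \<alpha> * t1)" by (simp add: exp_double[symmetric])
        ultimately show ?thesis by (simp add: power_mult_distrib)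
      qed
      finally show "norm (X t1) \<le> \<kappa> * M * exp (- (\<alpha> / 2) * t1)"
        by (rule power2_le_imp_le) (use \<kappa> Mnn in simp)
    qed
  qed
qed

section \<open>The grounded Laplacian of a rooted digraph\<close>

text \<open>
  A breadth-first tree: every node other than the root chooses a parent whose distance from the root is smaller.
\<close>

lemma spanning_tree_iff_reachable:
  assumes root: "\<And>j. (j, r) \<notin> Ed"
  shows "contains_directed_spanning_tree Ed r \<longleftrightarrow> (\<forall>i. (r, i) \<in> Ed\<^sup>*)"
proof
  assume "contains_directed_spanning_tree Ed r"
  then show "\<forall>i. (r, i) \<in> Ed\<^sup>*"
    unfolding contains_directed_spanning_tree_def directed_tree_def using rtrancl_mono by blast
next
  assume reach: "\<forall>i. (r, i) \<in> Ed\<^sup>*"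
  define d where "d i = (LEAST n. (r, i) \<in> Ed ^^ n)" for i
  have d: "(r, i) \<in> Ed ^^ d i" for i
    unfolding d_def using reach by (metis LeastI_ex rtrancl_imp_relpow)
  have "\<exists>j. (j, i) \<in> Ed \<and> d j < d i" if "i \<noteq> r" for i
  proof (cases "d i")
    case 0
    then show ?thesis using d[of i] that by simp
  next
    case (Suc n)
    then obtain j where j: "(r, j) \<in> Ed ^^ n" "(j, i) \<in> Ed" using d[of i] by auto
    have "d j \<le> n" unfolding d_def by (rule Least_le[of "\<lambda>n. (r, j) \<in> Ed ^^ n", OF j(1)])
    then show ?thesis using j(2) Suc by auto
  qed
  then obtain par where par: "\<And>i. i \<noteq> r \<Longrightarrow> (par i, i) \<in> Ed \<and> d (par i) < d i" by metis
  define T where "T = {(par i, i) | i. i \<noteq> r}"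
  have "(r, i) \<in> T\<^sup>*" for i
  proof (induction "d i" arbitrary: i rule: less_induct)
    case less
    show ?case
    proof (cases "i = r")
      case False
      then have "(r, par i) \<in> T\<^sup>*" using less par by blast
      moreover have "(par i, i) \<in> T" using False by (auto simp: T_def)
      ultimately show ?thesis by (rule rtrancl_into_rtrancl)
    qed simp
  qed
  then have "directed_tree T r" unfolding directed_tree_def by (auto simp: T_def)
  moreover have "T \<subseteq> Ed" using par by (auto simp: T_def)
  ultimately show "contains_directed_spanning_tree Ed r"
    unfolding contains_directed_spanning_tree_def by blast
qed

lemma sum_UNIV_option: "(\<Sum>j\<in>UNIV. f j) = f None + (\<Sum>k\<in>UNIV. f (Some k))"
  for f :: "'n::finite option \<Rightarrow> 'b::comm_monoid_add"
  by (simp add: UNIV_option_conv sum.reindex)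

text \<open>
  The graph Laplacian without the row and the column of the leader, whose weights remain in the diagonal.
\<close>

definition grounded_laplacian :: "('N::finite option \<Rightarrow> 'N option \<Rightarrow> real) \<Rightarrow> real^'N^'N" where
  "grounded_laplacian a = (\<chi> i k. (if i = k then \<Sum>j\<in>UNIV. a (Some i) j else 0) - a (Some i) (Some k))"

lemma weighted_adjacency_nonneg: "weighted_adjacency Ed a \<Longrightarrow> a i j \<ge> 0"
  unfolding weighted_adjacency_def by (metis less_imp_le order_refl)

lemma relative_sum_all:
  fixes \<xi> :: "'N::finite \<Rightarrow> 'b::real_vector"
  assumes "weighted_adjacency Ed a"
  shows "relative_sum Ed a \<xi> i = (\<Sum>j\<in>UNIV. a i j *\<^sub>R (\<xi> i - \<xi> j))"
  unfolding relative_sum_def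
  by (rule sum.mono_neutral_left) (use assms in \<open>auto simp: neighbors_def weighted_adjacency_def split: if_splits\<close>)

lemma relative_sum_laplacian:
  fixes \<xi> :: "'N::finite option \<Rightarrow> 'b::real_vector"
  assumes "weighted_adjacency Ed a"
  shows "relative_sum Ed a \<xi> (Some i) =
     (\<Sum>k\<in>UNIV. grounded_laplacian a $ i $ k *\<^sub>R \<xi> (Some k)) - a (Some i) None *\<^sub>R \<xi> None"
proof -
  have "(\<Sum>k\<in>UNIV. grounded_laplacian a $ i $ k *\<^sub>R \<xi> (Some k)) =
     (\<Sum>k\<in>UNIV. (if i = k then (\<Sum>j\<in>UNIV. a (Some i) j) *\<^sub>R \<xi> (Some i) else 0) - a (Some i) (Some k) *\<^sub>R \<xi> (Some k))"
    by (rule sum.cong) (auto simp: grounded_laplacian_def scaleR_diff_left)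
  also have "\<dots> = (\<Sum>j\<in>UNIV. a (Some i) j) *\<^sub>R \<xi> (Some i) - (\<Sum>k\<in>UNIV. a (Some i) (Some k) *\<^sub>R \<xi> (Some k))"
    by (simp add: sum_subtractf)
  finally show ?thesis
    unfolding relative_sum_all[OF assms]
    by (simp add: scaleR_diff_right sum_subtractf sum_UNIV_option scaleR_sum_left algebra_simps)
qed

lemma grounded_laplacian_offdiag:
  "weighted_adjacency Ed a \<Longrightarrow> i \<noteq> k \<Longrightarrow> grounded_laplacian a $ i $ k \<le> 0"
  by (simp add: grounded_laplacian_def weighted_adjacency_nonneg)

lemma grounded_laplacian_vec:
  assumes "weighted_adjacency Ed a"
  shows "(grounded_laplacian a *v x) $ i = (\<Sum>k\<in>UNIV. a (Some i) (Some k) * (x $ i - x $ k)) + a (Some i) None * x $ i"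
proof -
  let ?\<xi> = "\<lambda>j. case j of None \<Rightarrow> 0 | Some k \<Rightarrow> x $ k"
  have "(grounded_laplacian a *v x) $ i = relative_sum Ed a ?\<xi> (Some i)"
    unfolding relative_sum_laplacian[OF assms] by (simp add: matrix_vector_mult_def)
  then show ?thesis unfolding relative_sum_all[OF assms] by (simp add: sum_UNIV_option)
qed

text \<open>
  A negative minimum of \<open>x\<close> would spread from a follower to all its neighbours and exclude the leader as
  a neighbour; following a path from the leader backwards gives a contradiction.
\<close>

lemma grounded_laplacian_minimum_principle:
  assumes wa: "weighted_adjacency Ed a" and reach: "\<And>i. (None, Some i) \<in> Ed\<^sup>*"
    and pos: "\<And>i. (grounded_laplacian a *v x) $ i \<ge> 0"
  shows "x $ i \<ge> 0"
proof (rule ccontr)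
  assume neg: "\<not> x $ i \<ge> 0"
  define m where "m = Min (range (($) x))"
  have m: "m \<le> x $ k" for k unfolding m_def by simp
  have "m \<in> range (($) x)" unfolding m_def by (rule Min_in) auto
  then obtain i0 where i0: "x $ i0 = m" by auto
  have m0: "m < 0" using neg m[of i] by simp
  have nbr: "a (Some l) None = 0 \<and> (\<forall>k. a (Some l) (Some k) > 0 \<longrightarrow> x $ k = m)" if "x $ l = m" for l
  proof -
    let ?S = "\<Sum>k\<in>UNIV. a (Some l) (Some k) * (x $ l - x $ k)"
    have le: "a (Some l) (Some k) * (x $ l - x $ k) \<le> 0" for k
      using m[of k] that weighted_adjacency_nonneg[OF wa] by (simp add: mult_nonneg_nonpos)
    have S: "?S \<le> 0" by (rule sum_nonpos) (use le in auto)
    have t: "a (Some l) None * x $ l \<le> 0"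
      using m0 that weighted_adjacency_nonneg[OF wa] by (simp add: mult_nonneg_nonpos)
    have sum: "?S + a (Some l) None * x $ l \<ge> 0" using pos[of l] unfolding grounded_laplacian_vec[OF wa] .
    have "a (Some l) None * x $ l = 0" using S t sum by linarith
    then have "a (Some l) None = 0" using m0 that by simp
    moreover have S0: "?S = 0" using S t sum by linarith
    have "x $ k = m" if "a (Some l) (Some k) > 0" for k
    proof -
      have "(\<Sum>k\<in>UNIV. - (a (Some l) (Some k) * (x $ l - x $ k))) = 0" using S0 by (simp add: sum_negf)
      then have "- (a (Some l) (Some k) * (x $ l - x $ k)) = 0"
        using le by (subst (asm) sum_nonneg_eq_0_iff) auto
      then show ?thesis using that \<open>x $ l = m\<close> by simp
    qed
    ultimately show ?thesis by blast
  qed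
  have "\<forall>l. v = Some l \<longrightarrow> x $ l \<noteq> m" if "(None, v) \<in> Ed\<^sup>*" for v
    using that
  proof (induction rule: rtrancl_induct)
    case (step y z)
    show ?case
    proof (intro allI impI notI)
      fix l assume l: "z = Some l" "x $ l = m"
      have "a z y > 0" using wa step(2) unfolding weighted_adjacency_def by metis
      then show False using nbr[OF l(2)] step(3) l(1) by (cases y) auto
    qed
  qed simp
  then show False using reach[of i0] i0 by blast
qed

lemma grounded_laplacian_invertible:
  assumes wa: "weighted_adjacency Ed a" and reach: "\<And>i. (None, Some i) \<in> Ed\<^sup>*"
  shows "invertible (grounded_laplacian a)"
proof -
  have "x = 0" if "grounded_laplacian a *v x = 0" for x
  proof -
    have "x $ i \<ge> 0" for i
      by (rule grounded_laplacian_minimum_principle[OF wa reach]) (simp add: that)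
    moreover have "(- x) $ i \<ge> 0" for i
      by (rule grounded_laplacian_minimum_principle[OF wa reach])
         (simp add: that linear_neg[OF matrix_vector_mul_linear])
    ultimately show ?thesis by (simp add: vec_eq_iff order_antisym)
  qed
  then show ?thesis
    by (metis invertible_left_inverse matrix_left_invertible_ker)
qed

text \<open>
  The diagonal stability of M-matrices. The minimum principle says that \<open>H\<^sup>-\<^sup>1\<close> is entrywise nonnegative, so \<open>v = H\<^sup>-\<^sup>1 1\<close> and
  \<open>w = H\<^sup>-\<^sup>T 1\<close> are positive vectors. For \<open>d\<^sub>i = w\<^sub>i / v\<^sub>i\<close> and \<open>y\<^sub>i = v\<^sub>i g\<^sub>i\<close> the quadratic form has the coefficients \<open>w\<^sub>i H\<^sub>i\<^sub>j v\<^sub>j\<close>, whose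
  row and column sums are \<open>w\<^sub>i\<close> and \<open>v\<^sub>j\<close>. As its off-diagonal entries are nonpositive, replacing \<open>g\<^sub>i g\<^sub>j\<close> by
  the larger mean of squares gives a lower bound.
\<close>

lemma grounded_laplacian_lyapunov:
  assumes wa: "weighted_adjacency Ed a" and reach: "\<And>i. (None, Some i) \<in> Ed\<^sup>*"
  shows "\<exists>d c. (\<forall>i::'N::finite. d i > 0) \<and> c > 0 \<and>
    (\<forall>y :: 'N \<Rightarrow> real. c * (\<Sum>i\<in>UNIV. (y i)\<^sup>2) \<le> (\<Sum>i\<in>UNIV. \<Sum>j\<in>UNIV. d i * grounded_laplacian a $ i $ j * y i * y j))"
proof -
  let ?H = "grounded_laplacian a"
  obtain G where HG: "?H ** G = mat 1" "G ** ?H = mat 1"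
    using grounded_laplacian_invertible[OF wa reach] unfolding invertible_def by blast
  have mono: "x $ i \<ge> 0" if "\<And>i. (?H *v x) $ i \<ge> 0" for x i
    by (rule grounded_laplacian_minimum_principle[OF wa reach that])
  have Gnn: "G $ i $ j \<ge> 0" for i j
  proof -
    have "column j G = G *v axis j 1" by (simp add: matrix_vector_mult_basis)
    then have "?H *v column j G = ?H *v (G *v axis j 1)" by (simp only:)
    also have "\<dots> = axis j 1" unfolding matrix_vector_mul_assoc HG by (rule matrix_vector_mul_lid)
    finally have "?H *v column j G = axis j 1" .
    have "column j G $ i \<ge> 0" by (rule mono) (simp add: axis_def \<open>?H *v column j G = axis j 1\<close>)
    then show ?thesis by (simp add: column_def)
  qed
  define v where "v = G *v (\<chi> i. 1)"
  define w where "w = transpose G *v (\<chi> i. 1)"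
  have vnn: "v $ i \<ge> 0" for i unfolding v_def
    by (simp add: matrix_vector_mult_def sum_nonneg Gnn)
  have wnn: "w $ i \<ge> 0" for i unfolding w_def
    by (simp add: matrix_vector_mult_def transpose_def sum_nonneg Gnn)
  have Hv: "(\<Sum>j\<in>UNIV. ?H $ i $ j * v $ j) = 1" for i
  proof -
    have "?H *v v = (\<chi> i. 1)" unfolding v_def by (simp add: matrix_vector_mul_assoc HG)
    then have "(?H *v v) $ i = 1" by simp
    then show ?thesis by (simp add: matrix_vector_mult_def)
  qed
  have Hw: "(\<Sum>i\<in>UNIV. ?H $ i $ j * w $ i) = 1" for j
  proof -
    have "transpose ?H *v w = transpose (G ** ?H) *v (\<chi> i. 1)" unfolding w_def
      by (simp only: matrix_vector_mul_assoc matrix_transpose_mul)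
    then have "transpose ?H *v w = (\<chi> i. 1)" by (simp only: HG transpose_mat matrix_vector_mul_lid)
    then have "(transpose ?H *v w) $ j = 1" by simp
    then show ?thesis by (simp add: matrix_vector_mult_def transpose_def)
  qed
  have off: "?H $ i $ j \<le> 0" if "i \<noteq> j" for i j
    by (rule grounded_laplacian_offdiag[OF wa that])
  have vpos: "v $ i > 0" for i
  proof (rule ccontr)
    assume "\<not> v $ i > 0"
    then have "v $ i = 0" using vnn[of i] by simp
    then have "(\<Sum>j\<in>UNIV. ?H $ i $ j * v $ j) \<le> 0"
      by (intro sum_nonpos) (metis mult_nonpos_nonneg mult_zero_right off order_refl vnn)
    then show False using Hv[of i] by simp
  qed
  have wpos: "w $ j > 0" for j
  proof (rule ccontr)
    assume "\<not> w $ j > 0"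
    then have "w $ j = 0" using wnn[of j] by simp
    then have "(\<Sum>i\<in>UNIV. ?H $ i $ j * w $ i) \<le> 0"
      by (intro sum_nonpos) (metis mult_nonpos_nonneg mult_zero_right off order_refl wnn)
    then show False using Hw[of j] by simp
  qed
  define c where "c = Min (range (\<lambda>i. (w $ i + v $ i) / 2 / (v $ i)\<^sup>2))"
  have "c \<in> range (\<lambda>i. (w $ i + v $ i) / 2 / (v $ i)\<^sup>2)" unfolding c_def by (rule Min_in) auto
  then obtain i where "c = (w $ i + v $ i) / 2 / (v $ i)\<^sup>2" by blast
  then have c: "c > 0" using vpos[of i] wpos[of i] by simp
  have cle: "c \<le> (w $ i + v $ i) / 2 / (v $ i)\<^sup>2" for i unfolding c_def by (rule Min_le) auto
  have "c * (\<Sum>i\<in>UNIV. (y i)\<^sup>2) \<le> (\<Sum>i\<in>UNIV. \<Sum>j\<in>UNIV. w $ i / v $ i * ?H $ i $ j * y i * y j)" for y :: "'N \<Rightarrow> real"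
  proof -
    define g where "g i = y i / v $ i" for i
    have y: "y i = v $ i * g i" for i using vpos[of i] by (simp add: g_def)
    have "c * (\<Sum>i\<in>UNIV. (y i)\<^sup>2) \<le> (\<Sum>i\<in>UNIV. (w $ i + v $ i) / 2 * (g i)\<^sup>2)"
      unfolding sum_distrib_left
    proof (rule sum_mono)
      fix i
      show "c * (y i)\<^sup>2 \<le> (w $ i + v $ i) / 2 * (g i)\<^sup>2"
        using mult_right_mono[OF cle[of i], of "(y i)\<^sup>2"] by (simp add: g_def power_divide)
    qed
    also have "\<dots> = (\<Sum>i\<in>UNIV. w $ i * (g i)\<^sup>2 * (\<Sum>j\<in>UNIV. ?H $ i $ j * v $ j)) / 2
        + (\<Sum>j\<in>UNIV. v $ j * (g j)\<^sup>2 * (\<Sum>i\<in>UNIV. ?H $ i $ j * w $ i)) / 2"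
      unfolding Hv Hw by (simp add: sum_divide_distrib sum.distrib algebra_simps add_divide_distrib)
    also have "(\<Sum>j\<in>UNIV. v $ j * (g j)\<^sup>2 * (\<Sum>i\<in>UNIV. ?H $ i $ j * w $ i)) =
        (\<Sum>i\<in>UNIV. \<Sum>j\<in>UNIV. v $ j * (g j)\<^sup>2 * (?H $ i $ j * w $ i))"
      unfolding sum_distrib_left by (rule sum.swap)
    also have "(\<Sum>i\<in>UNIV. w $ i * (g i)\<^sup>2 * (\<Sum>j\<in>UNIV. ?H $ i $ j * v $ j)) / 2
        + (\<Sum>i\<in>UNIV. \<Sum>j\<in>UNIV. v $ j * (g j)\<^sup>2 * (?H $ i $ j * w $ i)) / 2 =
        (\<Sum>i\<in>UNIV. \<Sum>j\<in>UNIV. w $ i * v $ j * (?H $ i $ j * (((g i)\<^sup>2 + (g j)\<^sup>2) / 2)))"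
      unfolding sum_distrib_left sum_divide_distrib sum.distrib[symmetric]
      by (intro sum.cong refl) (simp add: field_simps)
    also have "\<dots> \<le> (\<Sum>i\<in>UNIV. \<Sum>j\<in>UNIV. w $ i * v $ j * (?H $ i $ j * (g i * g j)))"
    proof (intro sum_mono, rule mult_left_mono)
      fix i j
      show "0 \<le> w $ i * v $ j" by (intro mult_nonneg_nonneg vnn wnn)
      show "?H $ i $ j * (((g i)\<^sup>2 + (g j)\<^sup>2) / 2) \<le> ?H $ i $ j * (g i * g j)"
      proof (cases "i = j")
        case False
        have "g i * g j \<le> ((g i)\<^sup>2 + (g j)\<^sup>2) / 2" using sum_squares_bound[of "g i" "g j"] by simp
        then show ?thesis using off[OF False] by (rule mult_left_mono_neg)
      qed (simp add: power2_eq_square)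
    qed
    also have "\<dots> = (\<Sum>i\<in>UNIV. \<Sum>j\<in>UNIV. w $ i / v $ i * ?H $ i $ j * y i * y j)"
      unfolding y using vpos by (intro sum.cong refl) (simp add: field_simps less_imp_neq[symmetric])
    finally show ?thesis .
  qed
  then show ?thesis using c vpos wpos
    by (intro exI[of _ "\<lambda>i. w $ i / v $ i"] exI[of _ c]) simp
qed

section \<open>Characteristic polynomials and eigenvalues of matrices\<close>

abbreviation mv :: "real^'n^'n \<Rightarrow> real^'n \<Rightarrow> real^'n" where "mv M \<equiv> \<lambda>x. M *v x"

lemma matrix_poly_vec:
  fixes M :: "real^'n^'n"
  shows "matrix_poly r M *v x = poly_act r (mv M) x"
proof -
  have "((((**) M) ^^ k) (mat 1)) *v x = (mv M ^^ k) x" for k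
    by (induction k) (simp_all flip: matrix_vector_mul_assoc)
  moreover have "(\<Sum>k\<in>I. F k) *v x = (\<Sum>k\<in>I. F k *v x)" if "finite I" for F :: "nat \<Rightarrow> real^'n^'n" and I
    using that by (induction I rule: finite_induct) (simp_all add: matrix_vector_mult_add_rdistrib)
  ultimately show ?thesis
    unfolding matrix_poly_def poly_act_sum[OF matrix_vector_mul_linear]
    by (simp add: scaleR_matrix_vector_assoc[symmetric])
qed

text \<open>
  The identity \<open>N adj(N) = det N\<close>, with the cofactors written as determinants in which row \<open>r\<close> is a unit vector.
\<close>

lemma adjugate_row_expansion:
  fixes N :: "'a::comm_ring_1^'n^'n"
  shows "(\<Sum>k\<in>UNIV. N $ j $ k * det (\<chi> i. if i = r then axis k 1 else N $ i)) = (if j = r then det N else 0)"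
proof -
  have "(\<Sum>k\<in>UNIV. N $ j $ k * det (\<chi> i. if i = r then axis k 1 else N $ i)) =
        (\<Sum>k\<in>UNIV. det (\<chi> i. if i = r then N $ j $ k *s axis k 1 else N $ i))"
    by (simp only: det_row_mul)
  also have "\<dots> = det (\<chi> i. if i = r then (\<Sum>k\<in>UNIV. N $ j $ k *s axis k 1) else N $ i)"
    by (rule det_linear_row_sum[symmetric]) simp
  also have "(\<Sum>k\<in>UNIV. N $ j $ k *s axis k 1) = N $ j" by (rule basis_expansion)
  also have "det (\<chi> i. if i = r then N $ j else N $ i) = (if j = r then det N else 0)"
  proof (cases "j = r")
    case True
    then have "(\<chi> i. if i = r then N $ j else N $ i) = N" by (simp add: vec_eq_iff)
    then show ?thesis using True by simp
  next
    case False
    then show ?thesis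
      by (simp, intro det_identical_rows[OF False]) (simp add: row_def)
  qed
  finally show ?thesis .
qed

text \<open>
  The adjugate argument over the polynomial ring: for \<open>N = x - \<beta>\<close> the expansion along row \<open>j\<close> writes the
  characteristic polynomial (for \<open>j = r\<close>, and zero otherwise) as \<open>x p\<^sub>j - \<Sum>\<^sub>k \<beta>\<^sub>j\<^sub>k p\<^sub>k\<close>. Evaluated at \<open>\<beta>\<close>, applied to the \<open>j\<close>-th unit
  vector and summed over \<open>j\<close>, both parts become the same double sum.
\<close>

lemma cayley_hamilton: "poly_act (char_polynomial \<beta>) (mv \<beta>) x = 0"
proof -
  let ?A = "\<lambda>p. poly_act p (mv \<beta>)"
  have lin: "linear (mv \<beta>)" by (rule matrix_vector_mul_linear)
  define N where "N = mat [:0, 1:] - map_matrix (\<lambda>c. [:c:]) \<beta>"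
  have axis: "?A (char_polynomial \<beta>) (axis r 1) = 0" for r
  proof -
    define p where "p k = det (\<chi> i. if i = r then axis k 1 else N $ i)" for k
    have N: "N $ j $ k = (if j = k then [:0, 1:] else 0) - [:\<beta> $ j $ k:]" for j k
      by (simp add: N_def mat_def)
    have row: "pCons 0 (p j) - (\<Sum>k\<in>UNIV. smult (\<beta> $ j $ k) (p k)) = (if j = r then char_polynomial \<beta> else 0)" for j
    proof -
      have "(\<Sum>k\<in>UNIV. N $ j $ k * p k) = (\<Sum>k\<in>UNIV. (if j = k then pCons 0 (p k) else 0) - smult (\<beta> $ j $ k) (p k))"
        by (rule sum.cong) (auto simp: N algebra_simps)
      also have "\<dots> = pCons 0 (p j) - (\<Sum>k\<in>UNIV. smult (\<beta> $ j $ k) (p k))"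
        by (simp add: sum_subtractf)
      finally show ?thesis
        using adjugate_row_expansion[of N j r] by (simp add: p_def char_polynomial_def N_def)
    qed
    have A_diff: "?A (f - g) w = ?A f w - ?A g w" for f g w
      using poly_act_add[OF lin, of "f - g" g w] by simp
    have A_sum: "?A (\<Sum>k\<in>I. g k) w = (\<Sum>k\<in>I. ?A (g k) w)" if "finite I" for g w and I :: "'a set"
      using that by (induction I rule: finite_induct) (simp_all add: poly_act_add[OF lin])
    have "?A (char_polynomial \<beta>) (axis r 1) =
        (\<Sum>j\<in>UNIV. ?A (if j = r then char_polynomial \<beta> else 0) (axis j 1))"
    proof -
      have "(\<Sum>j\<in>UNIV. ?A (if j = r then char_polynomial \<beta> else 0) (axis j 1)) =
          (\<Sum>j\<in>UNIV. if j = r then ?A (char_polynomial \<beta>) (axis j 1) else 0)"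
        by (rule sum.cong) auto
      then show ?thesis by simp
    qed
    also have "\<dots> = (\<Sum>j\<in>UNIV. mv \<beta> (?A (p j) (axis j 1))) - (\<Sum>j\<in>UNIV. \<Sum>k\<in>UNIV. \<beta> $ j $ k *\<^sub>R ?A (p k) (axis j 1))"
      unfolding row[symmetric] A_diff
      by (simp add: sum_subtractf A_sum poly_act_smult[OF lin] poly_act_pCons[OF lin])
    also have "(\<Sum>j\<in>UNIV. mv \<beta> (?A (p j) (axis j 1))) = (\<Sum>j\<in>UNIV. \<Sum>i\<in>UNIV. \<beta> $ i $ j *\<^sub>R ?A (p j) (axis i 1))"
    proof (rule sum.cong[OF refl])
      fix j
      have "mv \<beta> (axis j 1) = (\<Sum>i\<in>UNIV. \<beta> $ i $ j *\<^sub>R axis i 1)"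
        using basis_expansion[of "column j \<beta>"] by (simp add: matrix_vector_mult_basis scalar_mult_eq_scaleR column_def)
      then show "mv \<beta> (?A (p j) (axis j 1)) = (\<Sum>i\<in>UNIV. \<beta> $ i $ j *\<^sub>R ?A (p j) (axis i 1))"
        by (simp add: poly_act_commute[OF lin, symmetric] linear_sum[OF linear_poly_act[OF lin]] linear_cmul[OF linear_poly_act[OF lin]])
    qed
    also have "\<dots> = (\<Sum>j\<in>UNIV. \<Sum>k\<in>UNIV. \<beta> $ j $ k *\<^sub>R ?A (p k) (axis j 1))"
      by (rule sum.swap)
    finally show ?thesis by simp
  qed
  have "x = (\<Sum>r\<in>UNIV. x $ r *\<^sub>R axis r 1)" using basis_expansion[of x] by (simp add: scalar_mult_eq_scaleR)
  then have "?A (char_polynomial \<beta>) x = ?A (char_polynomial \<beta>) (\<Sum>r\<in>UNIV. x $ r *\<^sub>R axis r 1)" by simp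
  also have "\<dots> = 0"
    by (simp add: linear_sum[OF linear_poly_act[OF lin]] linear_cmul[OF linear_poly_act[OF lin]] axis)
  finally show ?thesis .
qed

lemma degree_char_polynomial_le: "degree (char_polynomial (\<beta> :: real^'n^'n)) \<le> CARD('n)"
  unfolding char_polynomial_def det_def
proof (rule degree_sum_le)
  fix p assume "p \<in> {p. p permutes (UNIV :: 'n set)}"
  let ?N = "mat [:0, 1:] - map_matrix (\<lambda>c. [:c:]) \<beta> :: real poly^'n^'n"
  have "degree (of_int (sign p) * (\<Prod>i\<in>UNIV. ?N $ i $ p i)) \<le> degree (of_int (sign p) :: real poly) + degree (\<Prod>i\<in>UNIV. ?N $ i $ p i)"
    by (rule degree_mult_le)
  also have "degree (of_int (sign p) :: real poly) = 0" by simp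
  also have "degree (\<Prod>i\<in>UNIV. ?N $ i $ p i) \<le> (\<Sum>i\<in>UNIV. degree (?N $ i $ p i))"
    using degree_prod_sum_le[of UNIV "\<lambda>i. ?N $ i $ p i"] by (simp add: o_def)
  also have "\<dots> \<le> (\<Sum>i\<in>(UNIV::'n set). 1)"
    by (rule sum_mono) (auto simp: mat_def intro!: degree_diff_le)
  finally show "degree (of_int (sign p) * (\<Prod>i\<in>UNIV. ?N $ i $ p i)) \<le> CARD('n)" by simp
qed (simp add: finite_permutations)

lemma map_complex_mult:
  fixes M :: "real^'n^'k"
  shows "(map_matrix complex_of_real M *v x) $ i = Complex ((M *v (\<chi> k. Re (x $ k))) $ i) ((M *v (\<chi> k. Im (x $ k))) $ i)"
  by (simp add: matrix_vector_mult_def complex_eq_iff)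

lemma eigenpair_imp_eigenvalue:
  assumes "eigenpair (mv M) a b u v"
  shows "Complex a b \<in> eigenvalues M"
proof -
  let ?x = "\<chi> i. Complex (u $ i) (v $ i)"
  have "M *v u = a *\<^sub>R u - b *\<^sub>R v" "M *v v = b *\<^sub>R u + a *\<^sub>R v" "u \<noteq> 0 \<or> v \<noteq> 0"
    using assms by (simp_all add: eigenpair_def)
  then have "map_matrix complex_of_real M *v ?x = Complex a b *s ?x" "?x \<noteq> 0"
    by (auto simp: vec_eq_iff map_complex_mult complex_eq_iff)
  then show ?thesis unfolding eigenvalues_def by blast
qed

lemma eigenvalue_imp_eigenpair:
  assumes "map_matrix complex_of_real M *v x = \<mu> *s x" "x \<noteq> 0"
  shows "eigenpair (mv M) (Re \<mu>) (Im \<mu>) (\<chi> i. Re (x $ i)) (\<chi> i. Im (x $ i))"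
proof -
  have "Complex ((M *v (\<chi> k. Re (x $ k))) $ i) ((M *v (\<chi> k. Im (x $ k))) $ i) = \<mu> * x $ i" for i
    using arg_cong[OF assms(1), of "\<lambda>y. y $ i"] unfolding map_complex_mult by simp
  then show ?thesis using assms(2)
    by (auto simp: eigenpair_def vec_eq_iff complex_eq_iff)
qed

lemma mat_scalar_vec: "mat \<mu> *v w = \<mu> *s (w :: 'a::comm_ring_1^'n)"
proof -
  have "(\<Sum>j\<in>UNIV. (if i = j then \<mu> else 0) * w $ j) = (\<Sum>j\<in>UNIV. if i = j then \<mu> * w $ j else 0)" for i
    by (rule sum.cong) auto
  then show ?thesis by (simp add: vec_eq_iff matrix_vector_mult_def mat_def)
qed

text \<open>
  \<open>M\<^sup>T - \<mu>\<close> and \<open>M - \<mu>\<close> are invertible together.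
\<close>

lemma eigenvalues_transpose:
  assumes "\<mu> \<in> eigenvalues (transpose M)"
  shows "\<mu> \<in> eigenvalues M"
proof -
  let ?X = "map_matrix complex_of_real M - mat \<mu>"
  obtain w where w: "w \<noteq> 0" "map_matrix complex_of_real (transpose M) *v w = \<mu> *s w"
    using assms unfolding eigenvalues_def by blast
  have "transpose ?X *v w = 0"
  proof -
    have "transpose ?X = map_matrix complex_of_real (transpose M) - mat \<mu>"
      by (simp add: vec_eq_iff transpose_def mat_def)
    then show ?thesis using w(2)
      by (simp add: matrix_vector_mult_diff_rdistrib mat_scalar_vec)
  qed
  have "\<not> (\<forall>x. ?X *v x = 0 \<longrightarrow> x = 0)"
  proof
    assume "\<forall>x. ?X *v x = 0 \<longrightarrow> x = 0"
    then obtain Z where "Z ** ?X = mat 1" using matrix_left_invertible_ker by blast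
    then have "?X ** Z = mat 1" by (simp add: matrix_left_right_inverse)
    then have "transpose Z ** transpose ?X = mat 1"
      by (metis matrix_transpose_mul transpose_mat)
    then have "w = transpose Z *v (transpose ?X *v w)" by (simp add: matrix_vector_mul_assoc del: transpose_matrix_vector)
    then show False using \<open>transpose ?X *v w = 0\<close> w(1) by simp
  qed
  then obtain x where x: "x \<noteq> 0" "?X *v x = 0" by blast
  have "map_matrix complex_of_real M *v x = \<mu> *s x"
    using x(2) by (simp add: matrix_vector_mult_diff_rdistrib mat_scalar_vec)
  then show ?thesis using x(1) unfolding eigenvalues_def by blast
qed

lemma poly_act_eigenpair:
  fixes p :: "real poly"
  assumes M: "linear M" and e: "eigenpair M a b u v"
  defines "z \<equiv> poly (map_poly complex_of_real p) (Complex a b)"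
  shows "poly_act p M u = Re z *\<^sub>R u - Im z *\<^sub>R v" "poly_act p M v = Im z *\<^sub>R u + Re z *\<^sub>R v"
proof -
  have uv: "M u = a *\<^sub>R u - b *\<^sub>R v" "M v = b *\<^sub>R u + a *\<^sub>R v" using e by (simp_all add: eigenpair_def)
  have "poly_act p M u = Re (poly (map_poly complex_of_real p) (Complex a b)) *\<^sub>R u - Im (poly (map_poly complex_of_real p) (Complex a b)) *\<^sub>R v \<and>
     poly_act p M v = Im (poly (map_poly complex_of_real p) (Complex a b)) *\<^sub>R u + Re (poly (map_poly complex_of_real p) (Complex a b)) *\<^sub>R v"
  proof (induction p rule: pCons_induct)
    case (pCons k p)
    then have *: "poly_act (pCons k p) M u = k *\<^sub>R u + M (Re (poly (map_poly complex_of_real p) (Complex a b)) *\<^sub>R u - Im (poly (map_poly complex_of_real p) (Complex a b)) *\<^sub>R v)"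
      "poly_act (pCons k p) M v = k *\<^sub>R v + M (Im (poly (map_poly complex_of_real p) (Complex a b)) *\<^sub>R u + Re (poly (map_poly complex_of_real p) (Complex a b)) *\<^sub>R v)"
      by (simp_all add: M)
    show ?case unfolding *
      by (simp add: M map_poly_pCons linear_diff linear_add linear_cmul uv algebra_simps)
  qed simp
  then show "poly_act p M u = Re z *\<^sub>R u - Im z *\<^sub>R v" "poly_act p M v = Im z *\<^sub>R u + Re z *\<^sub>R v"
    by (simp_all add: z_def)
qed

lemma eigenpair_root:
  assumes M: "linear M" and e: "eigenpair M a b u v" and "poly_act p M u = 0" "poly_act p M v = 0"
  shows "poly (map_poly complex_of_real p) (Complex a b) = 0"
proof -
  define z where "z = poly (map_poly complex_of_real p) (Complex a b)"
  have 1: "Re z *\<^sub>R u = Im z *\<^sub>R v" "Im z *\<^sub>R u = - (Re z *\<^sub>R v)"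
    using poly_act_eigenpair[OF M e, of p] assms(3,4) unfolding z_def[symmetric] eq_neg_iff_add_eq_0
    by simp_all
  have "((Re z)\<^sup>2 + (Im z)\<^sup>2) *\<^sub>R u = Re z *\<^sub>R (Re z *\<^sub>R u) + Im z *\<^sub>R (Im z *\<^sub>R u)"
    by (simp add: power2_eq_square scaleR_left_distrib)
  also have "\<dots> = 0" unfolding 1 by (simp add: mult.commute)
  finally have u: "((Re z)\<^sup>2 + (Im z)\<^sup>2) *\<^sub>R u = 0" .
  have "((Re z)\<^sup>2 + (Im z)\<^sup>2) *\<^sub>R v = Re z *\<^sub>R (Re z *\<^sub>R v) + Im z *\<^sub>R (Im z *\<^sub>R v)"
    by (simp add: power2_eq_square scaleR_left_distrib)
  also have "\<dots> = - (Re z *\<^sub>R (Im z *\<^sub>R u)) + Im z *\<^sub>R (Re z *\<^sub>R u)" using 1 by simp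
  also have "\<dots> = 0" by (simp add: mult.commute)
  finally have "(Re z)\<^sup>2 + (Im z)\<^sup>2 = 0" using u e by (auto simp: eigenpair_def)
  then show ?thesis by (simp add: z_def[symmetric] complex_eq_iff)
qed

text \<open>
  Every root of a minimal polynomial is an eigenvalue: otherwise the corresponding factor could be cancelled.
\<close>

lemma internal_model_eigenvalues:
  assumes min: "is_minimal_polynomial S (char_polynomial \<beta>)" and e: "eigenpair (mv \<beta>) a b u v"
  shows "Complex a b \<in> eigenvalues S"
proof -
  let ?p = "char_polynomial \<beta>" and ?z = "Complex a b"
  have lin: "linear (mv M)" for M :: "real^'k^'k" by (rule matrix_vector_mul_linear)
  have "poly (map_poly complex_of_real ?p) ?z = 0"
    by (rule eigenpair_root[OF lin e cayley_hamilton cayley_hamilton])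
  then obtain r where r: "?p = root_factor ?z * r" using root_factor_dvd by (metis dvdE)
  have "?p \<noteq> 0" using min by (auto simp: is_minimal_polynomial_def)
  then have "r \<noteq> 0" "degree r < degree ?p"
    using r degree_mult_eq[of "root_factor ?z" r] degree_root_factor_pos[of ?z] by auto
  then have "matrix_poly r S \<noteq> 0" using min unfolding is_minimal_polynomial_def by (meson not_le)
  then obtain x where x: "matrix_poly r S *v x \<noteq> 0"
    by (metis matrix_eq matrix_vector_mult_0)
  have "poly_act (root_factor ?z) (mv S) (matrix_poly r S *v x) = matrix_poly ?p S *v x"
    unfolding matrix_poly_vec r by (simp add: poly_act_mult[OF lin])
  also have "\<dots> = 0" using min by (simp add: is_minimal_polynomial_def)
  finally have "poly_act (root_factor ?z) (mv S) (matrix_poly r S *v x) = 0" .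
  from eigenpair_imp_eigenvalue[OF eigenpair_of_root_factor[OF lin x this]] show ?thesis by simp
qed

section \<open>Recovering the error from the internal model\<close>

text \<open>
  The eigenvector test, dual form. Along any trajectory the two coordinates \<open>u \<bullet> \<xi>\<close> and \<open>v \<bullet> \<xi>\<close> are not influenced by the
  input, so a trajectory that starts at the origin never reaches a point at which one of them is nonzero.
\<close>

lemma controllable_eigenpair:
  fixes \<beta> :: "real^'s^'s" and \<sigma> :: "real^1^'s"
  assumes c: "controllable \<beta> \<sigma>" and e: "eigenpair (mv (transpose \<beta>)) a b u v"
    and u: "u \<bullet> column 1 \<sigma> = 0" and v: "v \<bullet> column 1 \<sigma> = 0"
  shows False
proof -
  have uv: "transpose \<beta> *v u = a *\<^sub>R u - b *\<^sub>R v" "transpose \<beta> *v v = b *\<^sub>R u + a *\<^sub>R v"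
    using e by (simp_all add: eigenpair_def)
  have \<sigma>: "\<sigma> *v y = (y $ 1) *\<^sub>R column 1 \<sigma>" for y :: "real^1"
    by (simp add: vec_eq_iff matrix_vector_mult_def column_def sum_1 mult.commute)
  have adj: "x \<bullet> (\<beta> *v y) = (transpose \<beta> *v x) \<bullet> y" for x y
    by (simp add: dot_lmul_matrix[symmetric] )
  have zero: "u \<bullet> y = 0 \<and> v \<bullet> y = 0" for y
  proof -
    obtain T w \<xi> where T: "T > 0" and w: "\<xi> 0 = 0" "\<xi> T = y"
      "\<And>t. t \<in> {0..T} \<Longrightarrow> (\<xi> has_vector_derivative \<beta> *v \<xi> t + \<sigma> *v w t) (at t within {0..T})"
      using c[unfolded controllable_def, rule_format, of 0 y] by blast
    define N where "N t = ((u \<bullet> \<xi> t)\<^sup>2 + (v \<bullet> \<xi> t)\<^sup>2) * exp (- 2 * a * t)" for t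
    have "(N has_vector_derivative 0) (at t within {0..T})" if t: "t \<in> {0..T}" for t
    proof -
      have du: "((\<lambda>t. u \<bullet> \<xi> t) has_real_derivative a * (u \<bullet> \<xi> t) - b * (v \<bullet> \<xi> t)) (at t within {0..T})"
        using has_real_derivative_inner[OF has_vector_derivative_const[of u] w(3)[OF t]]
        by (simp add: inner_add_right \<sigma> u adj uv inner_diff_left del: transpose_matrix_vector)
      have dv: "((\<lambda>t. v \<bullet> \<xi> t) has_real_derivative b * (u \<bullet> \<xi> t) + a * (v \<bullet> \<xi> t)) (at t within {0..T})"
        using has_real_derivative_inner[OF has_vector_derivative_const[of v] w(3)[OF t]]
        by (simp add: inner_add_right \<sigma> v adj uv inner_add_left del: transpose_matrix_vector)
      have "(N has_real_derivative 0) (at t within {0..T})"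
        unfolding N_def[abs_def]
        by (rule derivative_eq_intros du dv refl | simp)+ (simp add: algebra_simps power2_eq_square)
      then show ?thesis by (simp add: has_real_derivative_iff_has_vector_derivative)
    qed
    then obtain k where k: "\<And>t. t \<in> {0..T} \<Longrightarrow> N t = k"
      using has_vector_derivative_zero_constant[of "{0..T}" N] by (metis convex_real_interval(5))
    have "N T = N 0" using k[of T] k[of 0] T by simp
    then have "(u \<bullet> y)\<^sup>2 + (v \<bullet> y)\<^sup>2 = 0" by (simp add: N_def w)
    then show ?thesis by (simp add: sum_power2_eq_zero_iff)
  qed
  from zero[of u] zero[of v] e show False by (auto simp: eigenpair_def)
qed

text \<open>
  If \<open>\<beta>\<^sup>d\<^sup>-\<^sup>1 \<sigma>\<close> were a combination of the earlier vectors \<open>\<beta>\<^sup>k \<sigma>\<close>, these would span a proper invariant subspace that contains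
  \<open>\<sigma>\<close>; its orthogonal complement would contain an eigenpair of \<open>\<beta>\<^sup>T\<close>, against controllability.
\<close>

lemma readout_functional:
  fixes \<beta> :: "real^'s^'s" and \<sigma> :: "real^1^'s"
  assumes c: "controllable \<beta> \<sigma>" and d: "0 < d" "d \<le> CARD('s)"
  shows "\<exists>c. (\<forall>k<d - 1. c \<bullet> (mv \<beta> ^^ k) (column 1 \<sigma>) = 0) \<and> c \<bullet> (mv \<beta> ^^ (d - 1)) (column 1 \<sigma>) = 1"
proof -
  let ?s = "\<lambda>k. (mv \<beta> ^^ k) (column 1 \<sigma>)"
  let ?S = "?s ` {..<d - 1}"
  have adj: "x \<bullet> (\<beta> *v y) = (transpose \<beta> *v x) \<bullet> y" for x y
    by (simp add: dot_lmul_matrix[symmetric])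
  have notin: "?s (d - 1) \<notin> span ?S"
  proof
    assume inV: "?s (d - 1) \<in> span ?S"
    have le: "?s k \<in> span ?S" if "k \<le> d - 1" for k
      using that inV by (cases "k = d - 1") (auto intro: span_base)
    have inv: "\<beta> *v y \<in> span ?S" if "y \<in> span ?S" for y
      using that
    proof (induction rule: span_induct)
      case base
      show ?case
        by (rule subspaceI) (auto simp: matrix_vector_right_distrib matrix_vector_mult_scaleR span_0 span_add span_scale)
    next
      case (step x)
      then obtain k where "k < d - 1" "x = ?s k" by auto
      then show ?case using le[of "Suc k"] by simp
    qed
    define U where "U = {x. \<forall>y\<in>span ?S. x \<bullet> y = 0}"
    have U: "subspace U" by (rule subspaceI) (auto simp: U_def inner_simps)
    have invU: "mv (transpose \<beta>) x \<in> U" if "x \<in> U" for x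
      using that inv by (auto simp: U_def adj[symmetric] simp del: transpose_matrix_vector)
    have "dim ?S \<le> card ?S" by (rule dim_le_card') simp
    also have "\<dots> \<le> d - 1" using card_image_le[of "{..<d - 1}" ?s] by simp
    also have "\<dots> < DIM(real^'s)" using d by simp
    finally obtain x where x: "x \<noteq> 0" "\<And>y. y \<in> span ?S \<Longrightarrow> orthogonal x y"
      using orthogonal_to_subspace_exists[of ?S] by blast
    then have "x \<in> U" by (auto simp: U_def orthogonal_def)
    have "\<exists>a b. \<exists>u\<in>U. \<exists>v\<in>U. eigenpair (mv (transpose \<beta>)) a b u v"
      by (rule exists_eigenpair[OF matrix_vector_mul_linear U _ \<open>x \<in> U\<close> x(1)]) (rule invU)
    then obtain a b u v where uv: "u \<in> U" "v \<in> U" "eigenpair (mv (transpose \<beta>)) a b u v" by blast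
    have "column 1 \<sigma> \<in> span ?S" using le[of 0] by simp
    then show False using controllable_eigenpair[OF c uv(3)] uv(1,2) by (auto simp: U_def)
  qed
  obtain y z where yz: "y \<in> span ?S" "\<And>w. w \<in> span ?S \<Longrightarrow> orthogonal z w" "?s (d - 1) = y + z"
    using orthogonal_subspace_decomp_exists[of ?S "?s (d - 1)"] by blast
  have z: "z \<noteq> 0" using yz notin by auto
  have zz: "z \<bullet> ?s (d - 1) = z \<bullet> z" using yz by (simp add: inner_simps orthogonal_def)
  show ?thesis
  proof (intro exI[of _ "(1 / (z \<bullet> z)) *\<^sub>R z"] conjI allI impI)
    fix k assume "k < d - 1"
    then have "?s k \<in> span ?S" by (auto intro: span_base)
    then show "((1 / (z \<bullet> z)) *\<^sub>R z) \<bullet> ?s k = 0" using yz(2) by (simp add: orthogonal_def)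
  qed (use z zz in simp)
qed

text \<open>
  Here \<open>\<zeta> k\<close> and \<open>e k\<close> stand for the \<open>k\<close>-th derivatives of the internal-model state and of its input. Unrolling
  the recursion gives \<open>\<zeta> k = \<beta>\<^sup>k \<zeta> 0 + \<Sum>\<^sub>l \<beta>\<^sup>k\<^sup>-\<^sup>1\<^sup>-\<^sup>l \<sigma> e l\<close>. The readout functional sees the input only in the term with
  \<open>\<beta>\<^sup>d\<^sup>-\<^sup>1 \<sigma>\<close>, which occurs once, with \<open>e 0\<close> in \<open>\<zeta> d\<close>; the contributions of \<open>\<zeta> 0\<close> cancel by the Cayley-Hamilton theorem.
\<close>

lemma internal_model_readout:
  fixes \<beta> :: "real^'s^'s" and \<sigma> :: "real^1^'s"
  assumes c: "controllable \<beta> \<sigma>" and lead: "lead_coeff (char_polynomial \<beta>) = 1"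
  shows "\<exists>c. \<forall>\<zeta> e. (\<forall>k. \<zeta> (Suc k) = \<beta> *v \<zeta> k + e k *\<^sub>R column 1 \<sigma>) \<longrightarrow>
     c \<bullet> (\<Sum>k\<le>degree (char_polynomial \<beta>). coeff (char_polynomial \<beta>) k *\<^sub>R \<zeta> k) = e 0"
proof -
  let ?p = "char_polynomial \<beta>"
  let ?s = "\<lambda>k. (mv \<beta> ^^ k) (column 1 \<sigma>)"
  define d where "d = degree ?p"
  have d0: "d > 0"
  proof (rule ccontr)
    assume "\<not> d > 0"
    then have "?p = 1" using lead by (metis d_def degree_eq_zeroE gr0I lead_coeff_pCons(2) one_pCons)
    then have "x = 0" for x :: "real^'s" using cayley_hamilton[of \<beta> x]
      by (simp add: one_pCons poly_act_pCons[OF matrix_vector_mul_linear])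
    from this[of "axis undefined 1"] show False by simp
  qed
  obtain c where c: "\<And>k. k < d - 1 \<Longrightarrow> c \<bullet> ?s k = 0" "c \<bullet> ?s (d - 1) = 1"
    using readout_functional[OF assms(1) d0] degree_char_polynomial_le[of \<beta>] unfolding d_def by blast
  show ?thesis
  proof (intro exI[of _ c] allI impI)
    fix \<zeta> :: "nat \<Rightarrow> real^'s" and e
    assume rec: "\<forall>k. \<zeta> (Suc k) = \<beta> *v \<zeta> k + e k *\<^sub>R column 1 \<sigma>"
    have lin: "linear (mv \<beta> ^^ m)" for m
      by (induction m) (auto intro: linear_compose[OF _ matrix_vector_mul_linear, unfolded o_def] simp: linear_id[unfolded id_def] linear_iff matrix_vector_right_distrib matrix_vector_mult_scaleR)
    have step: "c \<bullet> (mv \<beta> ^^ m) (\<zeta> (Suc k)) = c \<bullet> (mv \<beta> ^^ Suc m) (\<zeta> k) + e k * (c \<bullet> ?s m)" for m k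
      by (simp add: rec linear_add[OF lin] linear_cmul[OF lin] inner_simps funpow_swap1)
    have low: "m + k \<le> d - 1 \<Longrightarrow> c \<bullet> (mv \<beta> ^^ m) (\<zeta> k) = c \<bullet> (mv \<beta> ^^ (m + k)) (\<zeta> 0)" for m k
    proof (induction k arbitrary: m)
      case (Suc k)
      have "c \<bullet> ?s m = 0" using Suc.prems by (intro c(1)) simp
      then show ?case unfolding step using Suc.IH[of "Suc m"] Suc.prems by simp
    qed simp
    have top: "m + Suc k = d \<Longrightarrow> c \<bullet> (mv \<beta> ^^ m) (\<zeta> (Suc k)) = c \<bullet> (mv \<beta> ^^ d) (\<zeta> 0) + e 0" for m k
    proof (induction k arbitrary: m)
      case 0
      then have m: "m = d - 1" "Suc m = d" by auto
      show ?case unfolding step m(2) unfolding m(1) c(2) by simp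
    next
      case (Suc k)
      have "c \<bullet> ?s m = 0" using Suc.prems by (intro c(1)) simp
      then show ?case unfolding step[of m "Suc k"] using Suc.IH[of "Suc m"] Suc.prems by simp
    qed
    have val: "c \<bullet> \<zeta> k = c \<bullet> (mv \<beta> ^^ k) (\<zeta> 0) + (if k = d then e 0 else 0)" if "k \<le> d" for k
    proof (cases "k = d")
      case True
      then show ?thesis using top[of 0 "d - 1"] d0 by simp
    next
      case False
      then show ?thesis using low[of 0 k] that by simp
    qed
    have "c \<bullet> (\<Sum>k\<le>d. coeff ?p k *\<^sub>R \<zeta> k) = (\<Sum>k\<le>d. coeff ?p k * (c \<bullet> \<zeta> k))"
      by (simp add: inner_sum_right)
    also have "\<dots> = (\<Sum>k\<le>d. coeff ?p k * (c \<bullet> (mv \<beta> ^^ k) (\<zeta> 0)) + (if k = d then coeff ?p k * e 0 else 0))"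
      by (rule sum.cong) (auto simp: val algebra_simps)
    also have "\<dots> = c \<bullet> poly_act ?p (mv \<beta>) (\<zeta> 0) + coeff ?p d * e 0"
      by (simp add: sum.distrib poly_act_sum[OF matrix_vector_mul_linear] inner_sum_right d_def)
    also have "\<dots> = e 0" using lead by (simp add: cayley_hamilton d_def)
    finally show "c \<bullet> (\<Sum>k\<le>degree ?p. coeff ?p k *\<^sub>R \<zeta> k) = e 0" unfolding d_def .
  qed
qed

section \<open>The augmented plant\<close>

lemma sum_UNIV_prod: "(\<Sum>i\<in>UNIV. f i) = (\<Sum>q\<in>UNIV. \<Sum>s\<in>UNIV. f (q, s))"
  for f :: "'p::finite \<times> 's::finite \<Rightarrow> 'b::comm_monoid_add"
  by (simp add: sum.cartesian_product flip: UNIV_Times_UNIV)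

lemma sum_UNIV_sum: "(\<Sum>i\<in>UNIV. f i) = (\<Sum>q\<in>UNIV. f (Inl q)) + (\<Sum>s\<in>UNIV. f (Inr s))"
  for f :: "'p::finite + 's::finite \<Rightarrow> 'b::comm_monoid_add"
  by (simp add: sum.Plus flip: UNIV_Plus_UNIV)

definition block :: "real^('p::finite \<times> 's::finite) \<Rightarrow> 'p \<Rightarrow> real^'s" where
  "block z q = (\<chi> s. z $ (q, s))"

lemma linear_block: "linear (\<lambda>z. block z q)"
  by (simp add: linear_iff block_def vec_eq_iff)

lemma block_eq_0: "(\<And>q. block z q = 0) \<Longrightarrow> z = 0"
  by (auto simp: block_def vec_eq_iff)

lemma block_copies:
  fixes z :: "real^('p::finite \<times> 's::finite)" and \<beta> :: "real^'s^'s"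
  shows "block (copies \<beta> *v z) q = \<beta> *v block z q"
proof -
  have "(copies \<beta> *v z) $ (q, s) = (\<beta> *v block z q) $ s" for s
  proof -
    have "(copies \<beta> *v z) $ (q, s) = (\<Sum>q'\<in>UNIV. \<Sum>s'\<in>UNIV. (if q = q' then \<beta> $ s $ s' else 0) * z $ (q', s'))"
      by (simp add: matrix_vector_mult_def sum_UNIV_prod copies_def cong: if_cong)
    also have "\<dots> = (\<Sum>q'\<in>UNIV. if q = q' then \<Sum>s'\<in>UNIV. \<beta> $ s $ s' * z $ (q', s') else 0)"
      by (rule sum.cong) auto
    finally show ?thesis by (simp add: matrix_vector_mult_def block_def)
  qed
  then show ?thesis by (simp add: block_def vec_eq_iff)
qed

lemma transpose_copies: "transpose (copies \<beta>) = copies (transpose \<beta>)"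
  by (simp add: vec_eq_iff transpose_def copies_def)

lemma block_input:
  fixes e :: "real^'p" and \<sigma> :: "real^1^'s"
  shows "block ((\<chi> i j. copies \<sigma> $ i $ (j, 1)) *v e) q = e $ q *\<^sub>R column 1 \<sigma>"
proof -
  have "(\<Sum>j\<in>UNIV. (if q = j then \<sigma> $ s $ 1 else 0) * e $ j) = (\<Sum>j\<in>UNIV. if q = j then \<sigma> $ s $ 1 * e $ j else 0)" for s
    by (rule sum.cong) auto
  then show ?thesis
    by (simp add: vec_eq_iff block_def matrix_vector_mult_def copies_def column_def mult.commute cong: if_cong)
qed

lemma transpose_input:
  fixes y :: "real^('p::finite \<times> 's::finite)" and \<sigma> :: "real^1^'s"
  shows "(transpose (\<chi> i j. copies \<sigma> $ i $ (j, 1)) *v y) $ q = block y q \<bullet> column 1 \<sigma>"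
proof -
  have "(transpose (\<chi> i j. copies \<sigma> $ i $ (j, 1)) *v y) $ q =
     (\<Sum>q'\<in>UNIV. \<Sum>s\<in>UNIV. (if q' = q then \<sigma> $ s $ 1 else 0) * y $ (q', s))"
    by (simp add: matrix_vector_mult_def transpose_def sum_UNIV_prod copies_def del: transpose_matrix_vector cong: if_cong)
  also have "\<dots> = (\<Sum>q'\<in>UNIV. if q' = q then \<Sum>s\<in>UNIV. \<sigma> $ s $ 1 * y $ (q', s) else 0)"
    by (rule sum.cong) auto
  finally show ?thesis by (simp add: inner_vec_def block_def column_def mult.commute)
qed

lemma eigenpair_copies:
  fixes u v :: "real^('p::finite \<times> 's::finite)" and \<beta> :: "real^'s^'s"
  assumes "eigenpair (mv (copies \<beta>)) a b u v"
  shows "\<exists>q. eigenpair (mv \<beta>) a b (block u q) (block v q)"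
proof -
  have "u \<noteq> 0 \<or> v \<noteq> 0" using assms by (simp add: eigenpair_def)
  then obtain q where q: "block u q \<noteq> 0 \<or> block v q \<noteq> 0" using block_eq_0 by blast
  have "\<beta> *v block u q = block (a *\<^sub>R u - b *\<^sub>R v) q" "\<beta> *v block v q = block (b *\<^sub>R u + a *\<^sub>R v) q"
    using assms by (simp_all add: eigenpair_def flip: block_copies)
  then show ?thesis using q
    by (auto simp: eigenpair_def linear_diff[OF linear_block] linear_add[OF linear_block] linear_cmul[OF linear_block])
qed

lemma internal_model_spectrum:
  fixes \<beta> :: "real^'s^'s"
  assumes min: "is_minimal_polynomial S (char_polynomial \<beta>)"
  shows "eigenpair (mv (copies \<beta> :: real^('p::finite \<times> 's)^('p \<times> 's))) a b u v \<Longrightarrow> Complex a b \<in> eigenvalues S"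
    and "eigenpair (mv (transpose (copies \<beta> :: real^('p::finite \<times> 's)^('p \<times> 's)))) a b u v \<Longrightarrow> Complex a b \<in> eigenvalues S"
proof -
  show "Complex a b \<in> eigenvalues S" if "eigenpair (mv (copies \<beta> :: real^('p \<times> 's)^('p \<times> 's))) a b u v"
    using eigenpair_copies[OF that] internal_model_eigenvalues[OF min] by blast
  show "Complex a b \<in> eigenvalues S" if e: "eigenpair (mv (transpose (copies \<beta> :: real^('p \<times> 's)^('p \<times> 's)))) a b u v"
  proof -
    from e obtain q where "eigenpair (mv (transpose \<beta>)) a b (block u q) (block v q)"
      unfolding transpose_copies using eigenpair_copies by blast
    from eigenvalues_transpose[OF eigenpair_imp_eigenvalue[OF this]]
    obtain x where "x \<noteq> 0" "map_matrix complex_of_real \<beta> *v x = Complex a b *s x"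
      unfolding eigenvalues_def by blast
    from internal_model_eigenvalues[OF min eigenvalue_imp_eigenpair[OF this(2,1)]] show ?thesis by simp
  qed
qed

definition augmented_dynamics :: "real^'n^'n \<Rightarrow> real^'n^'p \<Rightarrow> real^'z^'z \<Rightarrow> real^'p^'z \<Rightarrow> (real^'n) \<times> (real^'z) \<Rightarrow> (real^'n) \<times> (real^'z)" where
  "augmented_dynamics A C G1 G2 X = (A *v fst X, G1 *v snd X + G2 *v (C *v fst X))"

definition augmented_input :: "real^'m^'n \<Rightarrow> real^'m \<Rightarrow> (real^'n) \<times> (real^'z)" where
  "augmented_input B u = (B *v u, 0)"

lemma linear_augmented_dynamics: "linear (augmented_dynamics A C G1 G2)"
  by (simp add: linear_iff augmented_dynamics_def matrix_vector_right_distrib matrix_vector_mult_scaleR algebra_simps)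

lemma linear_augmented_input: "linear (augmented_input B)"
  by (simp add: linear_iff augmented_input_def matrix_vector_right_distrib matrix_vector_mult_scaleR)

lemma inner_matrix_transpose: "(M *v x) \<bullet> y = x \<bullet> (transpose M *v (y :: real^'k))"
  by (metis adjoint_matrix adjoint_works inner_commute matrix_vector_mul_linear)

lemma adjoint_augmented_dynamics:
  "adjoint (augmented_dynamics A C G1 G2) =
     (\<lambda>W. (transpose A *v fst W + transpose C *v (transpose G2 *v snd W), transpose G1 *v snd W))"
  by (rule adjoint_unique)
     (simp add: augmented_dynamics_def inner_prod_def inner_matrix_transpose inner_simps del: transpose_matrix_vector)

lemma adjoint_augmented_input: "adjoint (augmented_input B) = (\<lambda>W. transpose B *v fst W)"
  by (rule adjoint_unique)
     (simp add: augmented_input_def inner_prod_def inner_matrix_transpose del: transpose_matrix_vector)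

text \<open>
  Full row rank means that the rows are distinct and independent, so the only vanishing combination of them is the
  trivial one.
\<close>

lemma full_row_rank:
  fixes M :: "'a::field^'l^'k"
  assumes rank: "rank M = CARD('k)" and r: "\<And>j. (\<Sum>i\<in>UNIV. r i * M $ i $ j) = 0"
  shows "r i = 0"
proof -
  have eq: "rows M = range (\<lambda>i. row i M)" by (auto simp: rows_def)
  then have fin: "finite (rows M)" by simp
  have le: "card (rows M) \<le> CARD('k)" unfolding eq by (rule card_image_le) simp
  have dim: "vec.dim (rows M) = CARD('k)" using rank by (simp add: row_rank_def_gen)
  have "vec.dim (rows M) \<le> card (rows M)" by (rule vec.dim_le_card'[OF fin])
  with le dim have card: "card (rows M) = CARD('k)" by simp
  then have inj: "inj (\<lambda>i. row i M)" unfolding eq by (intro eq_card_imp_inj_on) simp_all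
  have ind: "vec.independent (rows M)"
    by (rule vec.card_le_dim_spanning[OF order_refl vec.span_superset fin]) (simp add: dim card)
  have inv: "inv (\<lambda>i. row i M) (row k M) = k" for k using inv_f_f[OF inj, of k] by simp
  have "(\<Sum>i\<in>UNIV. r i *s row i M) = 0"
    using r by (simp add: vec_eq_iff row_def)
  then have "(\<Sum>y\<in>rows M. r (inv (\<lambda>i. row i M) y) *s y) = 0"
    unfolding eq by (simp add: sum.reindex[OF inj] inv)
  moreover have "row i M \<in> rows M" by (simp add: eq)
  ultimately have "r (inv (\<lambda>i. row i M) (row i M)) = 0"
    by (rule vec.independentD[OF ind fin order_refl, where u = "\<lambda>y. r (inv (\<lambda>i. row i M) y)"])
  then show ?thesis by (simp only: inv)
qed

lemma complex_left_mult:
  fixes M :: "real^'c^'d"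
  shows "(\<Sum>k\<in>UNIV. Complex (x $ k) (y $ k) * complex_of_real (M $ k $ c)) =
      Complex ((transpose M *v x) $ c) ((transpose M *v y) $ c)"
  by (simp add: complex_eq_iff matrix_vector_mult_def transpose_def mult.commute del: transpose_matrix_vector)

text \<open>
  The rank condition in dual form: the complex vector \<open>(u + i v, g + i h)\<close> is in the left kernel of a matrix of full
  row rank.
\<close>

lemma rank_condition_left_kernel:
  fixes A :: "real^'n^'n" and B :: "real^'m^'n" and C :: "real^'n^'p"
  assumes rank: "rank (block_matrix (map_matrix complex_of_real A - mat (Complex a b)) (map_matrix complex_of_real B)
                         (map_matrix complex_of_real C) (0 :: complex^'m^'p)) = CARD('n) + CARD('p)"
    and u: "transpose A *v u + transpose C *v g = a *\<^sub>R u - b *\<^sub>R v" "transpose B *v u = 0"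
    and v: "transpose A *v v + transpose C *v h = b *\<^sub>R u + a *\<^sub>R v" "transpose B *v v = 0"
  shows "u = 0 \<and> v = 0 \<and> g = 0 \<and> h = 0"
proof -
  let ?M = "block_matrix (map_matrix complex_of_real A - mat (Complex a b)) (map_matrix complex_of_real B)
                         (map_matrix complex_of_real C) (0 :: complex^'m^'p)"
  define r where "r i = (case i of Inl k \<Rightarrow> Complex (u $ k) (v $ k) | Inr q \<Rightarrow> Complex (g $ q) (h $ q))" for i
  have "(\<Sum>i\<in>UNIV. r i * ?M $ i $ j) = 0" for j
  proof (cases j)
    case (Inl c)
    have "(\<Sum>k\<in>UNIV. Complex (u $ k) (v $ k) * mat (Complex a b) $ k $ c) =
        (\<Sum>k\<in>UNIV. if k = c then Complex (u $ k) (v $ k) * Complex a b else 0)"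
      by (rule sum.cong) (auto simp: mat_def)
    then have "(\<Sum>i\<in>UNIV. r i * ?M $ i $ j) = Complex ((transpose A *v u) $ c) ((transpose A *v v) $ c)
        - Complex (u $ c) (v $ c) * Complex a b + Complex ((transpose C *v g) $ c) ((transpose C *v h) $ c)"
      by (simp add: complex_left_mult sum_UNIV_sum block_matrix_def r_def Inl right_diff_distrib sum_subtractf del: transpose_matrix_vector)
    also have "\<dots> = 0"
      using arg_cong[OF u(1), of "\<lambda>x. x $ c"] arg_cong[OF v(1), of "\<lambda>x. x $ c"]
      by (simp add: complex_eq_iff algebra_simps del: transpose_matrix_vector)
    finally show ?thesis .
  next
    case (Inr c)
    have "(\<Sum>i\<in>UNIV. r i * ?M $ i $ j) = Complex ((transpose B *v u) $ c) ((transpose B *v v) $ c)"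
      by (simp add: complex_left_mult sum_UNIV_sum block_matrix_def r_def Inr del: transpose_matrix_vector)
    then show ?thesis using u(2) v(2) by (simp add: complex_eq_iff del: transpose_matrix_vector)
  qed
  then have "r i = 0" for i using full_row_rank[of ?M r i] rank by simp
  from this[of "Inl _"] this[of "Inr _"] show ?thesis
    by (simp add: r_def vec_eq_iff complex_eq_iff)
qed

text \<open>
  Eigenpairs of the transposed augmented plant. If the component along the internal model is nonzero, the eigenvalue
  belongs to \<open>G1\<close>, hence to \<open>S\<close>, and is purely imaginary; the other eigenpairs are those of \<open>A\<^sup>T\<close>. For an eigenpair that the input
  does not see, the first case is impossible: the rank condition forces the plant component and \<open>G2\<^sup>T\<close> of the internal-model
  component to vanish, which contradicts controllability of the internal model. In the second case stabilizability of
  \<open>(A, B)\<close> gives a negative real part.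
\<close>

lemma augmented_eigenpairs:
  fixes A :: "real^'n^'n" and B :: "real^'m^'n" and C :: "real^'n^'p" and S :: "real^'q^'q"
    and G1 :: "real^('p \<times> 's::finite)^('p \<times> 's)" and G2 :: "real^'p^('p \<times> 's)"
  assumes S: "\<And>\<mu>. \<mu> \<in> eigenvalues S \<Longrightarrow> Re \<mu> = 0"
    and stab: "stabilizable A B"
    and rank: "\<And>\<mu>. \<mu> \<in> eigenvalues S \<Longrightarrow>
      rank (block_matrix (map_matrix complex_of_real A - mat \<mu>) (map_matrix complex_of_real B)
                         (map_matrix complex_of_real C) (0 :: complex^'m^'p)) = CARD('n) + CARD('p)"
    and A: "\<And>\<mu>. \<mu> \<in> eigenvalues A \<Longrightarrow> \<not> Re \<mu> > 0"
    and im: "minimal_p_copy_internal_model S G1 G2"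
    and e: "eigenpair (adjoint (augmented_dynamics A C G1 G2)) a b U V"
  shows "a \<le> 0"
    and "adjoint (augmented_input B :: _ \<Rightarrow> (real^'n) \<times> (real^('p \<times> 's))) U = 0 \<Longrightarrow>
         adjoint (augmented_input B :: _ \<Rightarrow> (real^'n) \<times> (real^('p \<times> 's))) V = 0 \<Longrightarrow> a < 0"
proof -
  obtain \<beta> :: "real^'s^'s" and \<sigma> :: "real^1^'s" where G1: "G1 = copies \<beta>" and G2: "G2 = (\<chi> i j. copies \<sigma> $ i $ (j, 1))"
    and min: "is_minimal_polynomial S (char_polynomial \<beta>)" and ctrl: "controllable \<beta> \<sigma>"
    using im unfolding minimal_p_copy_internal_model_def by blast
  obtain u1 u2 v1 v2 where UV: "U = (u1, u2)" "V = (v1, v2)" by (cases U, cases V)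
  have e1: "transpose A *v u1 + transpose C *v (transpose G2 *v u2) = a *\<^sub>R u1 - b *\<^sub>R v1"
      "transpose A *v v1 + transpose C *v (transpose G2 *v v2) = b *\<^sub>R u1 + a *\<^sub>R v1"
    and e2: "transpose G1 *v u2 = a *\<^sub>R u2 - b *\<^sub>R v2" "transpose G1 *v v2 = b *\<^sub>R u2 + a *\<^sub>R v2"
    and nz: "u1 \<noteq> 0 \<or> u2 \<noteq> 0 \<or> v1 \<noteq> 0 \<or> v2 \<noteq> 0"
    using e unfolding eigenpair_def adjoint_augmented_dynamics UV
    by (auto simp: zero_prod_def simp del: transpose_matrix_vector)
  have im_case: "Complex a b \<in> eigenvalues S" if "u2 \<noteq> 0 \<or> v2 \<noteq> 0"
    by (rule internal_model_spectrum(2)[OF min])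
       (use that e2 in \<open>auto simp: eigenpair_def G1 simp del: transpose_matrix_vector\<close>)
  have A_case: "eigenpair (mv (transpose A)) a b u1 v1" if "u2 = 0" "v2 = 0"
    using that e1 nz by (auto simp: eigenpair_def simp del: transpose_matrix_vector)
  show "a \<le> 0"
  proof (cases "u2 = 0 \<and> v2 = 0")
    case True
    from A[OF eigenvalues_transpose[OF eigenpair_imp_eigenvalue[OF A_case]]] True show ?thesis by simp
  next
    case False
    from S[OF im_case] False show ?thesis by auto
  qed
  assume "adjoint (augmented_input B :: _ \<Rightarrow> (real^'n) \<times> (real^('p \<times> 's))) U = 0"
    "adjoint (augmented_input B :: _ \<Rightarrow> (real^'n) \<times> (real^('p \<times> 's))) V = 0"
  then have B: "transpose B *v u1 = 0" "transpose B *v v1 = 0"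
    by (simp_all add: adjoint_augmented_input UV del: transpose_matrix_vector)
  show "a < 0"
  proof (cases "u2 = 0 \<and> v2 = 0")
    case True
    obtain K :: "real^'n^'m" where K: "\<forall>\<mu>\<in>eigenvalues (A + B ** K). Re \<mu> < 0"
      using stab unfolding stabilizable_def by blast
    have "transpose (A + B ** K) *v x = transpose A *v x" if "transpose B *v x = 0" for x
    proof -
      have "transpose (A + B ** K) = transpose A + transpose K ** transpose B"
        by (simp add: vec_eq_iff transpose_def matrix_matrix_mult_def mult.commute)
      then have "transpose (A + B ** K) *v x = transpose A *v x + transpose K *v (transpose B *v x)"
        by (simp add: matrix_vector_mult_add_rdistrib matrix_vector_mul_assoc del: transpose_matrix_vector)
      then show ?thesis using that by (simp del: transpose_matrix_vector)
    qed
    then have "eigenpair (mv (transpose (A + B ** K))) a b u1 v1"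
      using A_case True B by (simp add: eigenpair_def del: transpose_matrix_vector)
    from eigenvalues_transpose[OF eigenpair_imp_eigenvalue[OF this]] K show ?thesis by fastforce
  next
    case False
    then have \<mu>: "Complex a b \<in> eigenvalues S" using im_case by blast
    have z: "transpose G2 *v u2 = 0" "transpose G2 *v v2 = 0"
      using rank_condition_left_kernel[OF rank[OF \<mu>] e1(1) B(1) e1(2) B(2)] by simp_all
    have "eigenpair (mv (copies (transpose \<beta>))) a b u2 v2"
      using e2 False by (auto simp: eigenpair_def G1 transpose_copies)
    then obtain q where q: "eigenpair (mv (transpose \<beta>)) a b (block u2 q) (block v2 q)"
      using eigenpair_copies by blast
    have "block u2 q \<bullet> column 1 \<sigma> = 0" "block v2 q \<bullet> column 1 \<sigma> = 0"
      using z unfolding G2 by (simp_all add: vec_eq_iff transpose_input del: transpose_matrix_vector)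
    from controllable_eigenpair[OF ctrl q this] show ?thesis ..
  qed
qed

section \<open>Undamped modes in the absence of a spanning tree\<close>

lemma cmv_scaleR: "(M :: complex^'a^'b) *v (c *\<^sub>R x) = c *\<^sub>R (M *v x)"
  by (simp add: vec_eq_iff matrix_vector_mult_def scaleR_sum_right)

lemma cscale_scaleR: "(e :: complex) *s (c *\<^sub>R x) = c *\<^sub>R (e *s x)"
  by (simp add: vec_eq_iff)

text \<open>
  The ansatz \<open>x(t) = exp (\<mu> t) fst Y\<close>, \<open>z(t) = exp (\<mu> t) snd Y\<close> inserted into the nominal closed loop, without the
  factor \<open>exp (\<mu> t)\<close>. The numbers \<open>e1\<close>, \<open>e2\<close>, \<open>e3\<close> stand for the delay factors \<open>exp (- \<mu> \<tau>)\<close>, \<open>exp (- \<mu> \<tau>con)\<close> and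
  \<open>exp (- \<mu> \<tau>com)\<close>.
\<close>

definition mode_defect :: "('N::finite option \<Rightarrow> 'N option \<Rightarrow> real) \<Rightarrow> real^'n^'n \<Rightarrow> real^'m^'n \<Rightarrow> real^'n^'p
    \<Rightarrow> real^'z^'z \<Rightarrow> real^'p^'z \<Rightarrow> real^'n^'m \<Rightarrow> real^'z^'m \<Rightarrow> complex \<Rightarrow> complex \<Rightarrow> complex \<Rightarrow> complex
    \<Rightarrow> (complex^'n^'N) \<times> (complex^'z^'N) \<Rightarrow> (complex^'n^'N) \<times> (complex^'z^'N)" where
  "mode_defect a A B C G1 G2 Kx Kz \<mu> e1 e2 e3 Y =
     (\<chi> i. \<mu> *s (fst Y $ i) - map_matrix complex_of_real A *v (fst Y $ i)
          - map_matrix complex_of_real B *v (map_matrix complex_of_real Kx *v (e1 *s (\<Sum>k\<in>UNIV. grounded_laplacian a $ i $ k *\<^sub>R (fst Y $ k)))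
              + map_matrix complex_of_real Kz *v (e2 *s (snd Y $ i))),
      \<chi> i. \<mu> *s (snd Y $ i) - map_matrix complex_of_real G1 *v (snd Y $ i)
          - map_matrix complex_of_real G2 *v (e3 *s (map_matrix complex_of_real C *v (\<Sum>k\<in>UNIV. grounded_laplacian a $ i $ k *\<^sub>R (fst Y $ k)))))"

lemma linear_mode_defect: "linear (mode_defect a A B C G1 G2 Kx Kz \<mu> e1 e2 e3)"
proof (rule linearI)
  fix Y Y' :: "(complex^'a^'b) \<times> (complex^'c^'b)" and r :: real
  have sum_add: "(\<Sum>k\<in>UNIV. H $ k *\<^sub>R (x $ k + y $ k)) = (\<Sum>k\<in>UNIV. H $ k *\<^sub>R x $ k) + (\<Sum>k\<in>UNIV. H $ k *\<^sub>R y $ k)"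
    and sum_scale: "(\<Sum>k\<in>UNIV. H $ k *\<^sub>R (r *\<^sub>R x $ k)) = r *\<^sub>R (\<Sum>k\<in>UNIV. H $ k *\<^sub>R x $ k)"
    for H :: "real^'b" and x y :: "complex^'a^'b"
    by (simp_all add: scaleR_right_distrib sum.distrib scaleR_sum_right mult.commute)
  show "mode_defect a A B C G1 G2 Kx Kz \<mu> e1 e2 e3 (Y + Y') = mode_defect a A B C G1 G2 Kx Kz \<mu> e1 e2 e3 Y + mode_defect a A B C G1 G2 Kx Kz \<mu> e1 e2 e3 Y'"
    unfolding mode_defect_def prod_eq_iff vec_eq_iff[where 'b = 'b] fst_add snd_add fst_conv snd_conv vec_lambda_beta
      vector_add_component sum_add vector_add_ldistrib matrix_vector_right_distrib
    by (simp add: algebra_simps)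
  show "mode_defect a A B C G1 G2 Kx Kz \<mu> e1 e2 e3 (r *\<^sub>R Y) = r *\<^sub>R mode_defect a A B C G1 G2 Kx Kz \<mu> e1 e2 e3 Y"
    unfolding mode_defect_def prod_eq_iff vec_eq_iff[where 'b = 'b] fst_scaleR snd_scaleR fst_conv snd_conv vec_lambda_beta
      vector_scaleR_component sum_scale cscale_scaleR cmv_scaleR
    by (simp add: matrix_vector_right_distrib cmv_scaleR scaleR_right_distrib scaleR_right_diff_distrib)
qed

lemma mode_defect_local:
  assumes H: "\<And>k. grounded_laplacian a $ i $ k \<noteq> 0 \<Longrightarrow> fst Y $ k = fst Y' $ k" and z: "fst Y $ i = fst Y' $ i" "snd Y $ i = snd Y' $ i"
  shows "fst (mode_defect a A B C G1 G2 Kx Kz \<mu> e1 e2 e3 Y) $ i = fst (mode_defect a A B C G1 G2 Kx Kz \<mu> e1 e2 e3 Y') $ i"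
    and "snd (mode_defect a A B C G1 G2 Kx Kz \<mu> e1 e2 e3 Y) $ i = snd (mode_defect a A B C G1 G2 Kx Kz \<mu> e1 e2 e3 Y') $ i"
proof -
  have "grounded_laplacian a $ i $ k *\<^sub>R fst Y $ k = grounded_laplacian a $ i $ k *\<^sub>R fst Y' $ k" for k
    using H[of k] by (cases "grounded_laplacian a $ i $ k = 0") simp_all
  then have "(\<Sum>k\<in>UNIV. grounded_laplacian a $ i $ k *\<^sub>R fst Y $ k) = (\<Sum>k\<in>UNIV. grounded_laplacian a $ i $ k *\<^sub>R fst Y' $ k)"
    by (simp only:)
  then show "fst (mode_defect a A B C G1 G2 Kx Kz \<mu> e1 e2 e3 Y) $ i = fst (mode_defect a A B C G1 G2 Kx Kz \<mu> e1 e2 e3 Y') $ i"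
    and "snd (mode_defect a A B C G1 G2 Kx Kz \<mu> e1 e2 e3 Y) $ i = snd (mode_defect a A B C G1 G2 Kx Kz \<mu> e1 e2 e3 Y') $ i"
    by (simp_all only: mode_defect_def fst_conv snd_conv vec_lambda_beta z)
qed

text \<open>
  A dimension count by means of injectivity. If the mode map \<open>L\<close> were injective it would be surjective. The followers in
  the unreachable set \<open>R\<close> depend on nobody outside \<open>R\<close>, so the part of \<open>L\<close> over \<open>R\<close> (the map \<open>L'\<close>, completed by the
  identity elsewhere) would be surjective and hence injective too. But it annihilates states that are constant
  over \<open>R\<close>: a kernel vector of \<open>\<mu> - A\<close>, if there is one, and otherwise the solution of \<open>(\<mu> - A) x = B Kz e2 z\<close>
  together with the eigenvector \<open>z\<close> of \<open>G1\<close>.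
\<close>

lemma critical_mode:
  fixes A :: "real^'n^'n" and G1 :: "real^'z^'z" and a :: "'N::finite option \<Rightarrow> 'N option \<Rightarrow> real"
  assumes wa: "weighted_adjacency Ed a" and unreach: "(None, Some i0) \<notin> Ed\<^sup>*"
    and z: "map_matrix complex_of_real G1 *v z = \<mu> *s z" "z \<noteq> 0"
  shows "\<exists>Y. Y \<noteq> 0 \<and> mode_defect a A B C G1 G2 Kx Kz \<mu> e1 e2 e3 Y = 0"
proof (rule ccontr)
  let ?L = "mode_defect a A B C G1 G2 Kx Kz \<mu> e1 e2 e3"
  let ?H = "grounded_laplacian a"
  assume "\<not> ?thesis"
  then have "inj ?L" by (subst linear_injective_0[OF linear_mode_defect]) blast
  then have surj: "surj ?L" by (rule linear_injective_imp_surjective[OF linear_mode_defect]) simp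
  define R where "R = {i. (None, Some i) \<notin> Ed\<^sup>*}"
  have a0: "a (Some i) None = 0" if "i \<in> R" for i
    using that wa unfolding R_def weighted_adjacency_def by (metis mem_Collect_eq r_into_rtrancl)
  have aR: "k \<in> R" if "i \<in> R" "a (Some i) (Some k) \<noteq> 0" for i k
  proof -
    have "(Some k, Some i) \<in> Ed" using wa that(2) unfolding weighted_adjacency_def by metis
    then show ?thesis using that(1) unfolding R_def by (metis mem_Collect_eq rtrancl.rtrancl_into_rtrancl)
  qed
  have HR: "k \<in> R" if "i \<in> R" "?H $ i $ k \<noteq> 0" for i k
    using that aR[of i k] by (cases "i = k") (auto simp: grounded_laplacian_def)
  have rowsum: "(\<Sum>k\<in>UNIV. ?H $ i $ k) = 0" if "i \<in> R" for i
    using grounded_laplacian_vec[OF wa, of "\<chi> k. 1" i] a0[OF that] by (simp add: matrix_vector_mult_def)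
  define L' where "L' Y = (\<chi> i. if i \<in> R then fst (?L Y) $ i else fst Y $ i, \<chi> i. if i \<in> R then snd (?L Y) $ i else snd Y $ i)" for Y
  have linL': "linear L'"
    by (rule linearI) (auto simp: L'_def vec_eq_iff linear_add[OF linear_mode_defect] linear_cmul[OF linear_mode_defect])
  have "surj L'"
    unfolding surj_def
  proof
    fix W :: "(complex^'n^'N) \<times> (complex^'z^'N)"
    obtain Y where Y: "?L Y = W" using surj by (metis surjD)
    define Y' where "Y' = (\<chi> i. if i \<in> R then fst Y $ i else fst W $ i, \<chi> i. if i \<in> R then snd Y $ i else snd W $ i)"
    have "fst (?L Y') $ i = fst W $ i" "snd (?L Y') $ i = snd W $ i" if "i \<in> R" for i
      using mode_defect_local[of a i Y' Y A B C G1 G2 Kx Kz \<mu> e1 e2 e3] HR[OF that] that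
      by (simp_all add: Y'_def flip: Y)
    then have "L' Y' = W"
      by (auto simp: L'_def prod_eq_iff vec_eq_iff[where 'b = 'N]) (auto simp: Y'_def)
    then show "\<exists>Y'. W = L' Y'" by metis
  qed
  then have inj: "inj L'" by (rule linear_surjective_imp_injective[OF linL']) simp
  have kernel: "x = 0 \<and> z' = 0" if eqx: "\<mu> *s x - map_matrix complex_of_real A *v x - map_matrix complex_of_real B *v (map_matrix complex_of_real Kz *v (e2 *s z')) = 0"
      and eqz: "map_matrix complex_of_real G1 *v z' = \<mu> *s z'" for x z'
  proof -
    define Y where "Y = (\<chi> i. if i \<in> R then x else 0, \<chi> i. if i \<in> R then z' else 0)"
    have sum0: "(\<Sum>k\<in>UNIV. ?H $ i $ k *\<^sub>R fst Y $ k) = 0" if "i \<in> R" for i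
    proof -
      have "(\<Sum>k\<in>UNIV. ?H $ i $ k *\<^sub>R fst Y $ k) = (\<Sum>k\<in>UNIV. ?H $ i $ k *\<^sub>R x)"
        using HR[OF that] by (intro sum.cong) (auto simp: Y_def)
      also have "\<dots> = 0" by (simp add: rowsum[OF that] flip: scaleR_sum_left)
      finally show ?thesis .
    qed
    have "L' Y = 0"
    proof -
      have "fst (?L Y) $ i = 0" "snd (?L Y) $ i = 0" if "i \<in> R" for i
        using that eqx eqz by (simp_all add: mode_defect_def sum0) (simp_all add: Y_def)
      then show ?thesis by (auto simp: L'_def prod_eq_iff vec_eq_iff[where 'b = 'N]) (auto simp: Y_def)
    qed
    then have "Y = 0" using linear_injective_0[OF linL'] inj by blast
    moreover have "i0 \<in> R" using unreach by (simp add: R_def)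
    ultimately have "fst Y $ i0 = 0" "snd Y $ i0 = 0" by simp_all
    then show ?thesis using \<open>i0 \<in> R\<close> by (simp add: Y_def)
  qed
  let ?X = "mat \<mu> - map_matrix complex_of_real A"
  have X: "?X *v x = \<mu> *s x - map_matrix complex_of_real A *v x" for x
    by (simp add: matrix_vector_mult_diff_rdistrib mat_scalar_vec)
  have "\<forall>x. ?X *v x = 0 \<longrightarrow> x = 0"
    using kernel[of _ 0] unfolding X by simp
  then obtain Z where "Z ** ?X = mat 1" using matrix_left_invertible_ker by blast
  then have "?X ** Z = mat 1" by (simp add: matrix_left_right_inverse)
  define x where "x = Z *v (map_matrix complex_of_real B *v (map_matrix complex_of_real Kz *v (e2 *s z)))"
  have "?X *v x = map_matrix complex_of_real B *v (map_matrix complex_of_real Kz *v (e2 *s z))"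
    unfolding x_def matrix_vector_mul_assoc[of ?X] \<open>?X ** Z = mat 1\<close> by simp
  then show False using kernel[of x z] z unfolding X by simp
qed

text \<open>
  Applied to \<open>Re\<close> and \<open>Im\<close>; real linearity of \<open>f\<close> suffices to commute with real matrices.
\<close>

definition real_trace :: "(complex \<Rightarrow> real) \<Rightarrow> complex^'n \<Rightarrow> real^'n" where
  "real_trace f w = (\<chi> k. f (w $ k))"

lemma linear_real_trace: "linear f \<Longrightarrow> linear (real_trace f)"
  by (simp add: linear_iff real_trace_def vec_eq_iff)

lemma real_trace_mult:
  assumes f: "linear f"
  shows "real_trace f (map_matrix complex_of_real M *v w) = M *v real_trace f w"
proof -
  have "f (\<Sum>k\<in>UNIV. complex_of_real (M $ i $ k) * w $ k) = (\<Sum>k\<in>UNIV. M $ i $ k * f (w $ k))" for i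
    using linear_cmul[OF f] by (simp add: linear_sum[OF f] flip: scaleR_conv_of_real)
  then show ?thesis by (simp add: real_trace_def vec_eq_iff matrix_vector_mult_def)
qed

lemma real_trace_exp_derivative:
  assumes f: "linear f"
  shows "((\<lambda>t. real_trace f (exp (\<mu> * of_real t) *s y)) has_vector_derivative
     real_trace f (exp (\<mu> * of_real t) *s (\<mu> *s y))) (at t within U)"
proof -
  have "((\<lambda>x. exp (\<mu> * x)) has_field_derivative exp (\<mu> * of_real t) * \<mu>) (at (of_real t))"
    by (auto intro!: derivative_eq_intros)
  from has_vector_derivative_real_field[OF this, of U]
  have dE: "((\<lambda>t. exp (\<mu> * of_real t)) has_vector_derivative exp (\<mu> * of_real t) * \<mu>) (at t within U)" .
  have "linear (\<lambda>c::complex. real_trace f (c *s y))"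
    by (rule linear_compose[OF _ linear_real_trace[OF f], unfolded o_def])
       (simp add: linear_iff vec_eq_iff distrib_right)
  from linear_has_vector_derivative[OF this dE] show ?thesis by (simp only: vector_smult_assoc)
qed

lemma mode_trajectory:
  fixes f :: "complex \<Rightarrow> real" and Ei :: "real^'q^'n^'N" and F :: "real^'q^'p" and S :: "real^'q^'q"
    and Ci :: "real^'n^'p^'N::finite" and G1 :: "real^'z^'z"
  assumes wa: "weighted_adjacency Ed a" and f: "linear f"
    and identical: "\<And>i. Ai $ i = A" "\<And>i. Bi $ i = B" "\<And>i. Ci $ i = C"
    and Y: "mode_defect a A B C G1 G2 Kx Kz \<mu> (exp (- \<mu> * of_real (\<tau>com + \<tau>con))) (exp (- \<mu> * of_real \<tau>con)) (exp (- \<mu> * of_real \<tau>com)) Y = 0"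
  shows "closed_loop (Ai, Bi, Ei, Ci) S F Ed a \<tau>com \<tau>con G1 G2 Kx Kz
      (\<lambda>t. \<chi> i. real_trace f (exp (\<mu> * of_real t) *s (fst Y $ i))) (\<lambda>t. \<chi> i. real_trace f (exp (\<mu> * of_real t) *s (snd Y $ i))) (\<lambda>_. 0)"
proof -
  let ?H = "grounded_laplacian a"
  define E where "E t = exp (\<mu> * of_real t)" for t :: real
  have E: "E t *s (exp (- \<mu> * of_real s) *s w) = E (t - s) *s w" for t s and w :: "complex^'n"
    by (simp add: E_def vector_smult_assoc algebra_simps flip: exp_add)
  have Ez: "E t *s (exp (- \<mu> * of_real s) *s w) = E (t - s) *s w" for t s and w :: "complex^'z"
    by (simp add: E_def vector_smult_assoc algebra_simps flip: exp_add)
  define xt where "xt t = (\<chi> i. real_trace f (E t *s (fst Y $ i)))" for t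
  define zt where "zt t = (\<chi> i. real_trace f (E t *s (snd Y $ i)))" for t
  have hsum: "real_trace f (c *s (\<Sum>k\<in>UNIV. ?H $ i $ k *\<^sub>R (fst Y $ k))) = (\<Sum>k\<in>UNIV. ?H $ i $ k *\<^sub>R real_trace f (c *s (fst Y $ k)))" for c i
  proof -
    have "c *s (\<Sum>k\<in>UNIV. ?H $ i $ k *\<^sub>R (fst Y $ k)) = (\<Sum>k\<in>UNIV. ?H $ i $ k *\<^sub>R (c *s (fst Y $ k)))"
      by (simp add: vec_eq_iff sum_component sum_distrib_left)
    then show ?thesis by (simp add: linear_sum[OF linear_real_trace[OF f]] linear_cmul[OF linear_real_trace[OF f]])
  qed
  have ctrl: "control Ed a \<tau>com Kx Kz xt zt i (t - \<tau>con) =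
      Kx *v real_trace f (E (t - (\<tau>com + \<tau>con)) *s (\<Sum>k\<in>UNIV. ?H $ i $ k *\<^sub>R (fst Y $ k))) + Kz *v real_trace f (E (t - \<tau>con) *s (snd Y $ i))" for t i
    unfolding hsum control_def relative_state_def relative_sum_laplacian[OF wa]
    by (simp add: xt_def zt_def algebra_simps)
  have verr: "virtual_error Ed a Ci F xt (\<lambda>_. 0) i (t - \<tau>com) =
      C *v real_trace f (E (t - \<tau>com) *s (\<Sum>k\<in>UNIV. ?H $ i $ k *\<^sub>R (fst Y $ k)))" for t i
    unfolding hsum virtual_error_def relative_sum_laplacian[OF wa]
    by (simp add: xt_def node_output_def identical linear_sum[OF matrix_vector_mul_linear] linear_cmul[OF matrix_vector_mul_linear])
  have eqx: "\<mu> *s (fst Y $ i) = map_matrix complex_of_real A *v (fst Y $ i) + map_matrix complex_of_real B *v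
       (map_matrix complex_of_real Kx *v (exp (- \<mu> * of_real (\<tau>com + \<tau>con)) *s (\<Sum>k\<in>UNIV. ?H $ i $ k *\<^sub>R (fst Y $ k)))
              + map_matrix complex_of_real Kz *v (exp (- \<mu> * of_real \<tau>con) *s (snd Y $ i)))" for i
    using arg_cong[OF Y, of "\<lambda>y. fst y $ i"] unfolding mode_defect_def by (simp add: algebra_simps)
  have eqz: "\<mu> *s (snd Y $ i) = map_matrix complex_of_real G1 *v (snd Y $ i)
          + map_matrix complex_of_real G2 *v (exp (- \<mu> * of_real \<tau>com) *s (map_matrix complex_of_real C *v (\<Sum>k\<in>UNIV. ?H $ i $ k *\<^sub>R (fst Y $ k))))" for i
    using arg_cong[OF Y, of "\<lambda>y. snd y $ i"] unfolding mode_defect_def by (simp add: algebra_simps)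
  have rhsx: "real_trace f (E t *s (\<mu> *s (fst Y $ i))) = A *v (xt t $ i) + B *v control Ed a \<tau>com Kx Kz xt zt i (t - \<tau>con)" for t i
    unfolding eqx ctrl vector_add_ldistrib vector_scalar_commute[symmetric] E Ez linear_add[OF linear_real_trace[OF f]] real_trace_mult[OF f]
    by (simp add: xt_def)
  have rhsz: "real_trace f (E t *s (\<mu> *s (snd Y $ i))) = G1 *v (zt t $ i) + G2 *v virtual_error Ed a Ci F xt (\<lambda>_. 0) i (t - \<tau>com)" for t i
    unfolding eqz verr vector_add_ldistrib vector_scalar_commute[symmetric] E linear_add[OF linear_real_trace[OF f]] real_trace_mult[OF f]
    by (simp add: zt_def)
  have dx: "((\<lambda>s. xt s $ i) has_vector_derivative real_trace f (E t *s (\<mu> *s (fst Y $ i)))) (at t within U)" for i t U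
    unfolding xt_def E_def vec_lambda_beta by (rule real_trace_exp_derivative[OF f])
  have dz: "((\<lambda>s. zt s $ i) has_vector_derivative real_trace f (E t *s (\<mu> *s (snd Y $ i)))) (at t within U)" for i t U
    unfolding zt_def E_def vec_lambda_beta by (rule real_trace_exp_derivative[OF f])
  have cx: "continuous_on U (\<lambda>s. xt s $ i)" for U i
    using dx by (meson continuous_on_eq_continuous_within has_vector_derivative_continuous)
  have cz: "continuous_on U (\<lambda>s. zt s $ i)" for U i
    using dz by (meson continuous_on_eq_continuous_within has_vector_derivative_continuous)
  have "continuous_on U (\<lambda>s. \<chi> i. xt s $ i)" "continuous_on U (\<lambda>s. \<chi> i. zt s $ i)" for U
    by (intro continuous_on_vec_lambda cx cz)+
  then have cont: "continuous_on U xt" "continuous_on U zt" for U by simp_all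
  have "closed_loop (Ai, Bi, Ei, Ci) S F Ed a \<tau>com \<tau>con G1 G2 Kx Kz xt zt (\<lambda>_. 0)"
    unfolding closed_loop_def prod.case
  proof (intro conjI allI impI cont)
    show "((\<lambda>_. 0) has_vector_derivative S *v 0) (at t)" for t by simp
    fix i and t :: real
    show "((\<lambda>s. xt s $ i) has_vector_derivative Ai $ i *v xt t $ i + Bi $ i *v control Ed a \<tau>com Kx Kz xt zt i (t - \<tau>con) + Ei $ i *v 0) (at t within {0..})"
      using dx[of i t] unfolding rhsx identical by simp
    show "((\<lambda>s. zt s $ i) has_vector_derivative G1 *v zt t $ i + G2 *v virtual_error Ed a Ci F xt (\<lambda>_. 0) i (t - \<tau>com)) (at t within {0..})"
      using dz[of i t] unfolding rhsz .
  qed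
  then show ?thesis unfolding xt_def[abs_def] zt_def[abs_def] E_def .
qed

text \<open>
  The real and the imaginary part of the undamped mode are trajectories, so stability would make both tend to zero;
  but the sum of their squares is constant in time in every component.
\<close>

lemma stable_imp_spanning_tree:
  fixes G1 :: "real^('p::finite \<times> 's::finite)^('p \<times> 's)" and G2 :: "real^'p^('p \<times> 's)" and S :: "real^'q^'q"
    and Ed :: "('N::finite option \<times> 'N option) set"
  assumes root: "\<And>j. (j, None) \<notin> Ed" and wa: "weighted_adjacency Ed a"
    and identical: "\<And>i. Ai $ i = A" "\<And>i. Bi $ i = B" "\<And>i. Ci $ i = C"
    and S: "\<And>\<mu>. \<mu> \<in> eigenvalues S \<Longrightarrow> Re \<mu> = 0"
    and im: "minimal_p_copy_internal_model S G1 G2"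
    and stable: "exponentially_stable (Ai, Bi, Ei, Ci) S F Ed a \<tau>com \<tau>con G1 G2 Kx Kz"
  shows "contains_directed_spanning_tree Ed None"
proof (rule ccontr)
  assume "\<not> ?thesis"
  then obtain v where v: "(None, v) \<notin> Ed\<^sup>*" using spanning_tree_iff_reachable[OF root] by blast
  then obtain i0 where i0: "(None, Some i0) \<notin> Ed\<^sup>*" by (cases v) auto
  obtain \<beta> :: "real^'s^'s" where G1: "G1 = copies \<beta>" and min: "is_minimal_polynomial S (char_polynomial \<beta>)"
    using im unfolding minimal_p_copy_internal_model_def by blast
  have "\<exists>a b. \<exists>u\<in>UNIV. \<exists>v\<in>UNIV. eigenpair (mv G1) a b u v"
    by (rule exists_eigenpair[OF matrix_vector_mul_linear subspace_UNIV, of _ "axis undefined 1"]) simp_all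
  then obtain p q u w where e: "eigenpair (mv G1) p q u w" by blast
  define \<mu> where "\<mu> = Complex p q"
  have re: "Re \<mu> = 0" unfolding \<mu>_def by (rule S[OF internal_model_spectrum(1)[OF min e[unfolded G1]]])
  obtain z where z: "map_matrix complex_of_real G1 *v z = \<mu> *s z" "z \<noteq> 0"
    using eigenpair_imp_eigenvalue[OF e] unfolding eigenvalues_def \<mu>_def by blast
  obtain Y where Y: "Y \<noteq> 0" and Y0: "mode_defect a A B C G1 G2 Kx Kz \<mu> (exp (- \<mu> * of_real (\<tau>com + \<tau>con))) (exp (- \<mu> * of_real \<tau>con)) (exp (- \<mu> * of_real \<tau>com)) Y = 0"
    using critical_mode[OF wa i0 z] by blast
  obtain \<kappa> \<alpha> where \<alpha>: "\<alpha> > 0" and st: "\<And>x z t. closed_loop (Ai, Bi, Ei, Ci) S F Ed a \<tau>com \<tau>con G1 G2 Kx Kz x z (\<lambda>_. 0) \<Longrightarrow> t \<ge> 0 \<Longrightarrow>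
       norm (x t, z t) \<le> \<kappa> * exp (- \<alpha> * t) * (SUP s\<in>{- (\<tau>com + \<tau>con)..0}. norm (x s, z s))"
    using stable unfolding exponentially_stable_def by blast
  have lim: "((\<lambda>t. f (exp (\<mu> * of_real t) * y)) \<longlongrightarrow> 0) at_top"
    if f: "linear f" and y: "(\<exists>i k. y = fst Y $ i $ k) \<or> (\<exists>i k. y = snd Y $ i $ k)" for f :: "complex \<Rightarrow> real" and y
  proof -
    define xt where "xt t = (\<chi> i. real_trace f (exp (\<mu> * of_real t) *s (fst Y $ i)))" for t :: real
    define zt where "zt t = (\<chi> i. real_trace f (exp (\<mu> * of_real t) *s (snd Y $ i)))" for t :: real
    define M where "M = \<kappa> * (SUP s\<in>{- (\<tau>com + \<tau>con)..0}. norm (xt s, zt s))"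
    have cl: "closed_loop (Ai, Bi, Ei, Ci) S F Ed a \<tau>com \<tau>con G1 G2 Kx Kz xt zt (\<lambda>_. 0)"
      unfolding xt_def[abs_def] zt_def[abs_def] by (rule mode_trajectory[OF wa f identical Y0])
    have bd: "norm (xt t, zt t) \<le> M * exp (- \<alpha> * t)" if "t \<ge> 0" for t
      using st[OF cl that] by (simp add: M_def mult_ac)
    have le: "\<bar>f (exp (\<mu> * of_real t) * y)\<bar> \<le> norm (xt t, zt t)" for t
    proof -
      have "\<bar>xt t $ i $ k\<bar> \<le> norm (xt t, zt t)" for i k
      proof -
        have "\<bar>xt t $ i $ k\<bar> \<le> norm (xt t $ i)" by (rule component_le_norm_cart)
        also have "\<dots> \<le> norm (xt t)" by (rule Finite_Cartesian_Product.norm_nth_le)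
        also have "\<dots> \<le> norm (xt t, zt t)" by (metis fst_conv norm_fst_le)
        finally show ?thesis .
      qed
      moreover have "\<bar>zt t $ i $ k\<bar> \<le> norm (xt t, zt t)" for i k
      proof -
        have "\<bar>zt t $ i $ k\<bar> \<le> norm (zt t $ i)" by (rule component_le_norm_cart)
        also have "\<dots> \<le> norm (zt t)" by (rule Finite_Cartesian_Product.norm_nth_le)
        also have "\<dots> \<le> norm (xt t, zt t)" by (metis snd_conv norm_snd_le)
        finally show ?thesis .
      qed
      ultimately show ?thesis using y by (auto simp: xt_def zt_def real_trace_def)
    qed
    have "((\<lambda>t. M * exp (- \<alpha> * t)) \<longlongrightarrow> M * 0) at_top"
    proof (intro tendsto_intros filterlim_compose[OF exp_at_bot])
      show "filterlim (\<lambda>t. - \<alpha> * t) at_bot at_top"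
        using \<alpha> by (simp add: filterlim_uminus_at_bot filterlim_tendsto_pos_mult_at_top[OF tendsto_const _ filterlim_ident])
    qed
    then have l0: "((\<lambda>t. M * exp (- \<alpha> * t)) \<longlongrightarrow> 0) at_top" by simp
    show ?thesis
    proof (rule Lim_null_comparison[OF _ l0])
      show "\<forall>\<^sub>F t in at_top. norm (f (exp (\<mu> * of_real t) * y)) \<le> M * exp (- \<alpha> * t)"
        using eventually_ge_at_top[of 0]
      proof eventually_elim
        case (elim t)
        from order_trans[OF le bd[OF elim]] show ?case by simp
      qed
    qed
  qed
  have zero: "y = 0" if y: "(\<exists>i k. y = fst Y $ i $ k) \<or> (\<exists>i k. y = snd Y $ i $ k)" for y
  proof -
    have linRe: "linear Re" "linear Im" by (simp_all add: linear_iff)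
    have "((\<lambda>t. (Re (exp (\<mu> * of_real t) * y))\<^sup>2 + (Im (exp (\<mu> * of_real t) * y))\<^sup>2) \<longlongrightarrow> 0\<^sup>2 + 0\<^sup>2) at_top"
      by (intro tendsto_intros lim linRe y)
    moreover have "(Re (exp (\<mu> * of_real t) * y))\<^sup>2 + (Im (exp (\<mu> * of_real t) * y))\<^sup>2 = (norm y)\<^sup>2" for t :: real
    proof -
      have "norm (exp (\<mu> * of_real t) * y) = norm y" by (simp add: norm_mult re)
      then show ?thesis by (simp only: cmod_power2[symmetric])
    qed
    ultimately have "((\<lambda>t::real. (norm y)\<^sup>2) \<longlongrightarrow> 0) at_top" by simp
    then show ?thesis using tendsto_unique[OF trivial_limit_at_top_linorder _ tendsto_const[of "(norm y)\<^sup>2"]] by fastforce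
  qed
  have "fst Y $ i $ k = 0" for i k by (rule zero) blast
  moreover have "snd Y $ i $ k = 0" for i k by (rule zero) blast
  ultimately have "fst Y = 0" "snd Y = 0" unfolding vec_eq_iff zero_index by blast+
  with Y show False by (simp add: prod_eq_iff)
qed

section \<open>Predictor feedback over the network\<close>

lemma bounded_bilinear_rep_endo: "bounded_bilinear (\<lambda>A w. blinfun_apply (rep_endo A) w)"
proof
  show "\<exists>K. \<forall>a b. norm (blinfun_apply (rep_endo a) b) \<le> norm a * norm b * K"
    by (intro exI[of _ 1]) (simp add: norm_endo.rep_eq norm_blinfun)
qed (simp_all add: plus_endo.rep_eq scaleR_endo.rep_eq blinfun.bilinear_simps)

lemma flow_bound:
  assumes "\<tau> \<ge> 0"
  shows "\<exists>m>0. \<forall>s\<in>{0..\<tau>}. \<forall>x. norm (flow M s x) \<le> m * norm x"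
proof (intro exI conjI ballI allI)
  let ?X = "endo (Blinfun M)"
  show "exp (\<tau> * norm ?X) > 0" by simp
  fix s x assume s: "s \<in> {0..\<tau>}"
  have "norm (flow M s x) \<le> norm (exp (s *\<^sub>R ?X)) * norm x"
    unfolding flow_def norm_endo.rep_eq by (rule norm_blinfun)
  also have "norm (exp (s *\<^sub>R ?X)) \<le> exp (norm (s *\<^sub>R ?X))" by (rule norm_exp)
  also have "exp (norm (s *\<^sub>R ?X)) \<le> exp (\<tau> * norm ?X)" using s by (simp add: mult_right_mono)
  finally show "norm (flow M s x) \<le> exp (\<tau> * norm ?X) * norm x" by (simp add: mult_right_mono)
qed

text \<open>
  Integrate the derivative of \<open>flow M (b - s) (x s)\<close>.
\<close>

lemma variation_of_constants:
  assumes M: "linear M" and "a \<le> b"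
    and x: "\<And>s. s \<in> {a..b} \<Longrightarrow> (x has_vector_derivative M (x s) + f s) (at s within {a..b})"
  shows "((\<lambda>s. flow M (b - s) (f s)) has_integral (x b - flow M (b - a) (x a))) {a..b}"
proof -
  let ?X = "endo (Blinfun M)"
  have "((\<lambda>s. flow M (b - s) (f s)) has_integral (flow M (b - b) (x b) - flow M (b - a) (x a))) {a..b}"
  proof (rule fundamental_theorem_of_calculus[OF \<open>a \<le> b\<close>])
    fix s assume s: "s \<in> {a..b}"
    have "((\<lambda>s. b - s) has_vector_derivative - 1) (at s within {a..b})"
      by (auto intro!: derivative_eq_intros)
    from vector_diff_chain_within[OF this has_vector_derivative_at_within[OF exp_scaleR_has_vector_derivative_left]]
    have d: "((\<lambda>s. exp ((b - s) *\<^sub>R ?X)) has_vector_derivative - (?X * exp ((b - s) *\<^sub>R ?X))) (at s within {a..b})"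
      by (simp add: o_def)
    have "((\<lambda>s. flow M (b - s) (x s)) has_vector_derivative
        flow M (b - s) (M (x s) + f s) + blinfun_apply (rep_endo (- (?X * exp ((b - s) *\<^sub>R ?X)))) (x s)) (at s within {a..b})"
      using bounded_bilinear.has_vector_derivative[OF bounded_bilinear_rep_endo d x[OF s]] unfolding flow_def .
    moreover have "blinfun_apply (rep_endo (- (?X * exp ((b - s) *\<^sub>R ?X)))) (x s) = - M (flow M (b - s) (x s))"
      by (simp add: uminus_endo.rep_eq times_endo.rep_eq rep_endo_Blinfun[OF M] flow_def blinfun.bilinear_simps)
    ultimately show "((\<lambda>s. flow M (b - s) (x s)) has_vector_derivative flow M (b - s) (f s)) (at s within {a..b})"
      by (simp add: linear_add flow_commute[OF M])
  qed
  then show ?thesis by simp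
qed

lemma variation_bound:
  assumes M: "linear M" and "a \<le> b"
    and x: "\<And>s. s \<in> {a..b} \<Longrightarrow> (x has_vector_derivative M (x s) + f s) (at s within {a..b})"
    and m: "\<And>s y. s \<in> {0..b - a} \<Longrightarrow> norm (flow M s y) \<le> m * norm y"
    and g: "g integrable_on {a..b}" "\<And>s. s \<in> {a..b} \<Longrightarrow> m * norm (f s) \<le> g s"
  shows "norm (x b - flow M (b - a) (x a)) \<le> integral {a..b} g"
proof -
  note hi = variation_of_constants[OF M \<open>a \<le> b\<close> x]
  have "norm (integral {a..b} (\<lambda>s. flow M (b - s) (f s))) \<le> integral {a..b} g"
  proof (rule integral_norm_bound_integral[OF _ g(1)])
    show "(\<lambda>s. flow M (b - s) (f s)) integrable_on {a..b}" using hi by (rule has_integral_integrable)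
    show "norm (flow M (b - s) (f s)) \<le> g s" if "s \<in> {a..b}" for s
      using m[of "b - s" "f s"] g(2)[OF that] that by simp
  qed
  then show ?thesis using integral_unique[OF hi] by simp
qed

lemma norm_vec_sq: "(norm (X :: 'a::real_inner^'n))\<^sup>2 = (\<Sum>i\<in>UNIV. (norm (X $ i))\<^sup>2)"
  by (simp add: norm_vec_def L2_set_def sum_nonneg)

lemma norm_vec_le:
  fixes X :: "'a::real_inner^'n" and Z :: "'b::real_inner^'n"
  assumes "c \<ge> 0" "\<And>i. norm (X $ i) \<le> c * norm (Z $ i)"
  shows "norm X \<le> c * norm Z"
proof -
  have "L2_set (\<lambda>i. norm (X $ i)) UNIV \<le> L2_set (\<lambda>i. c * norm (Z $ i)) UNIV"
    by (rule L2_set_mono) (use assms in auto)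
  also have "\<dots> = c * L2_set (\<lambda>i. norm (Z $ i)) UNIV"
    by (rule L2_set_right_distrib[OF assms(1), symmetric])
  finally show ?thesis by (simp add: norm_vec_def)
qed

lemma norm_vec_le_sum: "norm (X :: 'a::real_normed_vector^'n) \<le> (\<Sum>i\<in>UNIV. norm (X $ i))"
  unfolding norm_vec_def by (rule L2_set_le_sum) simp

lemma has_vector_derivative_vec:
  fixes X :: "real \<Rightarrow> 'a::euclidean_space^'n"
  assumes "\<And>i. ((\<lambda>s. X s $ i) has_vector_derivative D $ i) F"
  shows "(X has_vector_derivative D) F"
proof -
  define J where "J i x = (\<chi> j. if j = i then x else 0)" for i :: 'n and x :: 'a
  have J: "linear (J i)" for i by (simp add: J_def linear_iff vec_eq_iff)
  have sum: "(\<Sum>i\<in>UNIV. J i (Z $ i)) = Z" for Z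
    by (simp add: J_def vec_eq_iff sum_component)
  have "((\<lambda>s. \<Sum>i\<in>UNIV. J i (X s $ i)) has_vector_derivative (\<Sum>i\<in>UNIV. J i (D $ i))) F"
    by (intro has_vector_derivative_sum linear_has_vector_derivative[OF J] assms)
  then show ?thesis by (simp add: sum)
qed

text \<open>
  Coordinate by coordinate in an orthonormal basis.
\<close>

lemma lyapunov_inner:
  fixes y :: "'N::finite \<Rightarrow> 'b::euclidean_space"
  assumes "\<And>y :: 'N \<Rightarrow> real. c * (\<Sum>i\<in>UNIV. (y i)\<^sup>2) \<le> (\<Sum>i\<in>UNIV. \<Sum>j\<in>UNIV. d i * H $ i $ j * y i * y j)"
  shows "c * (\<Sum>i\<in>UNIV. (norm (y i))\<^sup>2) \<le> (\<Sum>i\<in>UNIV. \<Sum>j\<in>UNIV. d i * H $ i $ j * (y i \<bullet> y j))"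
proof -
  have nrm: "(norm (y i))\<^sup>2 = (\<Sum>b\<in>Basis. (y i \<bullet> b)\<^sup>2)" for i
  proof -
    have "(norm (y i))\<^sup>2 = y i \<bullet> y i" by (rule power2_norm_eq_inner)
    also have "\<dots> = (\<Sum>b\<in>Basis. (y i \<bullet> b)\<^sup>2)"
      using euclidean_inner[of "y i" "y i"] by (simp only: power2_eq_square)
    finally show ?thesis .
  qed
  have "c * (\<Sum>i\<in>UNIV. (norm (y i))\<^sup>2) = (\<Sum>i\<in>UNIV. \<Sum>b\<in>Basis. c * (y i \<bullet> b)\<^sup>2)"
    by (simp only: nrm sum_distrib_left)
  also have "\<dots> = (\<Sum>b\<in>Basis. \<Sum>i\<in>UNIV. c * (y i \<bullet> b)\<^sup>2)" by (rule sum.swap)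
  also have "\<dots> = (\<Sum>b\<in>Basis. c * (\<Sum>i\<in>UNIV. (y i \<bullet> b)\<^sup>2))"
    by (simp only: sum_distrib_left)
  also have "\<dots> \<le> (\<Sum>b\<in>Basis. \<Sum>i\<in>UNIV. \<Sum>j\<in>UNIV. d i * H $ i $ j * (y i \<bullet> b) * (y j \<bullet> b))"
    by (rule sum_mono) (rule assms)
  also have "\<dots> = (\<Sum>i\<in>UNIV. \<Sum>b\<in>Basis. \<Sum>j\<in>UNIV. d i * H $ i $ j * (y i \<bullet> b) * (y j \<bullet> b))"
    by (rule sum.swap)
  also have "\<dots> = (\<Sum>i\<in>UNIV. \<Sum>j\<in>UNIV. \<Sum>b\<in>Basis. d i * H $ i $ j * (y i \<bullet> b) * (y j \<bullet> b))"
    by (intro sum.cong refl) (rule sum.swap)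
  also have "\<dots> = (\<Sum>i\<in>UNIV. \<Sum>j\<in>UNIV. d i * H $ i $ j * (y i \<bullet> y j))"
    by (simp add: euclidean_inner[of "y _" "y _"] sum_distrib_left mult.assoc)
  finally show ?thesis .
qed

text \<open>
  Exponential decay of the network of systems \<open>(Y, B)\<close> with the delayed and coupled feedback \<open>K\<close>, uniformly over all
  relative perturbations \<open>\<Delta>\<close> of size \<open>\<eta>\<close>. Uncertain plants are covered by this because their deviation from the
  nominal plant is such a \<open>\<Delta>\<close>.
\<close>

definition network_decays :: "real^'N^'N \<Rightarrow> real \<Rightarrow> ('a::euclidean_space \<Rightarrow> 'a) \<Rightarrow> ('b::euclidean_space \<Rightarrow> 'a) \<Rightarrow> ('a \<Rightarrow> 'b)
    \<Rightarrow> real \<Rightarrow> real \<Rightarrow> real \<Rightarrow> bool" where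
  "network_decays H \<tau> Y B K \<eta> \<kappa> \<alpha> \<longleftrightarrow> (\<forall>X U \<Delta> M0.
     continuous_on {-\<tau>..} X \<longrightarrow> continuous_on {0..} \<Delta> \<longrightarrow>
     (\<forall>t\<ge>0. U t = (\<chi> i. \<Sum>j\<in>UNIV. H $ i $ j *\<^sub>R K (X (t - \<tau>) $ j))) \<longrightarrow>
     (\<forall>t\<ge>0. \<forall>i. ((\<lambda>s. X s $ i) has_vector_derivative Y (X t $ i) + B (U t $ i) + \<Delta> t $ i) (at t within {0..})) \<longrightarrow>
     (\<forall>t\<ge>0. norm (\<Delta> t) \<le> \<eta> * (norm (X t) + norm (U t))) \<longrightarrow>
     (\<forall>s\<in>{-\<tau>..0}. norm (X s) \<le> M0) \<longrightarrow>
     (\<forall>t\<ge>0. norm (X t) \<le> \<kappa> * M0 * exp (- \<alpha> * t)))"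

text \<open>
  The network is a single system on the product space. With \<open>y\<^sub>i = B\<^sup>T P x\<^sub>i\<close> the Lyapunov operator \<open>D \<otimes> P\<close> and the
  feedback \<open>- \<mu> H y\<close> give \<open>d\<^sub>i |y\<^sub>i|\<^sup>2\<close> from the low-gain inequality and \<open>- 2 \<mu> c |y|\<^sup>2\<close> from the coupling; for large \<open>\<mu>\<close> their
  sum is at most \<open>- |y|\<^sup>2\<close>, so \<open>n = |y|\<close> provides a certificate. The constant \<open>\<mu>\<close>, hence \<open>c1\<close>, depends on \<open>H\<close>
  and \<open>D\<close> only, so the bound \<open>\<kappa>0\<close> on the gain is known before \<open>P\<close> is chosen small enough for it. The actual feedback applies
  the certified one to \<open>exp (\<tau> Y) X(t - \<tau>)\<close>, and by the variation of constants formula this differs from \<open>X t\<close> by an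
  integral of inputs and perturbations over the window.
\<close>

lemma network_decay:
  fixes Y :: "'a::euclidean_space \<Rightarrow> 'a" and B :: "'b::euclidean_space \<Rightarrow> 'a" and H :: "real^'N^'N"
  assumes Y: "linear Y" and B: "linear B" and \<tau>: "\<tau> \<ge> 0"
    and stab: "\<And>a b u v. eigenpair (adjoint Y) a b u v \<Longrightarrow> adjoint B u = 0 \<Longrightarrow> adjoint B v = 0 \<Longrightarrow> a < 0"
    and marginal: "\<And>a b u v. eigenpair (adjoint Y) a b u v \<Longrightarrow> a \<le> 0"
    and d: "\<And>i. d i > 0" and c: "c > 0"
    and lyap: "\<And>y :: 'N \<Rightarrow> real. c * (\<Sum>i\<in>UNIV. (y i)\<^sup>2) \<le> (\<Sum>i\<in>UNIV. \<Sum>j\<in>UNIV. d i * H $ i $ j * y i * y j)"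
  shows "\<exists>K. linear K \<and> (\<exists>\<eta>>0. \<exists>\<kappa>>0. \<exists>\<alpha>>0. network_decays H \<tau> Y B K \<eta> \<kappa> \<alpha>)"
proof -
  obtain b where b: "b > 0" "\<And>u. norm (B u) \<le> b * norm u" using linear_bounded_pos[OF B] by blast
  have B': "linear (adjoint B)" using B by (rule adjoint_linear)
  obtain b' where b': "b' > 0" "\<And>x. norm (adjoint B x) \<le> b' * norm x" using linear_bounded_pos[OF B'] by blast
  obtain m where m: "m > 0" "\<And>s x. s \<in> {0..\<tau>} \<Longrightarrow> norm (flow Y s x) \<le> m * norm x"
    using flow_bound[OF \<tau>, of Y] by blast
  \<comment> \<open>Bounds the prediction error in terms of the window integral of \<open>|U| + \<eta> |X|\<close>.\<close>
  define \<phi> where "\<phi> = real CARD('N) * (m * (b + 1))"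
  have \<phi>: "\<phi> > 0" using m b by (simp add: \<phi>_def)
  define dM where "dM = Max (range d)"
  define dm where "dm = Min (range d)"
  have dM: "d i \<le> dM" and dm: "dm \<le> d i" for i unfolding dM_def dm_def by simp_all
  have "dm \<in> range d" unfolding dm_def by (rule Min_in) auto
  then have dm0: "dm > 0" using d by auto
  have dM0: "dM > 0" using d dM by (meson less_le_trans)
  define h where "h = (\<Sum>i\<in>UNIV. \<Sum>j\<in>UNIV. \<bar>H $ i $ j\<bar>)"
  have h0: "h \<ge> 0" unfolding h_def by (intro sum_nonneg) auto
  \<comment> \<open>So that \<open>dM - 2 \<mu> c = - 1\<close>.\<close>
  define \<mu> where "\<mu> = (dM + 1) / (2 * c)"
  have \<mu>: "\<mu> > 0" "2 * \<mu> * c = dM + 1" using dM0 c by (simp_all add: \<mu>_def)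
  define c1 where "c1 = dM + \<mu> * h + 1"
  have c1: "c1 > 0" "dM \<le> c1" "\<mu> * h \<le> c1" using dM0 \<mu> h0 by (simp_all add: c1_def add_pos_nonneg)
  obtain \<kappa>0 where \<kappa>0: "\<kappa>0 > 0" and dl: "\<And>(P :: 'a^'N \<Rightarrow> 'a^'N) Y (B :: 'b^'N \<Rightarrow> 'a^'N) K n p l \<epsilon>.
      feedback_certificate c1 \<kappa>0 P Y B K n p l \<epsilon> \<Longrightarrow>
      \<exists>\<eta>>0. \<exists>\<kappa>>0. \<exists>\<alpha>>0. delayed_feedback_decay \<tau> \<phi> Y B K \<eta> \<kappa> \<alpha>"
    using delay_lyapunov[OF \<tau> \<phi> c1(1), where 'a = "'a^'N" and 'b = "'b^'N"] by blast
  \<comment> \<open>The bound on \<open>P\<close> that keeps the norm of the feedback below \<open>\<kappa>0\<close>.\<close>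
  define \<gamma> where "\<gamma> = \<kappa>0 / (c1 * b')"
  have \<gamma>: "\<gamma> > 0" "c1 * (b' * \<gamma>) = \<kappa>0" using \<kappa>0 c1 b' by (simp_all add: \<gamma>_def)
  have "\<exists>P \<epsilon> k. linear P \<and> (\<forall>x y. P x \<bullet> y = x \<bullet> P y) \<and> k > 0 \<and> (\<forall>x. P x \<bullet> x \<ge> k * (norm x)\<^sup>2) \<and>
     (\<forall>x. norm (P x) \<le> \<gamma> * norm x) \<and> \<epsilon> > 0 \<and>
     (\<forall>x. 2 * (P x \<bullet> Y x) \<le> (norm (adjoint B (P x)))\<^sup>2 - \<epsilon> * (norm x)\<^sup>2)"
    by (rule low_gain[OF Y B stab marginal \<gamma>(1)])
  then obtain P \<epsilon> k where P': "linear P \<and> (\<forall>x y. P x \<bullet> y = x \<bullet> P y) \<and> k > 0 \<and> (\<forall>x. P x \<bullet> x \<ge> k * (norm x)\<^sup>2) \<and>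
     (\<forall>x. norm (P x) \<le> \<gamma> * norm x) \<and> \<epsilon> > 0 \<and>
     (\<forall>x. 2 * (P x \<bullet> Y x) \<le> (norm (adjoint B (P x)))\<^sup>2 - \<epsilon> * (norm x)\<^sup>2)" by blast
  then have P: "linear P" "\<And>x y. P x \<bullet> y = x \<bullet> P y" "k > 0" "\<And>x. P x \<bullet> x \<ge> k * (norm x)\<^sup>2"
     "\<And>x. norm (P x) \<le> \<gamma> * norm x" "\<epsilon> > 0"
     "\<And>x. 2 * (P x \<bullet> Y x) \<le> (norm (adjoint B (P x)))\<^sup>2 - \<epsilon> * (norm x)\<^sup>2" by blast+
  let ?y = "\<lambda>x. adjoint B (P x)"
  have ylin: "linear ?y" using linear_compose[OF P(1) B'] by (simp add: o_def)
  define Ph where "Ph X = (\<chi> i. d i *\<^sub>R P (X $ i))" for X :: "'a^'N"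
  define Yh where "Yh X = (\<chi> i. Y (X $ i))" for X :: "'a^'N"
  define Bh where "Bh U = (\<chi> i. B (U $ i))" for U :: "'b^'N"
  define Kh where "Kh X = (\<chi> i. \<Sum>j\<in>UNIV. H $ i $ j *\<^sub>R (- \<mu> *\<^sub>R ?y (X $ j)))" for X :: "'a^'N"
  define n where "n X = norm (\<chi> i. ?y (X $ i))" for X :: "'a^'N"
  have linPh: "linear Ph" by (simp add: linear_iff Ph_def vec_eq_iff linear_add[OF P(1)] linear_cmul[OF P(1)] scaleR_right_distrib)
  have linYh: "linear Yh" by (simp add: linear_iff Yh_def vec_eq_iff linear_add[OF Y] linear_cmul[OF Y])
  have linBh: "linear Bh" by (simp add: linear_iff Bh_def vec_eq_iff linear_add[OF B] linear_cmul[OF B])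
  have linKh: "linear Kh"
  proof (rule linearI)
    fix X Z :: "'a^'N" and s :: real
    show "Kh (X + Z) = Kh X + Kh Z"
      unfolding Kh_def vec_eq_iff[where 'b = 'N]
      by (simp only: vec_lambda_beta vector_add_component linear_add[OF ylin] scaleR_right_distrib sum.distrib) simp
    show "Kh (s *\<^sub>R X) = s *\<^sub>R Kh X"
      unfolding Kh_def vec_eq_iff[where 'b = 'N]
      by (simp only: vec_lambda_beta vector_scaleR_component linear_cmul[OF ylin] scaleR_sum_right scaleR_left_commute[of _ s]) simp
  qed
  have n_le: "n X \<le> b' * \<gamma> * norm X" for X
    unfolding n_def
  proof (rule norm_vec_le)
    show "b' * \<gamma> \<ge> 0" using b' \<gamma> by simp
    show "norm ((\<chi> i. ?y (X $ i)) $ i) \<le> b' * \<gamma> * norm (X $ i)" for i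
      using order_trans[OF b'(2) mult_left_mono[OF P(5), of b']] b'(1) by (simp add: mult.assoc)
  qed
  have Kh_le: "norm (Kh X) \<le> c1 * n X" for X
  proof -
    have "norm (Kh X) \<le> (\<Sum>i\<in>UNIV. norm (Kh X $ i))" by (rule norm_vec_le_sum)
    also have "\<dots> \<le> (\<Sum>i\<in>UNIV. \<Sum>j\<in>UNIV. \<bar>H $ i $ j\<bar> * (\<mu> * n X))"
    proof (rule sum_mono)
      fix i
      have "norm (Kh X $ i) \<le> (\<Sum>j\<in>UNIV. norm (H $ i $ j *\<^sub>R (- \<mu> *\<^sub>R ?y (X $ j))))"
        unfolding Kh_def by (simp only: vec_lambda_beta norm_sum)
      also have "\<dots> \<le> (\<Sum>j\<in>UNIV. \<bar>H $ i $ j\<bar> * (\<mu> * n X))"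
      proof (rule sum_mono)
        fix j
        have "norm (?y (X $ j)) \<le> n X"
          using Finite_Cartesian_Product.norm_nth_le[of "\<chi> i. ?y (X $ i)" j] by (simp add: n_def)
        then have "\<bar>H $ i $ j\<bar> * (\<mu> * norm (?y (X $ j))) \<le> \<bar>H $ i $ j\<bar> * (\<mu> * n X)"
          using \<mu>(1) by (intro mult_left_mono) auto
        then show "norm (H $ i $ j *\<^sub>R (- \<mu> *\<^sub>R ?y (X $ j))) \<le> \<bar>H $ i $ j\<bar> * (\<mu> * n X)"
          using \<mu>(1) by (simp add: abs_mult mult.assoc)
      qed
      finally show "norm (Kh X $ i) \<le> (\<Sum>j\<in>UNIV. \<bar>H $ i $ j\<bar> * (\<mu> * n X))" .
    qed
    also have "\<dots> = (\<mu> * h) * n X" by (simp add: h_def sum_distrib_left sum_distrib_right mult_ac)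
    also have "\<dots> \<le> c1 * n X" using c1(3) by (intro mult_right_mono) (auto simp: n_def)
    finally show ?thesis .
  qed
  have Kh_small: "norm (Kh X) \<le> \<kappa>0 * norm X" for X
  proof -
    have "c1 * n X \<le> c1 * (b' * \<gamma> * norm X)" using n_le c1(1) by (intro mult_left_mono) auto
    also have "\<dots> = \<kappa>0 * norm X" by (simp add: \<gamma>(2)[symmetric] mult.assoc)
    finally show ?thesis using Kh_le[of X] by linarith
  qed
  have PB: "Ph X \<bullet> Bh U = (\<Sum>i\<in>UNIV. d i * (?y (X $ i) \<bullet> U $ i))" for X U
    by (simp add: inner_vec_def Ph_def Bh_def adjoint_clauses(2)[OF B])
  have cross: "Ph X \<bullet> Bh U \<le> c1 * n X * norm U" for X U
  proof -
    have "Ph X \<bullet> Bh U = (\<chi> i. d i *\<^sub>R ?y (X $ i)) \<bullet> U" unfolding PB by (simp add: inner_vec_def)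
    also have "\<dots> \<le> norm (\<chi> i. d i *\<^sub>R ?y (X $ i)) * norm U" by (rule norm_cauchy_schwarz)
    also have "\<dots> \<le> (dM * n X) * norm U"
      unfolding n_def
      by (intro mult_right_mono norm_vec_le) (use dM0 dM d in \<open>auto intro!: mult_right_mono simp: less_imp_le\<close>)
    also have "\<dots> \<le> c1 * n X * norm U"
      using c1(2) by (intro mult_right_mono) (auto simp: n_def)
    finally show ?thesis .
  qed
  have main: "2 * (Ph X \<bullet> (Yh X + Bh (Kh X))) \<le> - (dm * \<epsilon>) * (norm X)\<^sup>2 - (n X)\<^sup>2" for X
  proof -
    have n2: "(n X)\<^sup>2 = (\<Sum>i\<in>UNIV. (norm (?y (X $ i)))\<^sup>2)" unfolding n_def norm_vec_sq by simp
    have "2 * (Ph X \<bullet> Yh X) = (\<Sum>i\<in>UNIV. d i * (2 * (P (X $ i) \<bullet> Y (X $ i))))"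
      by (simp add: inner_vec_def Ph_def Yh_def sum_distrib_left mult_ac)
    also have "\<dots> \<le> (\<Sum>i\<in>UNIV. dM * (norm (?y (X $ i)))\<^sup>2 - dm * \<epsilon> * (norm (X $ i))\<^sup>2)"
    proof (rule sum_mono)
      fix i
      have "d i * (2 * (P (X $ i) \<bullet> Y (X $ i))) \<le> d i * ((norm (?y (X $ i)))\<^sup>2 - \<epsilon> * (norm (X $ i))\<^sup>2)"
        using P(7) d[of i] by (intro mult_left_mono) (auto simp: less_imp_le)
      also have "\<dots> = d i * (norm (?y (X $ i)))\<^sup>2 - d i * (\<epsilon> * (norm (X $ i))\<^sup>2)" by (simp add: right_diff_distrib)
      also have "\<dots> \<le> dM * (norm (?y (X $ i)))\<^sup>2 - dm * (\<epsilon> * (norm (X $ i))\<^sup>2)"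
        using dM dm P(6) by (intro diff_mono mult_right_mono) auto
      finally show "d i * (2 * (P (X $ i) \<bullet> Y (X $ i))) \<le> dM * (norm (?y (X $ i)))\<^sup>2 - dm * \<epsilon> * (norm (X $ i))\<^sup>2"
        by (simp add: mult.assoc)
    qed
    also have "\<dots> = dM * (n X)\<^sup>2 - dm * \<epsilon> * (norm X)\<^sup>2"
      unfolding n2 norm_vec_sq[of X] by (simp add: sum_subtractf sum_distrib_left)
    finally have 1: "2 * (Ph X \<bullet> Yh X) \<le> dM * (n X)\<^sup>2 - dm * \<epsilon> * (norm X)\<^sup>2" .
    have "Ph X \<bullet> Bh (Kh X) = - \<mu> * (\<Sum>i\<in>UNIV. \<Sum>j\<in>UNIV. d i * H $ i $ j * (?y (X $ i) \<bullet> ?y (X $ j)))"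
      unfolding PB Kh_def by (simp add: inner_sum_right sum_distrib_left mult_ac sum_negf)
    also have "\<dots> \<le> - \<mu> * (c * (n X)\<^sup>2)"
      unfolding n2 using lyapunov_inner[of c d H "\<lambda>i. ?y (X $ i)", OF lyap] \<mu>(1) by simp
    finally have "2 * (Ph X \<bullet> Bh (Kh X)) \<le> - (2 * \<mu> * c) * (n X)\<^sup>2" by simp
    with 1 show ?thesis unfolding \<mu>(2) by (simp add: inner_add_right algebra_simps)
  qed
  have "feedback_certificate c1 \<kappa>0 Ph Yh Bh Kh n (dM * \<gamma>) (dm * k) (dm * \<epsilon>)"
    unfolding feedback_certificate_def
  proof (intro conjI)
    show "\<forall>x y. Ph x \<bullet> y = x \<bullet> Ph y" by (simp add: inner_vec_def Ph_def P(2))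
    show "\<forall>x. dm * k * (norm x)\<^sup>2 \<le> Ph x \<bullet> x"
    proof
      fix x :: "'a^'N"
      have "dm * k * (norm x)\<^sup>2 = (\<Sum>i\<in>UNIV. dm * (k * (norm (x $ i))\<^sup>2))"
        by (simp add: norm_vec_sq sum_distrib_left mult.assoc)
      also have "\<dots> \<le> (\<Sum>i\<in>UNIV. d i * (P (x $ i) \<bullet> x $ i))"
        using dm P(3,4) d by (intro sum_mono mult_mono) (auto simp: less_imp_le)
      finally show "dm * k * (norm x)\<^sup>2 \<le> Ph x \<bullet> x" by (simp add: inner_vec_def Ph_def)
    qed
    show "\<forall>x. norm (Ph x) \<le> dM * \<gamma> * norm x"
    proof (intro allI norm_vec_le)
      show "dM * \<gamma> \<ge> 0" using dM0 \<gamma> by simp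
      show "norm (Ph x $ i) \<le> dM * \<gamma> * norm (x $ i)" for x i
        using mult_mono[OF dM[of i] P(5)[of "x $ i"]] d[of i] dM0 by (simp add: Ph_def mult.assoc)
    qed
    show "\<forall>x. 0 \<le> n x" by (simp add: n_def)
  qed (use linPh dm0 P dM0 \<gamma> linKh Kh_small linBh Kh_le cross main in simp_all)
  from dl[OF this] obtain \<eta> \<kappa> \<alpha> where \<eta>: "\<eta> > 0" and \<kappa>: "\<kappa> > 0" and \<alpha>: "\<alpha> > 0"
    and decay: "delayed_feedback_decay \<tau> \<phi> Yh Bh Kh \<eta> \<kappa> \<alpha>" by blast
  \<comment> \<open>The bound 1 keeps the constants of the crude estimates on \<open>[0, \<tau>]\<close> and over the window independent of \<open>\<eta>\<close>.\<close>
  define \<eta>2 where "\<eta>2 = min \<eta> 1"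
  have \<eta>2: "\<eta>2 > 0" "\<eta>2 \<le> \<eta>" "\<eta>2 \<le> 1" using \<eta> by (auto simp: \<eta>2_def)
  define K where "K x = - \<mu> *\<^sub>R ?y (flow Y \<tau> x)" for x
  have linK: "linear K"
    using linear_compose_scale_right[OF linear_compose[OF linear_flow ylin], of "- \<mu>" Y \<tau>] by (simp add: K_def[abs_def] o_def)
  obtain y0 where y0: "y0 > 0" "\<And>X. norm (Yh X) \<le> y0 * norm X" using linear_bounded_pos[OF linYh] by blast
  have Bh_le: "norm (Bh U) \<le> b * norm U" for U
    by (rule norm_vec_le) (use b in \<open>auto simp: Bh_def\<close>)
  define ku where "ku = \<kappa>0 * m"
  have ku: "ku > 0" using \<kappa>0 m by (simp add: ku_def)
  \<comment> \<open>Rate for the Gronwall inequality of \<open>|X|\<^sup>2 + M0\<^sup>2\<close> on \<open>[0, \<tau>]\<close>, where the inputs stem from the initial function.\<close>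
  define g where "g = 2 * (y0 + 1) + (b + 1) * ku"
  have g: "g > 0" using y0 b ku by (simp add: g_def add_pos_pos)
  define G where "G = sqrt (2 * exp (g * \<tau>))"
  have G: "G > 0" by (simp add: G_def)
  define \<kappa>' where "\<kappa>' = \<kappa> * (G + ku) + G * exp (\<alpha> * \<tau>)"
  have \<kappa>': "\<kappa>' > 0" using \<kappa> G ku by (simp add: \<kappa>'_def add_pos_pos)
  have core: "norm (X t) \<le> \<kappa>' * M0 * exp (- \<alpha> * t)"
    if cX: "continuous_on {-\<tau>..} X" and c\<Delta>: "continuous_on {0..} \<Delta>"
      and U: "\<forall>t\<ge>0. U t = (\<chi> i. \<Sum>j\<in>UNIV. H $ i $ j *\<^sub>R K (X (t - \<tau>) $ j))"
      and der: "\<forall>t\<ge>0. \<forall>i. ((\<lambda>s. X s $ i) has_vector_derivative Y (X t $ i) + B (U t $ i) + \<Delta> t $ i) (at t within {0..})"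
      and \<Delta>: "\<forall>t\<ge>0. norm (\<Delta> t) \<le> \<eta>2 * (norm (X t) + norm (U t))"
      and M0: "\<forall>s\<in>{-\<tau>..0}. norm (X s) \<le> M0" and t: "t \<ge> 0"
    for X U \<Delta> M0 and t :: real
  proof -
    define E where "E Z = (\<chi> j. flow Y \<tau> (Z $ j))" for Z :: "'a^'N"
    define r where "r t = X t - E (X (t - \<tau>))" for t
    have M00: "M0 \<ge> 0" using order_trans[OF norm_ge_zero M0[rule_format, of 0]] \<tau> by simp
    have linE: "linear E"
      by (rule linearI) (simp_all add: E_def vec_eq_iff linear_add[OF linear_flow] linear_cmul[OF linear_flow])
    have E_le: "norm (E Z) \<le> m * norm Z" for Z
      by (rule norm_vec_le) (use m \<tau> in \<open>auto simp: E_def\<close>)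
    have UE: "U t = Kh (E (X (t - \<tau>)))" if "t \<ge> 0" for t
      using U that by (simp add: Kh_def E_def K_def)
    have U_le: "norm (U t) \<le> ku * norm (X (t - \<tau>))" if "t \<ge> 0" for t
      using order_trans[OF Kh_small mult_left_mono[OF E_le]] \<kappa>0 unfolding UE[OF that] ku_def by (simp add: mult.assoc)
    have cX0: "continuous_on {0..} X" using cX by (rule continuous_on_subset) (use \<tau> in auto)
    have cU: "continuous_on {0..} U"
    proof -
      have "continuous_on {0..} (\<lambda>t. X (t - \<tau>))"
        by (rule continuous_on_compose2[OF cX]) (auto intro!: continuous_intros)
      then have "continuous_on {0..} (\<lambda>t. Kh (E (X (t - \<tau>))))"
        using linear_continuous_on_compose[OF _ linear_compose[OF linE linKh]] by (simp add: o_def)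
      then show ?thesis by (rule continuous_on_eq) (simp add: UE)
    qed
    have derX: "(X has_vector_derivative Yh (X t) + Bh (U t) + \<Delta> t) (at t within {0..})" if "t \<ge> 0" for t
      by (rule has_vector_derivative_vec) (use der that in \<open>simp add: Yh_def Bh_def\<close>)
    have init: "norm (X s) \<le> G * M0 \<and> norm (U s) \<le> ku * M0" if s: "s \<in> {0..\<tau>}" for s
    proof -
      have U0: "norm (U s) \<le> ku * M0" if "s \<in> {0..\<tau>}" for s
      proof -
        have "norm (X (s - \<tau>)) \<le> M0" using M0 that by simp
        from order_trans[OF U_le mult_left_mono[OF this less_imp_le[OF ku]]] that show ?thesis by simp
      qed
      define N where "N t = X t \<bullet> X t + M0\<^sup>2" for t
      have "N s \<le> N 0 * exp (g * (s - 0))"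
      proof (rule gronwall_on_interval)
        show "0 \<le> s" using s by simp
        fix t assume t: "t \<in> {0..s}"
        show "(N has_real_derivative 2 * (X t \<bullet> (Yh (X t) + Bh (U t) + \<Delta> t))) (at t within {0..s})"
        proof -
          have "(X has_vector_derivative Yh (X t) + Bh (U t) + \<Delta> t) (at t within {0..s})"
            by (rule has_vector_derivative_within_subset[OF derX]) (use t in auto)
          from has_real_derivative_inner[OF this this] show ?thesis
            unfolding N_def[abs_def] by (auto intro!: derivative_eq_intros simp: inner_commute)
        qed
        let ?x = "norm (X t)"
        have Ut: "norm (U t) \<le> ku * M0" using U0 t s by simp
        have "norm (Yh (X t) + Bh (U t) + \<Delta> t) \<le> y0 * ?x + b * norm (U t) + \<eta>2 * (?x + norm (U t))"
          using norm_triangle_ineq[of "Yh (X t) + Bh (U t)" "\<Delta> t"] norm_triangle_ineq[of "Yh (X t)" "Bh (U t)"]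
            y0(2)[of "X t"] Bh_le[of "U t"] \<Delta> t by fastforce
        also have "\<dots> \<le> y0 * ?x + b * norm (U t) + 1 * (?x + norm (U t))"
          using \<eta>2 by (intro add_left_mono mult_right_mono) auto
        also have "\<dots> = (y0 + 1) * ?x + (b + 1) * norm (U t)" by (simp add: algebra_simps)
        also have "\<dots> \<le> (y0 + 1) * ?x + (b + 1) * (ku * M0)" using Ut b by (intro add_left_mono mult_left_mono) auto
        finally have le: "norm (Yh (X t) + Bh (U t) + \<Delta> t) \<le> (y0 + 1) * ?x + (b + 1) * (ku * M0)" .
        have "2 * (X t \<bullet> (Yh (X t) + Bh (U t) + \<Delta> t)) \<le> 2 * (?x * ((y0 + 1) * ?x + (b + 1) * (ku * M0)))"
          using norm_cauchy_schwarz[of "X t" "Yh (X t) + Bh (U t) + \<Delta> t"] mult_left_mono[OF le, of ?x] by simp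
        also have "\<dots> = 2 * (y0 + 1) * ?x\<^sup>2 + (b + 1) * ku * (2 * ?x * M0)" by (simp add: algebra_simps power2_eq_square)
        also have "\<dots> \<le> 2 * (y0 + 1) * (?x\<^sup>2 + M0\<^sup>2) + (b + 1) * ku * (?x\<^sup>2 + M0\<^sup>2)"
          using y0 b ku sum_squares_bound[of ?x M0] by (intro add_mono mult_left_mono) auto
        also have "\<dots> = g * N t" by (simp add: g_def N_def power2_norm_eq_inner algebra_simps)
        finally show "2 * (X t \<bullet> (Yh (X t) + Bh (U t) + \<Delta> t)) \<le> g * N t" .
      qed
      also have "\<dots> \<le> (2 * M0\<^sup>2) * exp (g * \<tau>)"
      proof (rule mult_mono)
        have "(norm (X 0))\<^sup>2 \<le> M0\<^sup>2" using M0 \<tau> by (intro power_mono) auto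
        then show "N 0 \<le> 2 * M0\<^sup>2" by (simp add: N_def power2_norm_eq_inner)
        show "exp (g * (s - 0)) \<le> exp (g * \<tau>)" using s g by simp
      qed simp_all
      also have "\<dots> = (G * M0)\<^sup>2" by (simp add: G_def power_mult_distrib)
      finally have "(norm (X s))\<^sup>2 \<le> (G * M0)\<^sup>2" by (simp add: N_def power2_norm_eq_inner) (smt (verit) zero_le_power2)
      then have "norm (X s) \<le> G * M0" by (rule power2_le_imp_le) (use G M00 in simp)
      then show ?thesis using U0[OF s] by simp
    qed
    have late: "\<forall>t\<ge>\<tau>. norm (X t) \<le> \<kappa> * ((G + ku) * M0) * exp (- \<alpha> * t)"
    proof (rule decay[unfolded delayed_feedback_decay_def, THEN spec, THEN spec, THEN spec, THEN spec, THEN spec, THEN mp, THEN mp, THEN mp, THEN mp, THEN mp, THEN mp, THEN mp, of X U \<Delta> r])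
      show "continuous_on {0..} X" "continuous_on {0..} U" by (rule cX0, rule cU)
      show "\<forall>t\<ge>\<tau>. (X has_vector_derivative Yh (X t) + Bh (U t) + \<Delta> t) (at t within {\<tau>..})"
        using \<tau> by (auto intro!: has_vector_derivative_within_subset[OF derX])
      show "\<forall>t\<ge>\<tau>. norm (\<Delta> t) \<le> \<eta> * (norm (X t) + norm (U t))"
      proof (intro allI impI)
        fix t assume "t \<ge> \<tau>"
        then have "norm (\<Delta> t) \<le> \<eta>2 * (norm (X t) + norm (U t))" using \<Delta> \<tau> by simp
        also have "\<dots> \<le> \<eta> * (norm (X t) + norm (U t))" using \<eta>2 by (intro mult_right_mono) auto
        finally show "norm (\<Delta> t) \<le> \<eta> * (norm (X t) + norm (U t))" .
      qed
      show "\<forall>t\<ge>\<tau>. U t = Kh (X t - r t)" using UE \<tau> by (simp add: r_def)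
      show "\<forall>s\<in>{0..\<tau>}. norm (X s) \<le> (G + ku) * M0 \<and> norm (U s) \<le> (G + ku) * M0"
      proof
        fix s assume "s \<in> {0..\<tau>}"
        from init[OF this] show "norm (X s) \<le> (G + ku) * M0 \<and> norm (U s) \<le> (G + ku) * M0"
          using mult_nonneg_nonneg[OF less_imp_le[OF G] M00] mult_nonneg_nonneg[OF less_imp_le[OF ku] M00]
          unfolding distrib_right by linarith
      qed
      show "\<forall>t\<ge>\<tau>. norm (r t) \<le> \<phi> * integral {t - \<tau>..t} (\<lambda>s. norm (U s) + \<eta> * norm (X s))"
      proof (intro allI impI)
        fix t assume t: "t \<ge> \<tau>"
        let ?g = "\<lambda>s. m * ((b + 1) * (norm (U s) + \<eta> * norm (X s)))"
        have cg: "continuous_on {t - \<tau>..t} (\<lambda>s. norm (U s) + \<eta> * norm (X s))"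
          by (intro continuous_intros continuous_on_subset[OF cX0] continuous_on_subset[OF cU]) (use t in auto)
        have "norm (r t $ i) \<le> integral {t - \<tau>..t} ?g" for i
        proof -
          have "norm (X t $ i - flow Y (t - (t - \<tau>)) (X (t - \<tau>) $ i)) \<le> integral {t - \<tau>..t} ?g"
          proof (rule variation_bound[OF Y, where f = "\<lambda>s. B (U s $ i) + \<Delta> s $ i" and m = m])
            show "t - \<tau> \<le> t" using \<tau> by simp
            show "((\<lambda>s. X s $ i) has_vector_derivative Y (X s $ i) + (B (U s $ i) + \<Delta> s $ i)) (at s within {t - \<tau>..t})"
              if "s \<in> {t - \<tau>..t}" for s
            proof (rule has_vector_derivative_within_subset[where S = "{0..}"])
              show "((\<lambda>s. X s $ i) has_vector_derivative Y (X s $ i) + (B (U s $ i) + \<Delta> s $ i)) (at s within {0..})"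
                using der that t by (simp add: add.assoc)
            qed (use t in auto)
            show "norm (flow Y s y) \<le> m * norm y" if "s \<in> {0..t - (t - \<tau>)}" for s y
              using m(2)[of s y] that by simp
            show "?g integrable_on {t - \<tau>..t}" by (intro integrable_continuous_interval continuous_on_mult_left cg)
            show "m * norm (B (U s $ i) + \<Delta> s $ i) \<le> ?g s" if "s \<in> {t - \<tau>..t}" for s
            proof (rule mult_left_mono)
              have s0: "s \<ge> 0" using that t by simp
              have "norm (B (U s $ i) + \<Delta> s $ i) \<le> norm (B (U s $ i)) + norm (\<Delta> s $ i)" by (rule norm_triangle_ineq)
              also have "\<dots> \<le> b * norm (U s $ i) + norm (\<Delta> s)"
                by (intro add_mono b Finite_Cartesian_Product.norm_nth_le)
              also have "\<dots> \<le> b * norm (U s) + \<eta>2 * (norm (X s) + norm (U s))"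
                using \<Delta> s0 b(1) by (intro add_mono mult_left_mono Finite_Cartesian_Product.norm_nth_le) auto
              also have "\<dots> = b * norm (U s) + \<eta>2 * norm (U s) + \<eta>2 * norm (X s)" by (simp add: algebra_simps)
              also have "\<dots> \<le> b * norm (U s) + 1 * norm (U s) + (b + 1) * (\<eta> * norm (X s))"
              proof (intro add_mono mult_right_mono order_refl \<eta>2 norm_ge_zero)
                have "\<eta>2 * norm (X s) \<le> \<eta> * norm (X s)" using \<eta>2 by (intro mult_right_mono) auto
                also have "\<dots> \<le> (b + 1) * (\<eta> * norm (X s))" using b(1) \<eta> by (simp add: distrib_right)
                finally show "\<eta>2 * norm (X s) \<le> (b + 1) * (\<eta> * norm (X s))" .
              qed
              also have "\<dots> = (b + 1) * (norm (U s) + \<eta> * norm (X s))" by (simp add: algebra_simps)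
              finally show "norm (B (U s $ i) + \<Delta> s $ i) \<le> (b + 1) * (norm (U s) + \<eta> * norm (X s))" .
            qed (use m in simp)
          qed
          then show ?thesis by (simp add: r_def E_def)
        qed
        then have "(\<Sum>i\<in>UNIV. norm (r t $ i)) \<le> (\<Sum>i\<in>(UNIV::'N set). integral {t - \<tau>..t} ?g)" by (intro sum_mono)
        then have "norm (r t) \<le> real CARD('N) * integral {t - \<tau>..t} ?g"
          using norm_vec_le_sum[of "r t"] by simp
        then show "norm (r t) \<le> \<phi> * integral {t - \<tau>..t} (\<lambda>s. norm (U s) + \<eta> * norm (X s))"
          by (simp add: \<phi>_def mult_ac)
      qed
    qed
    show ?thesis
    proof (cases "t \<ge> \<tau>")
      case True
      then have "norm (X t) \<le> \<kappa> * (G + ku) * (M0 * exp (- \<alpha> * t))" using late[rule_format, OF True] by (simp only: mult_ac)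
      also have "\<dots> \<le> \<kappa>' * (M0 * exp (- \<alpha> * t))"
        using G M00 by (intro mult_right_mono) (auto simp: \<kappa>'_def)
      finally show ?thesis by (simp add: mult_ac)
    next
      case False
      then have "norm (X t) \<le> G * M0" using init t by simp
      also have "\<dots> \<le> G * M0 * exp (\<alpha> * (\<tau> - t))"
        using False \<alpha> mult_left_mono[of 1 "exp (\<alpha> * (\<tau> - t))" "G * M0"] G M00 by simp
      also have "\<dots> = (G * exp (\<alpha> * \<tau>)) * (M0 * exp (- \<alpha> * t))" by (simp add: algebra_simps flip: exp_add)
      also have "\<dots> \<le> \<kappa>' * (M0 * exp (- \<alpha> * t))"
        using \<kappa> G ku M00 by (intro mult_right_mono) (auto simp: \<kappa>'_def)
      finally show ?thesis by (simp add: mult_ac)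
    qed
  qed
  have "network_decays H \<tau> Y B K \<eta>2 \<kappa>' \<alpha>"
    unfolding network_decays_def by (intro allI impI, rule core) assumption+
  with linK \<eta>2(1) \<kappa>' \<alpha> show ?thesis by blast
qed

section \<open>The closed loop in internal-model coordinates\<close>

lemma matrix_sum_inverse:
  fixes y :: "'N::finite \<Rightarrow> 'a::real_vector" and L R :: "real^'N^'N"
  assumes "L ** R = mat 1"
  shows "(\<Sum>j\<in>UNIV. L $ i $ j *\<^sub>R (\<Sum>k\<in>UNIV. R $ j $ k *\<^sub>R y k)) = y i"
proof -
  have "(\<Sum>j\<in>UNIV. L $ i $ j *\<^sub>R (\<Sum>k\<in>UNIV. R $ j $ k *\<^sub>R y k)) = (\<Sum>k\<in>UNIV. (\<Sum>j\<in>UNIV. L $ i $ j * R $ j $ k) *\<^sub>R y k)"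
    by (simp add: scaleR_sum_right scaleR_sum_left sum.swap[of "\<lambda>j k. (L $ i $ j * R $ j $ k) *\<^sub>R y k"])
  also have "\<dots> = (\<Sum>k\<in>UNIV. (if i = k then 1 else 0) *\<^sub>R y k)"
    using arg_cong[OF assms, of "\<lambda>M. M $ i $ _"] by (simp add: matrix_matrix_mult_def mat_def vec_eq_iff assms[unfolded vec_eq_iff matrix_matrix_mult_def mat_def, simplified])
  also have "\<dots> = (\<Sum>k\<in>UNIV. if i = k then y k else 0)" by (rule sum.cong) auto
  finally show ?thesis by simp
qed

lemma grounded_laplacian_row_sum:
  assumes "weighted_adjacency Ed a"
  shows "(\<Sum>k\<in>UNIV. grounded_laplacian a $ i $ k) = a (Some i) None"
  using grounded_laplacian_vec[OF assms, of "\<chi> k. 1" i] by (simp add: matrix_vector_mult_def)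

text \<open>
  The row sums of the grounded Laplacian are the leader weights, so the output of the leader can be distributed
  over the followers: the virtual errors are \<open>H\<close> applied to the regulated errors.
\<close>

lemma virtual_error_laplacian:
  assumes "weighted_adjacency Ed a"
  shows "virtual_error Ed a C F x v i t = (\<Sum>k\<in>UNIV. grounded_laplacian a $ i $ k *\<^sub>R (C $ k *v x t $ k + F *v v t))"
  unfolding virtual_error_def relative_sum_laplacian[OF assms]
  by (simp add: node_output_def scaleR_right_distrib sum.distrib grounded_laplacian_row_sum[OF assms] flip: scaleR_sum_left)

lemma has_vector_derivative_shift:
  assumes f: "(f has_vector_derivative f') (at (t + c) within {a + c..})"
  shows "((\<lambda>s. f (s + c)) has_vector_derivative f') (at t within {a..})"
proof -
  have "((\<lambda>s. s + c) has_vector_derivative 1) (at t within {a..})" by (auto intro!: derivative_eq_intros)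
  moreover have "(f has_vector_derivative f') (at (t + c) within (\<lambda>s. s + c) ` {a..})"
    by (rule has_vector_derivative_within_subset[OF f]) auto
  ultimately show ?thesis using vector_diff_chain_within[of "\<lambda>s. s + c" 1 t "{a..}" f f'] by (simp add: o_def)
qed

lemma norm_matrix_vector_le:
  fixes M :: "real^'n^'k"
  shows "norm (M *v x) \<le> norm M * norm x"
proof -
  have "norm (M *v x) \<le> norm x * norm M"
  proof (rule norm_vec_le)
    show "norm ((M *v x) $ i) \<le> norm x * norm (M $ i)" for i
      using Cauchy_Schwarz_ineq2[of "M $ i" x] by (simp add: matrix_vector_mul_component mult.commute)
  qed simp
  then show ?thesis by (simp add: mult.commute)
qed

text \<open>
  The right-hand side of the closed loop in the coordinates \<open>(x, \<zeta>)\<close> is \<open>direct_part\<close> of the present state plus \<open>input_part\<close>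
  of \<open>network_input\<close> of the delayed state plus \<open>exo_part\<close> of the exosystem state. All followers are treated as one vector
  because their perturbed matrices differ from each other.
\<close>

definition direct_part :: "real^'n^'n^'N \<Rightarrow> real^'n^'p^'N \<Rightarrow> real^'z^'z \<Rightarrow> real^'p^'z \<Rightarrow> ((real^'n) \<times> (real^'z))^'N \<Rightarrow> ((real^'n) \<times> (real^'z))^'N" where
  "direct_part A C G1 G2 X = (\<chi> i. (A $ i *v fst (X $ i), G1 *v snd (X $ i) + G2 *v (C $ i *v fst (X $ i))))"

definition network_input :: "real^'N^'N \<Rightarrow> ('a \<Rightarrow> 'b::real_vector) \<Rightarrow> 'a^'N \<Rightarrow> 'b^'N" where
  "network_input H K X = (\<chi> i. \<Sum>j\<in>UNIV. H $ i $ j *\<^sub>R K (X $ j))"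

definition input_part :: "real^'m^'n^'N \<Rightarrow> real^'m^'N \<Rightarrow> ((real^'n) \<times> (real^'z))^'N" where
  "input_part B U = (\<chi> i. (B $ i *v U $ i, 0))"

definition exo_part :: "real^'q^'n^'N \<Rightarrow> real^'p^'z \<Rightarrow> real^'q^'p \<Rightarrow> real^'q \<Rightarrow> ((real^'n) \<times> (real^'z))^'N" where
  "exo_part E G2 F v = (\<chi> i. (E $ i *v v, G2 *v (F *v v)))"

lemma linear_direct_part: "linear (direct_part A C G1 G2)"
  by (rule linearI) (simp_all add: direct_part_def vec_eq_iff prod_eq_iff matrix_vector_right_distrib matrix_vector_mult_scaleR algebra_simps)

lemma linear_network_input: "linear K \<Longrightarrow> linear (network_input H K)"
  by (rule linearI) (simp_all add: network_input_def vec_eq_iff linear_add linear_cmul scaleR_right_distrib sum.distrib scaleR_sum_right mult.commute)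

lemma linear_input_part: "linear (input_part B)"
  by (rule linearI) (simp_all add: input_part_def vec_eq_iff prod_eq_iff matrix_vector_right_distrib matrix_vector_mult_scaleR algebra_simps)

lemma linear_exo_part: "linear (exo_part E G2 F)"
  by (rule linearI) (simp_all add: exo_part_def vec_eq_iff prod_eq_iff matrix_vector_right_distrib matrix_vector_mult_scaleR algebra_simps)

text \<open>
  Inverting \<open>H\<close> undoes the mixing of the regulated errors in the virtual errors, and the shift by \<open>\<tau>com\<close> undoes their
  delay.
\<close>

definition internal_state :: "real^'N^'N \<Rightarrow> real \<Rightarrow> (real \<Rightarrow> real^'n^'N) \<Rightarrow> (real \<Rightarrow> real^'z^'N) \<Rightarrow> real \<Rightarrow> ((real^'n) \<times> (real^'z))^'N" where
  "internal_state Hi \<tau>com x z t = (\<chi> i. (x t $ i, \<Sum>j\<in>UNIV. Hi $ i $ j *\<^sub>R z (t + \<tau>com) $ j))"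

text \<open>
  In the shifted time the internal models are driven by the present virtual errors, which are \<open>H\<close> applied to the regulated
  errors; \<open>H\<^sup>-\<^sup>1\<close> cancels \<open>H\<close>. The control \<open>Kx (H x)\<^sub>i + Kz z\<^sub>i\<close> is \<open>(H K(x, \<zeta>))\<^sub>i\<close>, since \<open>z = H \<zeta>\<close>, and the shift by
  \<open>\<tau>com\<close> makes both delays equal to \<open>\<tau>\<close>.
\<close>

lemma closed_loop_internal_state:
  fixes A :: "real^'n^'n^'N::finite" and B :: "real^'m^'n^'N" and E :: "real^'q^'n^'N" and C :: "real^'n^'p^'N"
    and K :: "(real^'n) \<times> (real^'z) \<Rightarrow> real^'m" and Hi :: "real^'N^'N"
  assumes wa: "weighted_adjacency Ed a" and delays: "\<tau>com \<ge> 0" "\<tau>con \<ge> 0"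
    and Hi: "grounded_laplacian a ** Hi = mat 1" "Hi ** grounded_laplacian a = mat 1"
    and K: "\<And>x z. K (x, z) = Kx *v x + Kz *v z"
    and cl: "closed_loop (A, B, E, C) S F Ed a \<tau>com \<tau>con G1 G2 Kx Kz x z v"
  defines "X \<equiv> internal_state Hi \<tau>com x z"
  shows "continuous_on {-(\<tau>com + \<tau>con)..} X"
    and "\<And>t. t \<ge> 0 \<Longrightarrow> (X has_vector_derivative direct_part A C G1 G2 (X t)
           + input_part B (network_input (grounded_laplacian a) K (X (t - (\<tau>com + \<tau>con)))) + exo_part E G2 F (v t)) (at t within {0..})"
proof -
  let ?H = "grounded_laplacian a" and ?\<tau> = "\<tau>com + \<tau>con"
  have cx: "continuous_on {- ?\<tau>..} x" and cz: "continuous_on {- ?\<tau>..} z"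
    and dx: "\<And>i t. t \<ge> 0 \<Longrightarrow> ((\<lambda>s. x s $ i) has_vector_derivative
              A $ i *v x t $ i + B $ i *v control Ed a \<tau>com Kx Kz x z i (t - \<tau>con) + E $ i *v v t) (at t within {0..})"
    and dz: "\<And>i t. t \<ge> 0 \<Longrightarrow> ((\<lambda>s. z s $ i) has_vector_derivative
              G1 *v z t $ i + G2 *v virtual_error Ed a C F x v i (t - \<tau>com)) (at t within {0..})"
    using cl unfolding closed_loop_def by auto
  have Hsnd: "(\<Sum>k\<in>UNIV. ?H $ i $ k *\<^sub>R snd (X t $ k)) = z (t + \<tau>com) $ i" for i t
    unfolding X_def internal_state_def using matrix_sum_inverse[OF Hi(1), of i "\<lambda>j. z (t + \<tau>com) $ j"] by simp
  have ctrl: "control Ed a \<tau>com Kx Kz x z i (t - \<tau>con) = network_input ?H K (X (t - ?\<tau>)) $ i" for i t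
  proof -
    have Kp: "K p = Kx *v fst p + Kz *v snd p" for p using K[of "fst p" "snd p"] by simp
    have "network_input ?H K (X (t - ?\<tau>)) $ i = Kx *v (\<Sum>k\<in>UNIV. ?H $ i $ k *\<^sub>R fst (X (t - ?\<tau>) $ k)) + Kz *v (\<Sum>k\<in>UNIV. ?H $ i $ k *\<^sub>R snd (X (t - ?\<tau>) $ k))"
      by (simp add: network_input_def Kp scaleR_right_distrib sum.distrib linear_sum[OF matrix_vector_mul_linear] linear_cmul[OF matrix_vector_mul_linear])
    also have "\<dots> = Kx *v (\<Sum>k\<in>UNIV. ?H $ i $ k *\<^sub>R x (t - \<tau>con - \<tau>com) $ k) + Kz *v z (t - \<tau>con) $ i"
      unfolding Hsnd by (simp add: X_def internal_state_def algebra_simps)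
    finally show ?thesis
      unfolding control_def relative_state_def relative_sum_laplacian[OF wa] by simp
  qed
  have verr: "(\<Sum>j\<in>UNIV. Hi $ i $ j *\<^sub>R virtual_error Ed a C F x v j t) = C $ i *v x t $ i + F *v v t" for i t
    unfolding virtual_error_laplacian[OF wa] by (rule matrix_sum_inverse[OF Hi(2)])
  have czs: "continuous_on {- ?\<tau>..} (\<lambda>t. z (t + \<tau>com))"
    by (rule continuous_on_compose2[OF cz]) (use delays in \<open>auto intro!: continuous_intros\<close>)
  show "continuous_on {- ?\<tau>..} X"
    unfolding X_def internal_state_def[abs_def]
    by (intro continuous_on_vec_lambda continuous_on_Pair continuous_on_sum continuous_on_scaleR continuous_on_const
        bounded_linear.continuous_on[OF bounded_linear_vec_nth] cx czs)
  fix t :: real assume t: "t \<ge> 0"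
  show "(X has_vector_derivative direct_part A C G1 G2 (X t)
           + input_part B (network_input ?H K (X (t - ?\<tau>))) + exo_part E G2 F (v t)) (at t within {0..})"
  proof (rule has_vector_derivative_vec)
    fix i
    have 1: "((\<lambda>s. z (s + \<tau>com) $ j) has_vector_derivative G1 *v z (t + \<tau>com) $ j + G2 *v virtual_error Ed a C F x v j t) (at t within {0..})" for j
    proof (rule has_vector_derivative_shift)
      have "((\<lambda>s. z s $ j) has_vector_derivative G1 *v z (t + \<tau>com) $ j + G2 *v virtual_error Ed a C F x v j (t + \<tau>com - \<tau>com)) (at (t + \<tau>com) within {0..})"
        by (rule dz) (use t delays in simp)
      then have "((\<lambda>s. z s $ j) has_vector_derivative G1 *v z (t + \<tau>com) $ j + G2 *v virtual_error Ed a C F x v j t) (at (t + \<tau>com) within {0..})"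
        by simp
      then show "((\<lambda>s. z s $ j) has_vector_derivative G1 *v z (t + \<tau>com) $ j + G2 *v virtual_error Ed a C F x v j t) (at (t + \<tau>com) within {0 + \<tau>com..})"
        by (rule has_vector_derivative_within_subset) (use delays in auto)
    qed
    have "((\<lambda>s. \<Sum>j\<in>UNIV. Hi $ i $ j *\<^sub>R z (s + \<tau>com) $ j) has_vector_derivative
        (\<Sum>j\<in>UNIV. Hi $ i $ j *\<^sub>R (G1 *v z (t + \<tau>com) $ j + G2 *v virtual_error Ed a C F x v j t))) (at t within {0..})"
      by (intro has_vector_derivative_sum linear_has_vector_derivative[OF linear_scaleR] 1)
    moreover have "(\<Sum>j\<in>UNIV. Hi $ i $ j *\<^sub>R (G1 *v z (t + \<tau>com) $ j + G2 *v virtual_error Ed a C F x v j t)) =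
        G1 *v (\<Sum>j\<in>UNIV. Hi $ i $ j *\<^sub>R z (t + \<tau>com) $ j) + G2 *v (C $ i *v x t $ i + F *v v t)"
      unfolding verr[of i t, symmetric]
      by (simp add: scaleR_right_distrib sum.distrib linear_sum[OF matrix_vector_mul_linear] linear_cmul[OF matrix_vector_mul_linear])
    ultimately have "((\<lambda>s. (x s $ i, \<Sum>j\<in>UNIV. Hi $ i $ j *\<^sub>R z (s + \<tau>com) $ j)) has_vector_derivative
       (A $ i *v x t $ i + B $ i *v control Ed a \<tau>com Kx Kz x z i (t - \<tau>con) + E $ i *v v t,
        G1 *v (\<Sum>j\<in>UNIV. Hi $ i $ j *\<^sub>R z (t + \<tau>com) $ j) + G2 *v (C $ i *v x t $ i + F *v v t))) (at t within {0..})"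
      using has_vector_derivative_Pair[OF dx[OF t, of i]] by simp
    then show "((\<lambda>s. X s $ i) has_vector_derivative (direct_part A C G1 G2 (X t)
           + input_part B (network_input ?H K (X (t - ?\<tau>))) + exo_part E G2 F (v t)) $ i) (at t within {0..})"
      unfolding ctrl
      by (simp add: X_def internal_state_def direct_part_def input_part_def exo_part_def matrix_vector_right_distrib add.assoc)
  qed
qed

lemma norm_block_matrix_vector_le:
  fixes M :: "real^'k^'l^'N"
  shows "norm (M $ i *v y) \<le> norm M * norm y"
proof -
  have "norm (M $ i *v y) \<le> norm (M $ i) * norm y" by (rule norm_matrix_vector_le)
  also have "\<dots> \<le> norm M * norm y"
    by (intro mult_right_mono Finite_Cartesian_Product.norm_nth_le) simp
  finally show ?thesis .
qed

text \<open>
  The deviation enters through \<open>wA\<close>, \<open>wB\<close> and \<open>G2 wC\<close> linearly; the factor \<open>CARD('N)\<close> comes from estimating the norm by the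
  sum of the norms of the components.
\<close>

lemma perturbation_small:
  fixes G2 :: "real^'p::finite^'z::finite"
  assumes \<eta>: "\<eta> > 0"
  shows "\<exists>\<rho>>0. \<forall>(wA :: real^'n::finite^'n^'N::finite) (wB :: real^'m::finite^'n^'N) (wE :: real^'q::finite^'n^'N) (wC :: real^'n^'p^'N) X U.
     norm (wA, wB, wE, wC) < \<rho> \<longrightarrow>
     norm (direct_part wA wC (0 :: real^'z^'z) G2 X + input_part wB U) \<le> \<eta> * (norm X + norm U)"
proof -
  define c where "c = real CARD('N) * (2 + norm G2)"
  have c: "c > 0" by (simp add: c_def add_pos_nonneg)
  show ?thesis
  proof (rule exI[of _ "\<eta> / c"], rule conjI, use \<eta> c in simp, intro allI impI)
    fix wA :: "real^'n^'n^'N" and wB :: "real^'m^'n^'N" and wE :: "real^'q^'n^'N" and wC :: "real^'n^'p^'N"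
      and X :: "((real^'n) \<times> (real^'z))^'N" and U :: "real^'m^'N"
    let ?w = "norm (wA, wB, wE, wC)"
    assume w: "?w < \<eta> / c"
    let ?Z = "direct_part wA wC (0 :: real^'z^'z) G2 X + input_part wB U"
    have nw: "norm wA \<le> ?w" "norm wB \<le> ?w" "norm wC \<le> ?w"
      using norm_fst_le[of wA "(wB, wE, wC)"] norm_snd_le[of "(wB, wE, wC)" wA] norm_fst_le[of wB "(wE, wC)"]
        norm_snd_le[of "(wE, wC)" wB] norm_snd_le[of wC wE] by linarith+
    have comp: "norm (?Z $ i) \<le> (2 + norm G2) * (?w * (norm X + norm U))" for i
    proof -
      have "norm (fst (X $ i)) \<le> norm (X $ i)" by (metis norm_fst_le prod.collapse)
      then have x: "norm (fst (X $ i)) \<le> norm X + norm U"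
        using Finite_Cartesian_Product.norm_nth_le[of X i] norm_ge_zero[of U] by linarith
      have u: "norm (U $ i) \<le> norm X + norm U"
        using Finite_Cartesian_Product.norm_nth_le[of U i] norm_ge_zero[of X] by linarith
      have A: "norm (wA $ i *v fst (X $ i)) \<le> ?w * (norm X + norm U)"
        by (rule order_trans[OF norm_block_matrix_vector_le mult_mono[OF nw(1) x]]) simp_all
      have B: "norm (wB $ i *v U $ i) \<le> ?w * (norm X + norm U)"
        by (rule order_trans[OF norm_block_matrix_vector_le mult_mono[OF nw(2) u]]) simp_all
      have "norm (wC $ i *v fst (X $ i)) \<le> ?w * (norm X + norm U)"
        by (rule order_trans[OF norm_block_matrix_vector_le mult_mono[OF nw(3) x]]) simp_all
      then have C: "norm (G2 *v (wC $ i *v fst (X $ i))) \<le> norm G2 * (?w * (norm X + norm U))"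
        by (intro order_trans[OF norm_matrix_vector_le mult_left_mono]) simp_all
      have "?Z $ i = (wA $ i *v fst (X $ i) + wB $ i *v U $ i, G2 *v (wC $ i *v fst (X $ i)))"
        by (simp add: direct_part_def input_part_def)
      then have "norm (?Z $ i) \<le> norm (wA $ i *v fst (X $ i) + wB $ i *v U $ i) + norm (G2 *v (wC $ i *v fst (X $ i)))"
        by (simp only: norm_Pair_le)
      also have "\<dots> \<le> (2 + norm G2) * (?w * (norm X + norm U))"
        using norm_triangle_ineq[of "wA $ i *v fst (X $ i)" "wB $ i *v U $ i"] A B C
        unfolding distrib_right[of 2 "norm G2"] by linarith
      finally show ?thesis .
    qed
    have "norm ?Z \<le> (\<Sum>i\<in>UNIV. norm (?Z $ i))" by (rule norm_vec_le_sum)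
    also have "\<dots> \<le> (\<Sum>i\<in>(UNIV :: 'N set). (2 + norm G2) * (?w * (norm X + norm U)))" by (rule sum_mono) (rule comp)
    also have "\<dots> = (c * ?w) * (norm X + norm U)" by (simp add: c_def mult_ac)
    also have "\<dots> \<le> \<eta> * (norm X + norm U)"
      using w c by (intro mult_right_mono) (auto simp: field_simps)
    finally show "norm ?Z \<le> \<eta> * (norm X + norm U)" .
  qed
qed

text \<open>
  \<open>Z k\<close> is the \<open>k\<close>-th derivative of the trajectory, obtained by differentiating the equation. The initial function is merely
  continuous, so \<open>Z k\<close> can be differentiated only from time \<open>k \<tau>\<close> on; \<open>Z k\<close> is defined for all times by the recursion, and
  the delay costs one window of length \<open>\<tau>\<close> in each step.
\<close>

lemma derivative_sequence:
  fixes L1 L2 :: "'a::euclidean_space \<Rightarrow> 'a" and L3 :: "real^'q \<Rightarrow> 'a" and S :: "real^'q^'q"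
  assumes L: "linear L1" "linear L2" "linear L3" and \<tau>: "\<tau> \<ge> 0"
    and v: "\<And>t. (v has_vector_derivative S *v v t) (at t)"
    and cX: "continuous_on {-\<tau>..} X"
    and X: "\<And>t. t \<ge> 0 \<Longrightarrow> (X has_vector_derivative L1 (X t) + L2 (X (t - \<tau>)) + L3 (v t)) (at t within {0..})"
  shows "\<exists>Z. Z 0 = X \<and> (\<forall>k t. Z (Suc k) t = L1 (Z k t) + L2 (Z k (t - \<tau>)) + L3 ((mv S ^^ k) (v t))) \<and>
    (\<forall>k. continuous_on {real k * \<tau> - \<tau>..} (Z k)) \<and>
    (\<forall>k. \<forall>t\<ge>real k * \<tau>. (Z k has_vector_derivative Z (Suc k) t) (at t within {real k * \<tau>..}))"
proof -
  define Z where "Z = rec_nat X (\<lambda>k Zk t. L1 (Zk t) + L2 (Zk (t - \<tau>)) + L3 ((mv S ^^ k) (v t)))"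
  have Z0: "Z 0 = X" by (simp add: Z_def)
  have ZS: "Z (Suc k) = (\<lambda>t. L1 (Z k t) + L2 (Z k (t - \<tau>)) + L3 ((mv S ^^ k) (v t)))" for k by (simp add: Z_def)
  have linS: "linear (mv S ^^ k)" for k
    by (induction k) (auto simp: linear_iff matrix_vector_right_distrib matrix_vector_mult_scaleR)
  have dv: "((\<lambda>t. (mv S ^^ k) (v t)) has_vector_derivative (mv S ^^ Suc k) (v t)) (at t within U)" for k t U
    using linear_has_vector_derivative[OF linS has_vector_derivative_at_within[OF v]] by (simp add: funpow_swap1)
  have cv: "continuous_on U (\<lambda>t. (mv S ^^ k) (v t))" for k U
    using dv by (meson continuous_on_eq_continuous_within has_vector_derivative_continuous)
  have cont: "continuous_on {real k * \<tau> - \<tau>..} (Z k)" for k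
  proof (induction k)
    case 0
    then show ?case using cX by (simp add: Z0)
  next
    case (Suc k)
    have c1: "continuous_on {real (Suc k) * \<tau> - \<tau>..} (Z k)"
      by (rule continuous_on_subset[OF Suc.IH]) (use \<tau> in \<open>auto simp: algebra_simps\<close>)
    have c2: "continuous_on {real (Suc k) * \<tau> - \<tau>..} (\<lambda>t. Z k (t - \<tau>))"
      by (rule continuous_on_compose2[OF Suc.IH]) (auto intro!: continuous_intros simp: algebra_simps)
    have "continuous_on {real (Suc k) * \<tau> - \<tau>..} (\<lambda>t. L1 (Z k t) + L2 (Z k (t - \<tau>)) + L3 ((mv S ^^ k) (v t)))"
      using linear_continuous_on_compose[OF c1 L(1)] linear_continuous_on_compose[OF c2 L(2)] linear_continuous_on_compose[OF cv L(3)]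
      by (intro continuous_on_add) (simp_all add: o_def)
    then show ?case by (simp only: ZS)
  qed
  have der: "\<forall>t\<ge>real k * \<tau>. (Z k has_vector_derivative Z (Suc k) t) (at t within {real k * \<tau>..})" for k
  proof (induction k)
    case 0
    then show ?case using X by (simp add: Z0 ZS)
  next
    case (Suc k)
    show ?case
    proof (intro allI impI)
      fix t assume t: "t \<ge> real (Suc k) * \<tau>"
      have d1: "(Z k has_vector_derivative Z (Suc k) t) (at t within {real (Suc k) * \<tau>..})"
        by (rule has_vector_derivative_within_subset[where S = "{real k * \<tau>..}"]) (use Suc.IH t \<tau> in \<open>auto simp: algebra_simps\<close>)
      have d2: "((\<lambda>s. Z k (s + (- \<tau>))) has_vector_derivative Z (Suc k) (t - \<tau>)) (at t within {real (Suc k) * \<tau>..})"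
      proof (rule has_vector_derivative_shift)
        have "real (Suc k) * \<tau> + - \<tau> = real k * \<tau>" by (simp add: algebra_simps)
        then show "(Z k has_vector_derivative Z (Suc k) (t - \<tau>)) (at (t + - \<tau>) within {real (Suc k) * \<tau> + - \<tau>..})"
          using Suc.IH t by (simp add: algebra_simps)
      qed
      have "((\<lambda>t. L1 (Z k t) + L2 (Z k (t + (- \<tau>))) + L3 ((mv S ^^ k) (v t))) has_vector_derivative
          L1 (Z (Suc k) t) + L2 (Z (Suc k) (t - \<tau>)) + L3 ((mv S ^^ Suc k) (v t))) (at t within {real (Suc k) * \<tau>..})"
        by (intro has_vector_derivative_add linear_has_vector_derivative[OF L(1) d1] linear_has_vector_derivative[OF L(2) d2]
            linear_has_vector_derivative[OF L(3) dv])
      then show "(Z (Suc k) has_vector_derivative Z (Suc (Suc k)) t) (at t within {real (Suc k) * \<tau>..})"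
        by (simp only: ZS[of k] ZS[of "Suc k"] diff_conv_add_uminus)
    qed
  qed
  show ?thesis using Z0 ZS cont der by (intro exI[of _ Z]) simp
qed

text \<open>
  \<open>\<Xi> = p(d/dt) X\<close>. Since \<open>p(S) = 0\<close>, the combination of the forcing terms \<open>L3 (S\<^sup>k v)\<close> vanishes.
\<close>

lemma annihilated_combination:
  fixes L1 L2 :: "'a::euclidean_space \<Rightarrow> 'a" and L3 :: "real^'q \<Rightarrow> 'a" and S :: "real^'q^'q" and p :: "real poly"
  assumes L: "linear L1" "linear L2" "linear L3" and \<tau>: "\<tau> \<ge> 0"
    and Z: "\<And>k t. Z (Suc k) t = L1 (Z k t) + L2 (Z k (t - \<tau>)) + L3 ((mv S ^^ k) (v t))"
    and cont: "\<And>k. continuous_on {real k * \<tau> - \<tau>..} (Z k)"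
    and der: "\<And>k t. t \<ge> real k * \<tau> \<Longrightarrow> (Z k has_vector_derivative Z (Suc k) t) (at t within {real k * \<tau>..})"
    and p: "matrix_poly p S = 0"
  defines "T0 \<equiv> real (degree p) * \<tau>"
  defines "\<Xi> \<equiv> \<lambda>t. \<Sum>k\<le>degree p. coeff p k *\<^sub>R Z k t"
  shows "continuous_on {-\<tau>..} (\<lambda>t. \<Xi> (t + T0))"
    and "\<And>t. t \<ge> 0 \<Longrightarrow> ((\<lambda>t. \<Xi> (t + T0)) has_vector_derivative L1 (\<Xi> (t + T0)) + L2 (\<Xi> (t - \<tau> + T0))) (at t within {0..})"
proof -
  have le: "real k * \<tau> \<le> T0" if "k \<le> degree p" for k
    unfolding T0_def using that \<tau> by (intro mult_right_mono) auto
  show "continuous_on {-\<tau>..} (\<lambda>t. \<Xi> (t + T0))"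
    unfolding \<Xi>_def
  proof (intro continuous_on_sum continuous_on_scaleR continuous_on_const)
    fix k assume k: "k \<in> {..degree p}"
    show "continuous_on {-\<tau>..} (\<lambda>t. Z k (t + T0))"
      by (rule continuous_on_compose2[OF cont[of k]]) (use le[of k] k in \<open>auto intro!: continuous_intros\<close>)
  qed
  fix t :: real assume t: "t \<ge> 0"
  have d: "((\<lambda>t. \<Xi> (t + T0)) has_vector_derivative (\<Sum>k\<le>degree p. coeff p k *\<^sub>R Z (Suc k) (t + T0))) (at t within {0..})"
    unfolding \<Xi>_def
  proof (intro has_vector_derivative_sum linear_has_vector_derivative[OF linear_scaleR])
    fix k assume k: "k \<in> {..degree p}"
    show "((\<lambda>t. Z k (t + T0)) has_vector_derivative Z (Suc k) (t + T0)) (at t within {0..})"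
    proof (rule has_vector_derivative_shift, rule has_vector_derivative_within_subset)
      show "(Z k has_vector_derivative Z (Suc k) (t + T0)) (at (t + T0) within {real k * \<tau>..})"
        by (rule der) (use le[of k] k t in auto)
    qed (use le[of k] k in auto)
  qed
  have "(\<Sum>k\<le>degree p. coeff p k *\<^sub>R (mv S ^^ k) (v s)) = 0" for s
    using p matrix_poly_vec[of p S "v s"] by (simp add: poly_act_sum[OF matrix_vector_mul_linear])
  then have "(\<Sum>k\<le>degree p. coeff p k *\<^sub>R Z (Suc k) s) = L1 (\<Xi> s) + L2 (\<Xi> (s - \<tau>)) + L3 0" for s
    unfolding \<Xi>_def Z
    by (simp only: scaleR_right_distrib sum.distrib linear_sum[OF L(1)] linear_sum[OF L(2)] linear_cmul[OF L(1), symmetric] linear_cmul[OF L(2), symmetric]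
          linear_cmul[OF L(3), symmetric] linear_sum[OF L(3), symmetric])
  with d show "((\<lambda>t. \<Xi> (t + T0)) has_vector_derivative L1 (\<Xi> (t + T0)) + L2 (\<Xi> (t - \<tau> + T0))) (at t within {0..})"
    by (simp add: linear_0[OF L(3)] algebra_simps)
qed

section \<open>Robust regulation\<close>

text \<open>
  The perturbed right-hand side is the nominal one plus the part built from the deviations, which is taken as \<open>\<Delta>\<close>.
\<close>

lemma perturbed_decay:
  fixes Ai wA :: "real^'n^'n^'N" and Bi wB :: "real^'m^'n^'N" and Ci wC :: "real^'n^'p^'N" and K :: "(real^'n) \<times> (real^'z) \<Rightarrow> real^'m"
  assumes identical: "\<And>i. Ai $ i = A" "\<And>i. Bi $ i = B" "\<And>i. Ci $ i = C" and K: "linear K" and \<tau>: "\<tau> \<ge> 0"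
    and decay: "network_decays H \<tau> (augmented_dynamics A C G1 G2) (augmented_input B) K \<eta> \<kappa> \<alpha>"
    and small: "\<And>X U. norm (direct_part wA wC (0 :: real^'z^'z) G2 X + input_part wB U) \<le> \<eta> * (norm X + norm U)"
    and cX: "continuous_on {-\<tau>..} X"
    and X: "\<And>t. t \<ge> 0 \<Longrightarrow> (X has_vector_derivative direct_part (Ai + wA) (Ci + wC) G1 G2 (X t)
        + input_part (Bi + wB) (network_input H K (X (t - \<tau>)))) (at t within {0..})"
    and M0: "\<And>s. s \<in> {-\<tau>..0} \<Longrightarrow> norm (X s) \<le> M0" and t: "t \<ge> 0"
  shows "norm (X t) \<le> \<kappa> * M0 * exp (- \<alpha> * t)"
proof -
  define U where "U t = network_input H K (X (t - \<tau>))" for t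
  define \<Delta> where "\<Delta> t = direct_part wA wC (0 :: real^'z^'z) G2 (X t) + input_part wB (U t)" for t
  have c1: "continuous_on {0..} X" by (rule continuous_on_subset[OF cX]) (use \<tau> in auto)
  have "continuous_on {0..} (\<lambda>t. X (t - \<tau>))"
    by (rule continuous_on_compose2[OF cX]) (auto intro!: continuous_intros)
  from linear_continuous_on_compose[OF this linear_network_input[OF K, of H]]
  have c2: "continuous_on {0..} U" by (simp add: U_def[abs_def] o_def)
  have c\<Delta>: "continuous_on {0..} \<Delta>"
    unfolding \<Delta>_def[abs_def]
    using linear_continuous_on_compose[OF c1 linear_direct_part[of wA wC "0 :: real^'z^'z" G2]]
      linear_continuous_on_compose[OF c2 linear_input_part[of wB]]
    by (intro continuous_on_add) (simp_all add: o_def)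
  have der: "((\<lambda>s. X s $ i) has_vector_derivative augmented_dynamics A C G1 G2 (X t $ i) + augmented_input B (U t $ i) + \<Delta> t $ i) (at t within {0..})"
    if "t \<ge> 0" for t i
  proof -
    have "(direct_part (Ai + wA) (Ci + wC) G1 G2 (X t) + input_part (Bi + wB) (U t)) $ i =
        augmented_dynamics A C G1 G2 (X t $ i) + augmented_input B (U t $ i) + \<Delta> t $ i"
      by (simp add: direct_part_def input_part_def \<Delta>_def augmented_dynamics_def augmented_input_def identical
          matrix_vector_mult_add_rdistrib matrix_vector_right_distrib algebra_simps)
    with bounded_linear.has_vector_derivative[OF bounded_linear_vec_nth X[OF that], of i] show ?thesis
      by (simp only: U_def[symmetric])
  qed
  from decay[unfolded network_decays_def, THEN spec[of _ X], THEN spec[of _ U], THEN spec[of _ \<Delta>], THEN spec[of _ M0]]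
  have "\<forall>t\<ge>0. norm (X t) \<le> \<kappa> * M0 * exp (- \<alpha> * t)"
    using cX c\<Delta> der M0 small by (simp add: U_def[unfolded network_input_def] \<Delta>_def)
  then show ?thesis using t by blast
qed

text \<open>
  Decay is known in the coordinates \<open>(x, \<zeta>)\<close>, whose initial function involves \<open>z\<close> up to time \<open>\<tau>com\<close>. On \<open>[0, \<tau>com]\<close> the
  internal models are driven by initial data only, so Gronwall's inequality bounds \<open>z\<close> there by the supremum of the initial function.
  Going back, \<open>z(t) = H \<zeta>(t - \<tau>com)\<close> costs a factor \<open>exp (\<alpha> \<tau>com)\<close>.
\<close>

lemma nominal_exponential_stability:
  fixes Ai :: "real^'n^'n^'N::finite" and Bi :: "real^'m^'n^'N" and Ei :: "real^'q^'n^'N" and Ci :: "real^'n^'p^'N"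
    and K :: "(real^'n) \<times> (real^'z) \<Rightarrow> real^'m" and F :: "real^'q^'p"
  assumes wa: "weighted_adjacency Ed a" and delays: "\<tau>com \<ge> 0" "\<tau>con \<ge> 0"
    and identical: "\<And>i. Ai $ i = A" "\<And>i. Bi $ i = B" "\<And>i. Ci $ i = C"
    and Hi: "grounded_laplacian a ** Hi = mat 1" "Hi ** grounded_laplacian a = mat 1"
    and K: "linear K" "\<And>x z. K (x, z) = Kx *v x + Kz *v z"
    and decay: "network_decays (grounded_laplacian a) (\<tau>com + \<tau>con) (augmented_dynamics A C G1 G2) (augmented_input B) K \<eta> \<kappa> \<alpha>"
    and pos: "\<eta> > 0" "\<kappa> > 0" "\<alpha> > 0"
  shows "exponentially_stable (Ai, Bi, Ei, Ci) S F Ed a \<tau>com \<tau>con G1 G2 Kx Kz"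
proof -
  let ?H = "grounded_laplacian a" and ?\<tau> = "\<tau>com + \<tau>con"
  define Lz where "Lz y = (\<chi> i. G1 *v y $ i)" for y :: "real^'z^'N"
  define Lx where "Lx y = (\<chi> i. G2 *v (\<Sum>k\<in>UNIV. ?H $ i $ k *\<^sub>R (C *v y $ k)))" for y :: "real^'n^'N"
  define J1 where "J1 y = (\<chi> i. (y $ i, 0 :: real^'z))" for y :: "real^'n^'N"
  define J2 where "J2 y = (\<chi> i. (0 :: real^'n, \<Sum>j\<in>UNIV. Hi $ i $ j *\<^sub>R y $ j))" for y :: "real^'z^'N"
  define R1 where "R1 X = (\<chi> i. fst (X $ i))" for X :: "((real^'n) \<times> (real^'z))^'N"
  define R2 where "R2 X = (\<chi> i. \<Sum>k\<in>UNIV. ?H $ i $ k *\<^sub>R snd (X $ k))" for X :: "((real^'n) \<times> (real^'z))^'N"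
  have lin: "linear Lz" "linear J1" "linear R1"
    by (auto intro!: linearI simp: Lz_def J1_def R1_def vec_eq_iff prod_eq_iff matrix_vector_right_distrib matrix_vector_mult_scaleR)
  have lin2: "linear J2" "linear R2"
    by (auto intro!: linearI simp: J2_def R2_def vec_eq_iff prod_eq_iff scaleR_right_distrib sum.distrib sum_distrib_left algebra_simps)
  have lin3: "linear Lx"
  proof (rule linearI)
    fix x y :: "real^'n^'N" and r :: real
    have "(\<Sum>k\<in>UNIV. ?H $ i $ k *\<^sub>R (C *v (x + y) $ k)) = (\<Sum>k\<in>UNIV. ?H $ i $ k *\<^sub>R (C *v x $ k)) + (\<Sum>k\<in>UNIV. ?H $ i $ k *\<^sub>R (C *v y $ k))" for i
      by (simp add: matrix_vector_right_distrib scaleR_right_distrib sum.distrib)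
    then show "Lx (x + y) = Lx x + Lx y"
      unfolding Lx_def by (simp only: matrix_vector_right_distrib) (simp add: vec_eq_iff)
    have "(\<Sum>k\<in>UNIV. ?H $ i $ k *\<^sub>R (C *v (r *\<^sub>R x) $ k)) = r *\<^sub>R (\<Sum>k\<in>UNIV. ?H $ i $ k *\<^sub>R (C *v x $ k))" for i
      by (simp add: matrix_vector_mult_scaleR scaleR_sum_right mult.commute)
    then show "Lx (r *\<^sub>R x) = r *\<^sub>R Lx x"
      unfolding Lx_def by (simp only: matrix_vector_mult_scaleR) (simp add: vec_eq_iff)
  qed
  obtain g1 where g1: "g1 > 0" "\<And>y. norm (Lz y) \<le> g1 * norm y" using linear_bounded_pos[OF lin(1)] by blast
  obtain g2 where g2: "g2 > 0" "\<And>y. norm (Lx y) \<le> g2 * norm y" using linear_bounded_pos[OF lin3] by blast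
  obtain h1 where h1: "h1 > 0" "\<And>y. norm (J1 y) \<le> h1 * norm y" using linear_bounded_pos[OF lin(2)] by blast
  obtain h2 where h2: "h2 > 0" "\<And>y. norm (J2 y) \<le> h2 * norm y" using linear_bounded_pos[OF lin2(1)] by blast
  obtain h3 where h3: "h3 > 0" "\<And>y. norm (R1 y) \<le> h3 * norm y" using linear_bounded_pos[OF lin(3)] by blast
  obtain h4 where h4: "h4 > 0" "\<And>y. norm (R2 y) \<le> h4 * norm y" using linear_bounded_pos[OF lin2(2)] by blast
  define g where "g = 2 * g1 + g2"
  have g: "g > 0" using g1 g2 by (simp add: g_def)
  \<comment> \<open>\<open>|z| \<le> gz M\<close> on \<open>[0, \<tau>com]\<close>, from \<open>|z|\<^sup>2 + M\<^sup>2 \<le> 2 M\<^sup>2 exp (g t)\<close>.\<close>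
  define gz where "gz = sqrt (2 * exp (g * \<tau>com))"
  have "0 \<le> g * \<tau>com" using g delays by simp
  then have "1 \<le> exp (g * \<tau>com)" by simp
  then have "1 \<le> 2 * exp (g * \<tau>com)" by linarith
  then have gz: "gz \<ge> 1" by (simp add: gz_def)
  define h where "h = h1 + h2 * gz"
  have h: "h > 0" using h1 h2 gz by (simp add: h_def add_pos_pos)
  define \<kappa>' where "\<kappa>' = h3 * (\<kappa> * h) + (h4 * (\<kappa> * h) + gz) * exp (\<alpha> * \<tau>com)"
  have \<kappa>': "\<kappa>' > 0" using h h3 h4 gz pos by (simp add: \<kappa>'_def add_pos_pos)
  have bound: "norm (x t, z t) \<le> \<kappa>' * exp (- \<alpha> * t) * (SUP s\<in>{- ?\<tau>..0}. norm (x s, z s))"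
    if cl: "closed_loop (Ai, Bi, Ei, Ci) S F Ed a \<tau>com \<tau>con G1 G2 Kx Kz x z (\<lambda>_. 0)" and t: "t \<ge> 0" for x z t
  proof -
    define M where "M = (SUP s\<in>{- ?\<tau>..0}. norm (x s, z s))"
    have cx: "continuous_on {- ?\<tau>..} x" and cz: "continuous_on {- ?\<tau>..} z"
      and dz: "\<And>i t. t \<ge> 0 \<Longrightarrow> ((\<lambda>s. z s $ i) has_vector_derivative
              G1 *v z t $ i + G2 *v virtual_error Ed a Ci F x (\<lambda>_. 0) i (t - \<tau>com)) (at t within {0..})"
      using cl unfolding closed_loop_def by auto
    have Mle: "norm (x s, z s) \<le> M" if "s \<in> {- ?\<tau>..0}" for s
    proof -
      have "continuous_on {- ?\<tau>..0} (\<lambda>s. norm (x s, z s))"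
        by (intro continuous_intros continuous_on_subset[OF cx] continuous_on_subset[OF cz]) auto
      then have bdd: "bdd_above ((\<lambda>s. norm (x s, z s)) ` {- ?\<tau>..0})"
        by (intro bounded_imp_bdd_above compact_imp_bounded compact_continuous_image) auto
      show ?thesis unfolding M_def by (rule cSUP_upper[OF that bdd])
    qed
    have xM: "norm (x s) \<le> M" and zM: "norm (z s) \<le> M" if "s \<in> {- ?\<tau>..0}" for s
      using order_trans[OF norm_fst_le Mle[OF that]] order_trans[OF norm_snd_le Mle[OF that]] by simp_all
    have M: "M \<ge> 0" using order_trans[OF norm_ge_zero xM[of 0]] delays by simp
    have zle: "norm (z s) \<le> gz * M" if s: "s \<in> {0..\<tau>com}" for s
    proof -
      define N where "N t = z t \<bullet> z t + M\<^sup>2" for t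
      have dzv: "(z has_vector_derivative Lz (z t) + Lx (x (t - \<tau>com))) (at t within {0..})" if "t \<ge> 0" for t
      proof (rule has_vector_derivative_vec)
        fix i
        have "virtual_error Ed a Ci F x (\<lambda>_. 0) i (t - \<tau>com) = (\<Sum>k\<in>UNIV. ?H $ i $ k *\<^sub>R (C *v x (t - \<tau>com) $ k))"
          unfolding virtual_error_laplacian[OF wa] identical by simp
        with dz[OF that, of i] show "((\<lambda>s. z s $ i) has_vector_derivative (Lz (z t) + Lx (x (t - \<tau>com))) $ i) (at t within {0..})"
          by (simp add: Lz_def Lx_def)
      qed
      have "N s \<le> N 0 * exp (g * (s - 0))"
      proof (rule gronwall_on_interval)
        show "0 \<le> s" using s by simp
        fix t assume t: "t \<in> {0..s}"
        have "(z has_vector_derivative Lz (z t) + Lx (x (t - \<tau>com))) (at t within {0..s})"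
          by (rule has_vector_derivative_within_subset[OF dzv]) (use t in auto)
        from has_real_derivative_inner[OF this this]
        show "(N has_real_derivative 2 * (z t \<bullet> (Lz (z t) + Lx (x (t - \<tau>com))))) (at t within {0..s})"
          unfolding N_def[abs_def] by (auto intro!: derivative_eq_intros simp: inner_commute)
        let ?z = "norm (z t)"
        have "norm (x (t - \<tau>com)) \<le> M" by (rule xM) (use t s delays in auto)
        then have "norm (Lx (x (t - \<tau>com))) \<le> g2 * M"
          by (intro order_trans[OF g2(2)] mult_left_mono) (use g2 in auto)
        then have le: "norm (Lz (z t) + Lx (x (t - \<tau>com))) \<le> g1 * ?z + g2 * M"
          using norm_triangle_ineq[of "Lz (z t)" "Lx (x (t - \<tau>com))"] g1(2)[of "z t"] by linarith
        have "2 * (z t \<bullet> (Lz (z t) + Lx (x (t - \<tau>com)))) \<le> 2 * (?z * (g1 * ?z + g2 * M))"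
          using norm_cauchy_schwarz[of "z t" "Lz (z t) + Lx (x (t - \<tau>com))"] mult_left_mono[OF le, of ?z] by simp
        also have "\<dots> = 2 * g1 * ?z\<^sup>2 + g2 * (2 * ?z * M)" by (simp add: algebra_simps power2_eq_square)
        also have "\<dots> \<le> 2 * g1 * (?z\<^sup>2 + M\<^sup>2) + g2 * (?z\<^sup>2 + M\<^sup>2)"
          using g1 g2 sum_squares_bound[of ?z M] by (intro add_mono mult_left_mono) auto
        also have "\<dots> = g * N t" by (simp add: g_def N_def power2_norm_eq_inner algebra_simps)
        finally show "2 * (z t \<bullet> (Lz (z t) + Lx (x (t - \<tau>com)))) \<le> g * N t" .
      qed
      also have "\<dots> \<le> (2 * M\<^sup>2) * exp (g * \<tau>com)"
      proof (rule mult_mono)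
        have "(norm (z 0))\<^sup>2 \<le> M\<^sup>2" using zM delays by (intro power_mono) auto
        then show "N 0 \<le> 2 * M\<^sup>2" by (simp add: N_def power2_norm_eq_inner)
        show "exp (g * (s - 0)) \<le> exp (g * \<tau>com)" using s g by simp
      qed simp_all
      also have "\<dots> = (gz * M)\<^sup>2" by (simp add: gz_def power_mult_distrib)
      finally have "(norm (z s))\<^sup>2 \<le> (gz * M)\<^sup>2"
        using zero_le_power2[of M] unfolding N_def power2_norm_eq_inner by linarith
      then show ?thesis by (rule power2_le_imp_le) (use gz M in simp)
    qed
    define X where "X = internal_state Hi \<tau>com x z"
    have XJ: "X s = J1 (x s) + J2 (z (s + \<tau>com))" for s
      by (simp add: X_def internal_state_def J1_def J2_def vec_eq_iff prod_eq_iff)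
    have init: "norm (X s) \<le> h * M" if s: "s \<in> {- ?\<tau>..0}" for s
    proof -
      have "norm (z (s + \<tau>com)) \<le> gz * M"
      proof (cases "s + \<tau>com \<ge> 0")
        case True
        then show ?thesis using s by (intro zle) auto
      next
        case False
        then have "norm (z (s + \<tau>com)) \<le> M" using s delays by (intro zM) auto
        also have "\<dots> \<le> gz * M" using gz M mult_right_mono[of 1 gz M] by simp
        finally show ?thesis .
      qed
      then have "norm (J2 (z (s + \<tau>com))) \<le> h2 * (gz * M)"
        by (intro order_trans[OF h2(2)] mult_left_mono) (use h2 in auto)
      moreover have "norm (J1 (x s)) \<le> h1 * M"
        using xM[OF s] by (intro order_trans[OF h1(2)] mult_left_mono) (use h1 in auto)
      ultimately show ?thesis
        using norm_triangle_ineq[of "J1 (x s)" "J2 (z (s + \<tau>com))"] unfolding XJ h_def by (simp add: algebra_simps)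
    qed
    have exo: "exo_part E G2 F 0 = 0" for E :: "real^'q^'n^'N" by (simp add: exo_part_def vec_eq_iff prod_eq_iff)
    note cls = closed_loop_internal_state[OF wa delays Hi K(2) cl, folded X_def]
    have Xdec: "norm (X t) \<le> \<kappa> * (h * M) * exp (- \<alpha> * t)" if t: "t \<ge> 0" for t
    proof (rule perturbed_decay[OF identical K(1) _ decay, where wA = 0 and wB = 0 and wC = 0])
      show "norm (direct_part 0 0 (0 :: real^'z^'z) G2 X + input_part 0 U) \<le> \<eta> * (norm X + norm U)" for X :: "((real^'n) \<times> (real^'z))^'N" and U :: "real^'m^'N"
      proof -
        have "direct_part 0 0 (0 :: real^'z^'z) G2 X + input_part 0 U = 0"
          by (simp add: direct_part_def input_part_def vec_eq_iff prod_eq_iff)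
        then show ?thesis using pos by simp
      qed
    qed (use delays cls init t exo in \<open>simp_all\<close>)
    have "norm (x t) \<le> h3 * (\<kappa> * h) * (M * exp (- \<alpha> * t))"
    proof -
      have "x t = R1 (X t)" by (simp add: X_def internal_state_def R1_def vec_eq_iff)
      then have "norm (x t) \<le> h3 * norm (X t)" using h3(2) by simp
      also have "\<dots> \<le> h3 * (\<kappa> * (h * M) * exp (- \<alpha> * t))" using Xdec[OF t] h3 by (intro mult_left_mono) auto
      finally show ?thesis by (simp only: mult_ac)
    qed
    moreover have "norm (z t) \<le> (h4 * (\<kappa> * h) + gz) * exp (\<alpha> * \<tau>com) * (M * exp (- \<alpha> * t))"
    proof (cases "t \<ge> \<tau>com")
      case True
      have "z t = R2 (X (t - \<tau>com))"
        unfolding vec_eq_iff X_def internal_state_def R2_def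
        using matrix_sum_inverse[OF Hi(1), of _ "\<lambda>j. z t $ j"] by simp
      then have "norm (z t) \<le> h4 * norm (X (t - \<tau>com))" using h4(2) by simp
      also have "\<dots> \<le> h4 * (\<kappa> * (h * M) * exp (- \<alpha> * (t - \<tau>com)))" using Xdec[of "t - \<tau>com"] True h4 by (intro mult_left_mono) auto
      also have "exp (- \<alpha> * (t - \<tau>com)) = exp (\<alpha> * \<tau>com) * exp (- \<alpha> * t)" by (simp add: algebra_simps flip: exp_add)
      also have "h4 * (\<kappa> * (h * M) * (exp (\<alpha> * \<tau>com) * exp (- \<alpha> * t))) = (h4 * (\<kappa> * h)) * exp (\<alpha> * \<tau>com) * (M * exp (- \<alpha> * t))"
        by (simp only: mult_ac)
      also have "\<dots> \<le> (h4 * (\<kappa> * h) + gz) * exp (\<alpha> * \<tau>com) * (M * exp (- \<alpha> * t))"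
        using gz M by (intro mult_right_mono) auto
      finally show ?thesis .
    next
      case False
      have "norm (z t) \<le> gz * M" using zle[of t] t False by simp
      also have "\<dots> \<le> gz * M * exp (\<alpha> * (\<tau>com - t))"
        using False pos mult_left_mono[of 1 "exp (\<alpha> * (\<tau>com - t))" "gz * M"] gz M by simp
      also have "exp (\<alpha> * (\<tau>com - t)) = exp (\<alpha> * \<tau>com) * exp (- \<alpha> * t)" by (simp add: algebra_simps flip: exp_add)
      also have "gz * M * (exp (\<alpha> * \<tau>com) * exp (- \<alpha> * t)) = gz * exp (\<alpha> * \<tau>com) * (M * exp (- \<alpha> * t))" by (simp only: mult_ac)
      also have "\<dots> \<le> (h4 * (\<kappa> * h) + gz) * exp (\<alpha> * \<tau>com) * (M * exp (- \<alpha> * t))"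
        using h4 pos h M by (intro mult_right_mono) auto
      finally show ?thesis .
    qed
    ultimately have "norm (x t, z t) \<le> \<kappa>' * (M * exp (- \<alpha> * t))"
      using norm_Pair_le[of "x t" "z t"] unfolding \<kappa>'_def distrib_right[of "h3 * (\<kappa> * h)"] by linarith
    then show ?thesis unfolding M_def[symmetric] by (simp only: mult_ac)
  qed
  then show ?thesis unfolding exponentially_stable_def using \<kappa>' pos(3) by blast
qed

text \<open>
  \<open>\<Xi> = p(d/dt) X\<close>, for the characteristic polynomial \<open>p\<close> of \<open>\<beta>\<close>, solves the perturbed loop without exosystem and decays. In each
  output channel \<open>q\<close> the block of the internal model of follower \<open>i\<close> obeys \<open>\<zeta>' = \<beta> \<zeta> + \<sigma> e\<close> with the \<open>q\<close>-th component
  of the true regulated error, so the readout recovers this error from \<open>\<Xi>\<close>.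
\<close>

lemma perturbed_regulation:
  fixes Ai wA :: "real^'n^'n^'N::finite" and Bi wB :: "real^'m^'n^'N" and Ei wE :: "real^'q^'n^'N" and Ci wC :: "real^'n^'p^'N"
    and G1 :: "real^('p::finite \<times> 's::finite)^('p \<times> 's)" and G2 :: "real^'p^('p \<times> 's)"
    and K :: "(real^'n) \<times> (real^('p \<times> 's)) \<Rightarrow> real^'m" and F :: "real^'q^'p" and S :: "real^'q^'q"
  assumes wa: "weighted_adjacency Ed a" and delays: "\<tau>com \<ge> 0" "\<tau>con \<ge> 0"
    and identical: "\<And>i. Ai $ i = A" "\<And>i. Bi $ i = B" "\<And>i. Ci $ i = C"
    and Hi: "grounded_laplacian a ** Hi = mat 1" "Hi ** grounded_laplacian a = mat 1"
    and K: "linear K" "\<And>x z. K (x, z) = Kx *v x + Kz *v z"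
    and im: "minimal_p_copy_internal_model S G1 G2"
    and decay: "network_decays (grounded_laplacian a) (\<tau>com + \<tau>con) (augmented_dynamics A C G1 G2) (augmented_input B) K \<eta> \<kappa> \<alpha>"
    and \<alpha>: "\<alpha> > 0"
    and small: "\<And>X U. norm (direct_part wA wC (0 :: real^('p \<times> 's)^('p \<times> 's)) G2 X + input_part wB U) \<le> \<eta> * (norm X + norm U)"
    and cl: "closed_loop (Ai + wA, Bi + wB, Ei + wE, Ci + wC) S F Ed a \<tau>com \<tau>con G1 G2 Kx Kz x z v"
  shows "(regulated_error (Ci + wC) F x v i \<longlongrightarrow> 0) at_top"
proof -
  let ?H = "grounded_laplacian a" and ?\<tau> = "\<tau>com + \<tau>con"
  obtain \<beta> :: "real^'s^'s" and \<sigma> :: "real^1^'s" where G1: "G1 = copies \<beta>" and G2: "G2 = (\<chi> i j. copies \<sigma> $ i $ (j, 1))"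
    and min: "is_minimal_polynomial S (char_polynomial \<beta>)" and ctrl: "controllable \<beta> \<sigma>"
    using im unfolding minimal_p_copy_internal_model_def by blast
  define p where "p = char_polynomial \<beta>"
  have p: "matrix_poly p S = 0" "lead_coeff p = 1" using min by (simp_all add: p_def is_minimal_polynomial_def)
  obtain c where c: "\<And>\<zeta> e. (\<forall>k. \<zeta> (Suc k) = \<beta> *v \<zeta> k + e k *\<^sub>R column 1 \<sigma>) \<Longrightarrow> c \<bullet> (\<Sum>k\<le>degree p. coeff p k *\<^sub>R \<zeta> k) = e 0"
    using internal_model_readout[OF ctrl p(2)[unfolded p_def]] unfolding p_def by blast
  define L1 where "L1 = direct_part (Ai + wA) (Ci + wC) G1 G2"
  define L2 where "L2 X = (input_part (Bi + wB) (network_input ?H K X) :: ((real^'n) \<times> (real^('p \<times> 's)))^'N)" for X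
  define L3 where "L3 = exo_part (Ei + wE) G2 F"
  have L: "linear L1" "linear L2" "linear L3"
    unfolding L1_def L3_def L2_def[abs_def]
    using linear_compose[OF linear_network_input[OF K(1)] linear_input_part]
    by (simp_all add: linear_direct_part linear_exo_part o_def)
  define X where "X = internal_state Hi \<tau>com x z"
  have cX: "continuous_on {- ?\<tau>..} X"
    unfolding X_def by (rule closed_loop_internal_state(1)[OF wa delays Hi K(2) cl])
  have dX: "(X has_vector_derivative L1 (X t) + L2 (X (t - ?\<tau>)) + L3 (v t)) (at t within {0..})" if "t \<ge> 0" for t
    unfolding X_def L1_def L2_def L3_def by (rule closed_loop_internal_state(2)[OF wa delays Hi K(2) cl that])
  have v: "(v has_vector_derivative S *v v t) (at t)" for t
    using cl unfolding closed_loop_def by simp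
  have \<tau>: "?\<tau> \<ge> 0" using delays by simp
  have "\<exists>Z. Z 0 = X \<and> (\<forall>k t. Z (Suc k) t = L1 (Z k t) + L2 (Z k (t - ?\<tau>)) + L3 ((mv S ^^ k) (v t))) \<and>
    (\<forall>k. continuous_on {real k * ?\<tau> - ?\<tau>..} (Z k)) \<and>
    (\<forall>k. \<forall>t\<ge>real k * ?\<tau>. (Z k has_vector_derivative Z (Suc k) t) (at t within {real k * ?\<tau>..}))"
    by (rule derivative_sequence[OF L \<tau> v cX]) (rule dX)
  then obtain Z where Z: "Z 0 = X" "\<And>k t. Z (Suc k) t = L1 (Z k t) + L2 (Z k (t - ?\<tau>)) + L3 ((mv S ^^ k) (v t))"
    and cZ: "\<And>k. continuous_on {real k * ?\<tau> - ?\<tau>..} (Z k)"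
    and dZ: "\<And>k t. t \<ge> real k * ?\<tau> \<Longrightarrow> (Z k has_vector_derivative Z (Suc k) t) (at t within {real k * ?\<tau>..})"
    by blast
  define T0 where "T0 = real (degree p) * ?\<tau>"
  define \<Xi> where "\<Xi> t = (\<Sum>k\<le>degree p. coeff p k *\<^sub>R Z k t)" for t
  have c\<Xi>: "continuous_on {- ?\<tau>..} (\<lambda>t. \<Xi> (t + T0))"
    unfolding \<Xi>_def T0_def by (rule annihilated_combination(1)[OF L \<tau> Z(2) cZ _ p(1)]) (rule dZ)
  have d\<Xi>: "((\<lambda>t. \<Xi> (t + T0)) has_vector_derivative L1 (\<Xi> (t + T0)) + L2 (\<Xi> (t - ?\<tau> + T0))) (at t within {0..})" if t: "t \<ge> 0" for t
    unfolding \<Xi>_def T0_def by (rule annihilated_combination(2)[OF L \<tau> Z(2) cZ _ p(1) t]) (rule dZ)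
  obtain M0 where M0: "\<And>s. s \<in> {- ?\<tau>..0} \<Longrightarrow> norm (\<Xi> (s + T0)) \<le> M0"
  proof -
    have "continuous_on {- ?\<tau>..0} (\<lambda>t. \<Xi> (t + T0))" by (rule continuous_on_subset[OF c\<Xi>]) auto
    then have "bounded ((\<lambda>t. \<Xi> (t + T0)) ` {- ?\<tau>..0})" by (intro compact_imp_bounded compact_continuous_image) auto
    then show thesis using that unfolding bounded_iff by blast
  qed
  have dec: "norm (\<Xi> (t + T0)) \<le> \<kappa> * M0 * exp (- \<alpha> * t)" if t: "t \<ge> 0" for t
  proof (rule perturbed_decay[OF identical K(1) \<tau> decay small c\<Xi> _ _ t])
    show "((\<lambda>t. \<Xi> (t + T0)) has_vector_derivative direct_part (Ai + wA) (Ci + wC) G1 G2 (\<Xi> (t + T0))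
        + input_part (Bi + wB) (network_input ?H K (\<Xi> (t - ?\<tau> + T0)))) (at t within {0..})" if "t \<ge> 0" for t
      using d\<Xi>[OF that] unfolding L1_def L2_def .
    show "norm (\<Xi> (s + T0)) \<le> M0" if "s \<in> {- ?\<tau>..0}" for s by (rule M0[OF that])
  qed
  have lim: "(\<Xi> \<longlongrightarrow> 0) at_top"
  proof (rule Lim_null_comparison)
    show "\<forall>\<^sub>F t in at_top. norm (\<Xi> t) \<le> \<kappa> * M0 * exp (- \<alpha> * (t - T0))"
      using eventually_ge_at_top[of T0]
    proof eventually_elim
      case (elim t)
      then show ?case using dec[of "t - T0"] by simp
    qed
    have "((\<lambda>t. \<kappa> * M0 * exp (- \<alpha> * (t - T0))) \<longlongrightarrow> \<kappa> * M0 * 0) at_top"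
    proof (intro tendsto_mult tendsto_const filterlim_compose[OF exp_at_bot])
      have "filterlim (\<lambda>t. t - T0) at_top at_top"
        using filterlim_tendsto_add_at_top[OF tendsto_const[of "- T0"] filterlim_ident] by simp
      then have "filterlim (\<lambda>t. \<alpha> * (t - T0)) at_top at_top"
        by (rule filterlim_tendsto_pos_mult_at_top[OF tendsto_const \<alpha>])
      then show "filterlim (\<lambda>t. - \<alpha> * (t - T0)) at_bot at_top"
        by (simp add: filterlim_uminus_at_bot)
    qed
    then show "((\<lambda>t. \<kappa> * M0 * exp (- \<alpha> * (t - T0))) \<longlongrightarrow> 0) at_top" by simp
  qed
  have read: "regulated_error (Ci + wC) F x v i t $ q = c \<bullet> block (snd (\<Xi> t $ i)) q" for t q
  proof -
    define e where "e k = ((Ci + wC) $ i *v fst (Z k t $ i) + F *v (mv S ^^ k) (v t)) $ q" for k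
    define \<zeta> where "\<zeta> k = block (snd (Z k t $ i)) q" for k
    have "\<zeta> (Suc k) = \<beta> *v \<zeta> k + e k *\<^sub>R column 1 \<sigma>" for k
    proof -
      have "snd (Z (Suc k) t $ i) = G1 *v snd (Z k t $ i) + G2 *v ((Ci + wC) $ i *v fst (Z k t $ i) + F *v (mv S ^^ k) (v t))"
        unfolding Z(2) by (simp add: L1_def L2_def L3_def direct_part_def input_part_def exo_part_def matrix_vector_right_distrib)
      then show ?thesis
        unfolding \<zeta>_def e_def by (simp only: linear_add[OF linear_block] G1 G2 block_copies block_input)
    qed
    then have "c \<bullet> (\<Sum>k\<le>degree p. coeff p k *\<^sub>R \<zeta> k) = e 0" by (intro c) blast
    moreover have "(\<Sum>k\<le>degree p. coeff p k *\<^sub>R \<zeta> k) = block (snd (\<Xi> t $ i)) q"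
    proof -
      have "snd (\<Xi> t $ i) = (\<Sum>k\<le>degree p. coeff p k *\<^sub>R snd (Z k t $ i))"
        by (simp add: \<Xi>_def sum_component snd_sum)
      then show ?thesis unfolding \<zeta>_def by (simp only: linear_sum[OF linear_block] linear_cmul[OF linear_block])
    qed
    moreover have "e 0 = regulated_error (Ci + wC) F x v i t $ q"
      by (simp add: e_def Z(1) X_def internal_state_def regulated_error_def node_output_def)
    ultimately show ?thesis by simp
  qed
  show ?thesis
  proof (rule vec_tendstoI)
    fix q
    have "linear (\<lambda>Y :: ((real^'n) \<times> (real^('p \<times> 's)))^'N. c \<bullet> block (snd (Y $ i)) q)"
      by (simp add: linear_iff linear_add[OF linear_block] linear_cmul[OF linear_block] inner_add_right)
    then have "bounded_linear (\<lambda>Y :: ((real^'n) \<times> (real^('p \<times> 's)))^'N. c \<bullet> block (snd (Y $ i)) q)"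
      by (simp add: linear_conv_bounded_linear)
    from bounded_linear.tendsto_zero[OF this lim]
    show "((\<lambda>t. regulated_error (Ci + wC) F x v i t $ q) \<longlongrightarrow> 0 $ q) at_top" by (simp add: read)
  qed
qed

lemma spanning_tree_imp_regulation:
  fixes Ai :: "real^'n^'n^'N" and Bi :: "real^'m^'n^'N"
    and Ei :: "real^'q^'n^'N" and Ci :: "real^'n^'p^'N"
    and A :: "real^'n^'n" and B :: "real^'m^'n" and C :: "real^'n^'p"
    and S :: "real^'q^'q" and F :: "real^'q^'p"
    and Ed :: "('N::finite option \<times> 'N option) set" and a :: "'N option \<Rightarrow> 'N option \<Rightarrow> real"
    and G1 :: "real^('p \<times> 's::finite)^('p \<times> 's)" and G2 :: "real^'p^('p \<times> 's)"
  assumes delays: "\<tau>com \<ge> 0" "\<tau>con \<ge> 0"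
    and leader: "\<And>j. (j, None) \<notin> Ed"
    and wa: "weighted_adjacency Ed a"
    and identical: "\<And>i. Ai $ i = A" "\<And>i. Bi $ i = B" "\<And>i. Ci $ i = C"
    and S: "\<And>\<mu>. \<mu> \<in> eigenvalues S \<Longrightarrow> Re \<mu> = 0"
    and stab: "stabilizable A B"
    and rank: "\<And>\<mu>. \<mu> \<in> eigenvalues S \<Longrightarrow>
      rank (block_matrix (map_matrix complex_of_real A - mat \<mu>) (map_matrix complex_of_real B)
                         (map_matrix complex_of_real C) (0 :: complex^'m^'p)) = CARD('n) + CARD('p)"
    and A: "\<And>\<mu>. \<mu> \<in> eigenvalues A \<Longrightarrow> \<not> Re \<mu> > 0"
    and im: "minimal_p_copy_internal_model S G1 G2"
    and tree: "contains_directed_spanning_tree Ed None"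
  shows "\<exists>(Kx :: real^'n^'m) (Kz :: real^('p \<times> 's)^'m).
            solves_cooperative_robust_output_regulation (Ai, Bi, Ei, Ci) S F Ed a \<tau>com \<tau>con G1 G2 Kx Kz"
proof -
  let ?H = "grounded_laplacian a" and ?\<tau> = "\<tau>com + \<tau>con"
  have reach: "(None, Some i) \<in> Ed\<^sup>*" for i
    using tree spanning_tree_iff_reachable[OF leader] by blast
  obtain Hi where Hi: "?H ** Hi = mat 1" "Hi ** ?H = mat 1"
    using grounded_laplacian_invertible[OF wa reach] unfolding invertible_def by blast
  from grounded_laplacian_lyapunov[OF wa reach]
  obtain d c where dc: "(\<forall>i::'N. d i > 0) \<and> c > 0 \<and>
    (\<forall>y :: 'N \<Rightarrow> real. c * (\<Sum>i\<in>UNIV. (y i)\<^sup>2) \<le> (\<Sum>i\<in>UNIV. \<Sum>j\<in>UNIV. d i * ?H $ i $ j * y i * y j))" by blast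
  have "\<exists>K. linear K \<and> (\<exists>\<eta>>0. \<exists>\<kappa>>0. \<exists>\<alpha>>0. network_decays ?H ?\<tau> (augmented_dynamics A C G1 G2) (augmented_input B) K \<eta> \<kappa> \<alpha>)"
  proof (rule network_decay[OF linear_augmented_dynamics linear_augmented_input])
    show "?\<tau> \<ge> 0" using delays by simp
    show "a' < 0" if "eigenpair (adjoint (augmented_dynamics A C G1 G2)) a' b u v"
      "adjoint (augmented_input B) u = 0" "adjoint (augmented_input B) v = 0" for a' b u v
      by (rule augmented_eigenpairs(2)[OF _ stab _ _ im that]) (fact S rank A)+
    show "a' \<le> 0" if "eigenpair (adjoint (augmented_dynamics A C G1 G2)) a' b u v" for a' b u v
      by (rule augmented_eigenpairs(1)[OF _ stab _ _ im that]) (fact S rank A)+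
    show "d i > 0" for i using dc by blast
    show "c > 0" using dc by blast
    show "c * (\<Sum>i\<in>UNIV. (y i)\<^sup>2) \<le> (\<Sum>i\<in>UNIV. \<Sum>j\<in>UNIV. d i * ?H $ i $ j * y i * y j)" for y using dc by blast
  qed
  then obtain K \<eta> \<kappa> \<alpha> where K: "linear K" and pos: "\<eta> > 0" "\<kappa> > 0" "\<alpha> > 0"
    and decay: "network_decays ?H ?\<tau> (augmented_dynamics A C G1 G2) (augmented_input B) K \<eta> \<kappa> \<alpha>" by blast
  define Kx where "Kx = matrix (\<lambda>x. K (x, 0))"
  define Kz where "Kz = matrix (\<lambda>z. K (0, z))"
  have lin: "linear (\<lambda>x. K (x, 0))" "linear (\<lambda>z. K (0, z))"
    using linear_add[OF K] linear_cmul[OF K] by (auto intro!: linearI) (metis add_Pair add_0 scaleR_Pair scaleR_zero_right)+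
  have Kp: "K (x, z) = Kx *v x + Kz *v z" for x z
    using linear_add[OF K, of "(x, 0)" "(0, z)"] lin[unfolded linear_def scalar_mult_eq_scaleR[abs_def, symmetric]]
    by (simp add: Kx_def Kz_def matrix_works)
  have stable: "exponentially_stable (Ai, Bi, Ei, Ci) S F Ed a \<tau>com \<tau>con G1 G2 Kx Kz"
    by (rule nominal_exponential_stability[OF wa delays identical Hi K Kp decay pos])
  obtain \<rho> where \<rho>: "\<rho> > 0" and small: "\<forall>(wA :: real^'n^'n^'N) (wB :: real^'m^'n^'N) (wE :: real^'q^'n^'N) (wC :: real^'n^'p^'N) X U.
     norm (wA, wB, wE, wC) < \<rho> \<longrightarrow> norm (direct_part wA wC (0 :: real^('p \<times> 's)^('p \<times> 's)) G2 X + input_part wB U) \<le> \<eta> * (norm X + norm U)"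
    using perturbation_small[OF pos(1)] by blast
  have "solves_cooperative_robust_output_regulation (Ai, Bi, Ei, Ci) S F Ed a \<tau>com \<tau>con G1 G2 Kx Kz"
    unfolding solves_cooperative_robust_output_regulation_def
  proof (rule conjI[OF stable], rule exI[of _ "ball 0 \<rho>"], intro conjI ballI allI impI)
    show "open (ball 0 \<rho>)" "0 \<in> ball 0 \<rho>" using \<rho> by simp_all
    fix w :: "('n, 'm, 'p, 'q, 'N) plant" and x z v i
    assume w: "w \<in> ball 0 \<rho>" and cl: "closed_loop ((Ai, Bi, Ei, Ci) + w) S F Ed a \<tau>com \<tau>con G1 G2 Kx Kz x z v"
    obtain wA wB wE wC where weq: "w = (wA, wB, wE, wC)" by (cases w) auto
    have cl': "closed_loop (Ai + wA, Bi + wB, Ei + wE, Ci + wC) S F Ed a \<tau>com \<tau>con G1 G2 Kx Kz x z v"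
      using cl by (simp add: weq)
    have "norm (wA, wB, wE, wC) < \<rho>" using w unfolding weq mem_ball_0 .
    then have sm: "norm (direct_part wA wC (0 :: real^('p \<times> 's)^('p \<times> 's)) G2 X + input_part wB U) \<le> \<eta> * (norm X + norm U)" for X U
      using small by blast
    have "(regulated_error (Ci + wC) F x v i \<longlongrightarrow> 0) at_top"
      by (rule perturbed_regulation[OF wa delays identical Hi K Kp im decay pos(3) sm cl'])
    then show "(regulated_error (snd (snd (snd ((Ai, Bi, Ei, Ci) + w)))) F x v i \<longlongrightarrow> 0) at_top"
      by (simp add: weq)
  qed
  then show ?thesis by blast
qed

theorem theorem4p1:
  fixes Ai :: "real^'n^'n^'N" and Bi :: "real^'m^'n^'N"
    and Ei :: "real^'q^'n^'N" and Ci :: "real^'n^'p^'N"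
    and A :: "real^'n^'n" and B :: "real^'m^'n" and C :: "real^'n^'p"
    and S :: "real^'q^'q" and F :: "real^'q^'p"
    and Ed :: "('N::finite option \<times> 'N option) set" and a :: "'N option \<Rightarrow> 'N option \<Rightarrow> real"
    and \<tau>com \<tau>con :: real
    and G1 :: "real^('p \<times> 's::finite)^('p \<times> 's)" and G2 :: "real^'p^('p \<times> 's)"
  assumes delays: "\<tau>com \<ge> 0" "\<tau>con \<ge> 0"
    and leader: "\<And>j. (j, None) \<notin> Ed"
    and weights: "weighted_adjacency Ed a"
    and identical: "\<And>i. Ai $ i = A" "\<And>i. Bi $ i = B" "\<And>i. Ci $ i = C"
    and S_imaginary: "\<And>\<mu>. \<mu> \<in> eigenvalues S \<Longrightarrow> Re \<mu> = 0"
    and stabilizable: "stabilizable A B"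
    and rank_condition: "\<And>\<mu>. \<mu> \<in> eigenvalues S \<Longrightarrow>
      rank (block_matrix (map_matrix complex_of_real A - mat \<mu>) (map_matrix complex_of_real B)
                         (map_matrix complex_of_real C) (0 :: complex^'m^'p))
        = CARD('n) + CARD('p)"
    and A_no_unstable: "\<And>\<mu>. \<mu> \<in> eigenvalues A \<Longrightarrow> \<not> Re \<mu> > 0"
    and internal_model: "minimal_p_copy_internal_model S G1 G2"
  shows "(\<exists>(Kx :: real^'n^'m) (Kz :: real^('p \<times> 's)^'m).
            solves_cooperative_robust_output_regulation
              (Ai, Bi, Ei, Ci) S F Ed a \<tau>com \<tau>con G1 G2 Kx Kz)
         \<longleftrightarrow> contains_directed_spanning_tree Ed None"
proof
  assume "\<exists>(Kx :: real^'n^'m) (Kz :: real^('p \<times> 's)^'m).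
            solves_cooperative_robust_output_regulation
              (Ai, Bi, Ei, Ci) S F Ed a \<tau>com \<tau>con G1 G2 Kx Kz"
  then obtain Kx :: "real^'n^'m" and Kz :: "real^('p \<times> 's)^'m"
    where stable: "exponentially_stable (Ai, Bi, Ei, Ci) S F Ed a \<tau>com \<tau>con G1 G2 Kx Kz"
    unfolding solves_cooperative_robust_output_regulation_def by blast
  show "contains_directed_spanning_tree Ed None"
    by (rule stable_imp_spanning_tree[OF leader weights identical _ internal_model stable]) (rule S_imaginary)
next
  assume tree: "contains_directed_spanning_tree Ed None"
  show "\<exists>(Kx :: real^'n^'m) (Kz :: real^('p \<times> 's)^'m).
            solves_cooperative_robust_output_regulation
              (Ai, Bi, Ei, Ci) S F Ed a \<tau>com \<tau>con G1 G2 Kx Kz"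
    by (rule spanning_tree_imp_regulation[OF delays leader weights identical _ stabilizable _ _ internal_model tree])
      (fact S_imaginary rank_condition A_no_unstable)+
qed

end
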